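(* Let $w,u\in S_\infty$, let $r\ge1$, and let $v(\lambda,r)\in S_\infty$ be the $r$-shuffle associated with a partition $\lambda$ having at most $r$ parts. Assume that $w$ is an $r$-semi-shuffle or that $\lambda$ is a hook. Then the generalized Littlewood–Richardson coefficient $c^u_{w\,v(\lambda,r)}$ is equal to the number of tableaux of transpositions $T$ of $v(\lambda,r)$ such that $T$ is an $r$-Bruhat chain of $w$, $E(w,T)$ is row and column strict, and $w\,w(T)=u$.
   Context: **Permutations.** $S_\infty$ is the group of permutations of $\mathbb N=\{1,2,\dots\}$ fixing all but finitely many integers; products are compositions of functions; $s_i=t_{i,i+1}$, where $t_{ij}$ is the transposition of $i$ and $j$; $l(w)$ is the Coxeter length. $w$ is an $r$-shuffle if $w(i)<w(i+1)$ for all $i\ne r$, and an $r$-semi-shuffle if $w(i)<w(i+1)$ for all $i>r$. For a partition $\lambda=(\lambda_1\ge\lambda_2\ge\dots)$ with at most $r$ nonzero parts, $v(\lambda,r)$ is the unique $r$-shuffle $v$ with $\lambda_j=v(r+1-j)-r-1+j$ for $1\le j\le r$. $\lambda$ is a hook if $\lambda=(\lambda_1,1,\dots,1)$ (rows and columns included). **Schubert polynomials.** A graph is a finite set $R\subset\mathbb N\times\mathbb N$; the element $(i,j)$ (row $i$ from the top, column $j$ from the left) has label $i+j-1$; reading labels from the top row to the bottom row, right to left in each row, gives a word $i_1\dots i_m$, and $R$ is an rc-graph of $w$ if this word is a reduced word of $w=s_{i_1}\cdots s_{i_m}$. The Schubert polynomial is $\mathfrak S_w=\sum_R x^R$ over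 all rc-graphs $R$ of $w$, where $x^R=\prod_{(i,j)\in R}x_i$ (this agrees with the usual definition of Schubert polynomials). The polynomials $\mathfrak S_w$, $w\in S_\infty$, form a basis of the polynomial ring in $x_1,x_2,\dots$, and the generalized Littlewood–Richardson coefficients $c^u_{wv}$ are defined by $\mathfrak S_w\cdot\mathfrak S_v=\sum_u c^u_{wv}\mathfrak S_u$. **Tableaux.** Boxes of the Young diagram of $\lambda$ ($\lambda_i$ boxes in row $i$, row 1 on top) are numbered $1,\dots,m$ starting with the bottom row and going up, left to right in each row. A tableau of integers is row strict if entries strictly increase left to right and weakly increase top to bottom, and column strict if they weakly increase left to right and strictly increase top to bottom. A tableau of transpositions of $v(\lambda,r)$ is a filling of the diagram of $\lambda$ by pairs $(ab)$ of positive integers with $a\le r<b$. If $T$ has entry $(a_kb_k)$ in box $k$, put $w_i(T)=t_{a_1b_1}\cdots t_{a_ib_i}$ for $1\le i\le m$ and $w(T)=w_m(T)$. $T$ is an $r$-Bruhat chain of $w$ if $l(w\,w_i(T))=l(w)+i$ for $1\le i\le m$. $E(w,T)$ is the tableau of the same shape whose box $i$ contains the integer $w\,w_i(T)(b_i)$. *)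

theory Defs
  imports
    "HOL-Combinatorics.Permutations"
    "HOL-Library.FuncSet"
    "HOL-Library.Poly_Mapping"
begin

subsection \<open>Permutations\<close>

text \<open>Positions and values of permutations start at 1, so a permutation is a function on
  \<^typ>\<open>nat\<close> that fixes 0.\<close>

definition S_inf :: "(nat \<Rightarrow> nat) set" where
  "S_inf = {w. w permutes {1..} \<and> finite {i. w i \<noteq> i}}"

definition simple_refl :: "nat \<Rightarrow> nat \<Rightarrow> nat" where
  "simple_refl i = transpose i (Suc i)"

definition word_perm :: "nat list \<Rightarrow> nat \<Rightarrow> nat" where
  "word_perm is = foldr (\<circ>) (map simple_refl is) id"

definition coxeter_length :: "(nat \<Rightarrow> nat) \<Rightarrow> nat" where
  "coxeter_length w = (LEAST n. \<exists>is. length is = n \<and> set is \<subseteq> {1..} \<and> word_perm is = w)"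

definition reduced_word :: "(nat \<Rightarrow> nat) \<Rightarrow> nat list \<Rightarrow> bool" where
  "reduced_word w is \<longleftrightarrow>
     set is \<subseteq> {1..} \<and> word_perm is = w \<and> length is = coxeter_length w"

definition shuffle :: "nat \<Rightarrow> (nat \<Rightarrow> nat) \<Rightarrow> bool" where
  "shuffle r w \<longleftrightarrow> (\<forall>i\<ge>1. i \<noteq> r \<longrightarrow> w i < w (Suc i))"

definition semi_shuffle :: "nat \<Rightarrow> (nat \<Rightarrow> nat) \<Rightarrow> bool" where
  "semi_shuffle r w \<longleftrightarrow> (\<forall>i>r. w i < w (Suc i))"

subsection \<open>Partitions\<close>

text \<open>A partition is an eventually zero sequence of parts \<open>lam 1 \<ge> lam 2 \<ge> \<dots>\<close>; the value
  \<open>lam 0\<close> is irrelevant and never used.\<close>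

definition is_partition :: "(nat \<Rightarrow> nat) \<Rightarrow> bool" where
  "is_partition lam \<longleftrightarrow> (\<forall>i\<ge>1. lam (Suc i) \<le> lam i) \<and> finite {i. lam i \<noteq> 0}"

definition num_parts :: "(nat \<Rightarrow> nat) \<Rightarrow> nat" where
  "num_parts lam = card {i. 1 \<le> i \<and> lam i \<noteq> 0}"

definition hook :: "(nat \<Rightarrow> nat) \<Rightarrow> bool" where
  "hook lam \<longleftrightarrow> (\<forall>i. 2 \<le> i \<and> i \<le> num_parts lam \<longrightarrow> lam i = 1)"

definition shuffle_of :: "(nat \<Rightarrow> nat) \<Rightarrow> nat \<Rightarrow> nat \<Rightarrow> nat" where
  "shuffle_of lam r = (THE v. v \<in> S_inf \<and> shuffle r v \<and>
     (\<forall>j\<in>{1..r}. int (lam j) = int (v (r + 1 - j)) - int r - 1 + int j))"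

subsection \<open>Schubert polynomials\<close>

text \<open>Integer polynomials in the variables \<open>x\<^sub>i\<close>, as finitely supported maps from exponent
  vectors to coefficients.\<close>

type_synonym mpoly = "(nat \<Rightarrow>\<^sub>0 nat) \<Rightarrow>\<^sub>0 int"

definition var :: "nat \<Rightarrow> mpoly" where
  "var i = Poly_Mapping.single (Poly_Mapping.single i 1) 1"

definition graph_word :: "(nat \<times> nat) set \<Rightarrow> nat list" where
  "graph_word R =
     concat (map (\<lambda>i. map (\<lambda>j. i + j - 1) (rev (sorted_list_of_set {j. (i, j) \<in> R})))
       (sorted_list_of_set (fst ` R)))"

definition rc_graph :: "(nat \<Rightarrow> nat) \<Rightarrow> (nat \<times> nat) set \<Rightarrow> bool" where
  "rc_graph w R \<longleftrightarrow> finite R \<and> R \<subseteq> {1..} \<times> {1..} \<and> reduced_word w (graph_word R)"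

text \<open>There are only finitely many rc-graphs of a given \<open>w \<in> S_inf\<close>: their number of elements
  is the length of \<open>w\<close>, and every label occurs in a reduced word of \<open>w\<close>.\<close>

definition schubert :: "(nat \<Rightarrow> nat) \<Rightarrow> mpoly" where
  "schubert w = (\<Sum>R | rc_graph w R. \<Prod>(i, j)\<in>R. var i)"

text \<open>The coefficients of the expansion in the basis of Schubert polynomials; the unique
  finitely supported family \<open>c\<close> is well defined because the \<open>schubert u\<close>, \<open>u \<in> S_inf\<close>,
  form a basis of the polynomial ring in \<open>x\<^sub>1, x\<^sub>2, \<dots>\<close>.\<close>

definition lr_coeff :: "(nat \<Rightarrow> nat) \<Rightarrow> (nat \<Rightarrow> nat) \<Rightarrow> (nat \<Rightarrow> nat) \<Rightarrow> int" where
  "lr_coeff w v = Poly_Mapping.lookup (THE c :: (nat \<Rightarrow> nat) \<Rightarrow>\<^sub>0 int.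
     Poly_Mapping.keys c \<subseteq> S_inf \<and>
     schubert w * schubert v =
       (\<Sum>u\<in>Poly_Mapping.keys c. of_int (Poly_Mapping.lookup c u) * schubert u))"

subsection \<open>Tableaux\<close>

definition diagram :: "(nat \<Rightarrow> nat) \<Rightarrow> (nat \<times> nat) set" where
  "diagram lam = {(i, j). 1 \<le> i \<and> 1 \<le> j \<and> j \<le> lam i}"

text \<open>The boxes in the order of their numbers: bottom row first, each row from left to right.
  Box number \<open>k\<close> is at list position \<open>k - 1\<close>.\<close>

definition boxes :: "(nat \<Rightarrow> nat) \<Rightarrow> (nat \<times> nat) list" where
  "boxes lam = concat (map (\<lambda>i. map (Pair i) [1..<Suc (lam i)]) (rev [1..<Suc (num_parts lam)]))"

definition box_number :: "(nat \<Rightarrow> nat) \<Rightarrow> nat \<times> nat \<Rightarrow> nat" where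
  "box_number lam x = (THE k. 1 \<le> k \<and> k \<le> length (boxes lam) \<and> boxes lam ! (k - 1) = x)"

definition row_strict :: "(nat \<Rightarrow> nat) \<Rightarrow> (nat \<times> nat \<Rightarrow> nat) \<Rightarrow> bool" where
  "row_strict lam E \<longleftrightarrow>
     (\<forall>i j j'. (i, j) \<in> diagram lam \<and> (i, j') \<in> diagram lam \<and> j < j' \<longrightarrow> E (i, j) < E (i, j')) \<and>
     (\<forall>i i' j. (i, j) \<in> diagram lam \<and> (i', j) \<in> diagram lam \<and> i < i' \<longrightarrow> E (i, j) \<le> E (i', j))"

definition column_strict :: "(nat \<Rightarrow> nat) \<Rightarrow> (nat \<times> nat \<Rightarrow> nat) \<Rightarrow> bool" where
  "column_strict lam E \<longleftrightarrow>
     (\<forall>i j j'. (i, j) \<in> diagram lam \<and> (i, j') \<in> diagram lam \<and> j < j' \<longrightarrow> E (i, j) \<le> E (i, j')) \<and>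
     (\<forall>i i' j. (i, j) \<in> diagram lam \<and> (i', j) \<in> diagram lam \<and> i < i' \<longrightarrow> E (i, j) < E (i', j))"

text \<open>Fillings are extensional functions, so that each tableau is represented exactly once.\<close>

definition transposition_tableaux :: "(nat \<Rightarrow> nat) \<Rightarrow> nat \<Rightarrow> (nat \<times> nat \<Rightarrow> nat \<times> nat) set" where
  "transposition_tableaux lam r = diagram lam \<rightarrow>\<^sub>E {1..r} \<times> {r<..}"

definition partial_perm ::
    "(nat \<Rightarrow> nat) \<Rightarrow> (nat \<times> nat \<Rightarrow> nat \<times> nat) \<Rightarrow> nat \<Rightarrow> nat \<Rightarrow> nat" where
  "partial_perm lam T i =
     foldr (\<circ>) (map (\<lambda>x. transpose (fst (T x)) (snd (T x))) (take i (boxes lam))) id"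

definition tableau_perm ::
    "(nat \<Rightarrow> nat) \<Rightarrow> (nat \<times> nat \<Rightarrow> nat \<times> nat) \<Rightarrow> nat \<Rightarrow> nat" where
  "tableau_perm lam T = partial_perm lam T (length (boxes lam))"

definition bruhat_chain ::
    "(nat \<Rightarrow> nat) \<Rightarrow> (nat \<Rightarrow> nat) \<Rightarrow> (nat \<times> nat \<Rightarrow> nat \<times> nat) \<Rightarrow> bool" where
  "bruhat_chain w lam T \<longleftrightarrow>
     (\<forall>i\<in>{1..length (boxes lam)}.
        coxeter_length (w \<circ> partial_perm lam T i) = coxeter_length w + i)"

definition label_tableau ::
    "(nat \<Rightarrow> nat) \<Rightarrow> (nat \<Rightarrow> nat) \<Rightarrow> (nat \<times> nat \<Rightarrow> nat \<times> nat) \<Rightarrow> nat \<times> nat \<Rightarrow> nat" where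
  "label_tableau w lam T x = w (partial_perm lam T (box_number lam x) (snd (T x)))"

definition strict_chain_tableaux ::
    "(nat \<Rightarrow> nat) \<Rightarrow> (nat \<Rightarrow> nat) \<Rightarrow> nat \<Rightarrow> (nat \<Rightarrow> nat) \<Rightarrow> (nat \<times> nat \<Rightarrow> nat \<times> nat) set" where
  "strict_chain_tableaux w lam r u =
     {T \<in> transposition_tableaux lam r.
        bruhat_chain w lam T \<and>
        row_strict lam (label_tableau w lam T) \<and> column_strict lam (label_tableau w lam T) \<and>
        w \<circ> tableau_perm lam T = u}"

end

theory Submission
  imports Defs
begin

text \<open>For \<open>g\<close> a function on permutations let \<open>U\<^sub>k g\<close> be the sum of \<open>g\<close> over all covers \<open>w < w t\<^sub>a\<^sub>b\<close> with
  \<open>a \<le> r < b\<close> and \<open>w a = k\<close>. Then the sum of \<open>S (w w(T))\<close> over all admissible \<open>T\<close> is the sum, over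
  all row and column strict fillings \<open>F\<close>, of the operator word \<open>U\<^sub>F\<close> of \<open>F\<close> applied to
  \<open>S\<close>. The increasing words of length \<open>m\<close> add up to an operator \<open>H\<^sub>m\<close> which, by Monk's
  rule and a zipper argument, multiplies \<open>S\<close> by the complete symmetric polynomial
  \<open>h\<^sub>m(x\<^sub>1, \<dots>, x\<^sub>r)\<close>; moreover the versions of \<open>H\<^sub>m\<close> restricted to labels \<open>\<ge> k\<close> commute.

  For hooks, \<open>U\<^sub>k U\<^sub>k = 0\<close> allows peeling off rows and columns. For semi-shuffles, expand the
  Jacobi-Trudi determinant and cancel the fillings that are not column strict by exchanging, at the
  first violation \<open>k\<close> between two consecutive rows, the lengths of their tails of labels \<open>> k\<close>. In
  both cases the sum equals \<open>D S(w)\<close> with a polynomial \<open>D\<close> that does not depend on \<open>w\<close>.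
  At \<open>w = id\<close> only one filling contributes, and its end point is \<open>v(\<lambda>, r)\<close>, so
  \<open>D = S(v(\<lambda>, r))\<close>. Linear independence of the Schubert polynomials finishes the proof.\<close>

subsection \<open>Inversions and Bruhat covers\<close>

text \<open>The operators \<open>Uop\<close> with different labels do not commute, so row words
  cannot be rearranged letter by letter; only sums of them behave well. The threshold
  \<open>k\<close> in \<open>Zop\<close> and \<open>Hop\<close> does two jobs. It is the induction
  variable of the zipper, which proves the recursion of the complete symmetric polynomials with
  \<open>Zop\<close> in place of a variable, for all thresholds at once. It also supplies what the
  cancellation needs: the tails of two rows have labels above k, and their lengths may be exchanged
  because the operators with threshold k + 1 commute. For thresholds above 1 this does not come from
  multiplication by polynomials, so it is derived from the commutation of the restricted Monk
  operators. The remaining obstacle is that the two tails are separated by the head of the upper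
  row. Moving a tail past that head is where w has to be a semi-shuffle: then the values at
  positions > r are sorted, and labels already used act as barriers. All operators live on the
  permutations of {1..B}; a cover enlarges the range of a permutation by at most one, so a bound n +
  m \<le> B leaves room for m steps.\<close>

definition perm_inversions :: "(nat \<Rightarrow> nat) \<Rightarrow> (nat \<times> nat) set" where
  "perm_inversions w = {(i, j). i < j \<and> w j < w i}"

definition ilen :: "(nat \<Rightarrow> nat) \<Rightarrow> nat" where
  "ilen w = card (perm_inversions w)"

definition covers :: "(nat \<Rightarrow> nat) \<Rightarrow> nat \<Rightarrow> nat \<Rightarrow> bool" where
  "covers w a b \<longleftrightarrow> ilen (w \<circ> transpose a b) = Suc (ilen w)"

lemma perm_inversions_subset:
  assumes "w permutes {1..B}"
  shows "perm_inversions w \<subseteq> {1..B} \<times> {1..B}"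
proof
  fix p assume "p \<in> perm_inversions w"
  then obtain i j where p: "p = (i, j)" and ij: "i < j" "w j < w i"
    by (auto simp: perm_inversions_def)
  have out: "w x = x" if "x \<notin> {1..B}" for x
    using assms that by (rule permutes_not_in)
  have inn: "w x \<in> {1..B}" if "x \<in> {1..B}" for x
    using permutes_in_image[OF assms] that by blast
  have "i \<in> {1..B}"
  proof (rule ccontr)
    assume n: "i \<notin> {1..B}"
    then have "i = 0 \<or> i > B" by auto
    then show False using ij out[OF n] out[of j] inn[of j] by auto
  qed
  moreover have "j \<in> {1..B}"
  proof (rule ccontr)
    assume n: "j \<notin> {1..B}"
    then show False using ij out[OF n] inn[OF \<open>i \<in> {1..B}\<close>] by auto
  qed
  ultimately show "p \<in> {1..B} \<times> {1..B}" by (simp add: p)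
qed

lemma ilen_as_sum:
  assumes "w permutes {1..B}"
  shows "int (ilen w) = (\<Sum>i\<in>{1..B}. \<Sum>j\<in>{1..B}. if i < j \<and> w j < w i then 1 else 0)"
proof -
  have "perm_inversions w = {p \<in> {1..B} \<times> {1..B}. fst p < snd p \<and> w (snd p) < w (fst p)}"
    using perm_inversions_subset[OF assms] by (auto simp: perm_inversions_def)
  then have "int (ilen w) = (\<Sum>p\<in>{1..B} \<times> {1..B}. if fst p < snd p \<and> w (snd p) < w (fst p) then 1 else 0)"
    by (simp add: ilen_def sum.If_cases Int_def)
  also have "\<dots> = (\<Sum>i\<in>{1..B}. \<Sum>j\<in>{1..B}. if i < j \<and> w j < w i then 1 else 0)"
    by (simp add: sum.cartesian_product split_def)
  finally show ?thesis .
qed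

lemma permutes_comp_transpose:
  assumes "w permutes S" "a \<in> S" "b \<in> S"
  shows "(w \<circ> transpose a b) permutes S"
  using assms by (intro permutes_compose permutes_swap_id)

text \<open>Serves to compare two inversion counts that differ only in pairs meeting {a, b}.\<close>

lemma sum_two_rows:
  fixes f :: "'a \<Rightarrow> 'a \<Rightarrow> 'b::comm_monoid_add"
  assumes "finite A" "a \<in> A" "b \<in> A" "a \<noteq> b"
    and "\<And>i j. i \<notin> {a, b} \<Longrightarrow> j \<notin> {a, b} \<Longrightarrow> f i j = 0"
  shows "(\<Sum>i\<in>A. \<Sum>j\<in>A. f i j) =
    (\<Sum>c\<in>A - {a, b}. f a c + f b c + f c a + f c b) + (f a a + f a b + f b a + f b b)"
proof -
  let ?C = "A - {a, b}"
  have A: "A = insert a (insert b ?C)" using assms by auto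
  have split: "(\<Sum>i\<in>A. g i) = g a + (g b + (\<Sum>i\<in>?C. g i))" for g :: "'a \<Rightarrow> 'b"
    using assms by (subst A) auto
  have z: "(\<Sum>j\<in>?C. f i j) = 0" if "i \<in> ?C" for i
    using that assms(5) by (intro sum.neutral) auto
  show ?thesis
    by (simp add: split sum.distrib z add.assoc) (simp add: ac_simps)
qed

text \<open>Only pairs of positions that meet {a, b} change their status. The pair (a, b) itself
  accounts for 1. The pairs with a third position c account for 2 if c lies between a and b both in
  position and in value, and cancel otherwise.\<close>

lemma ilen_comp_transpose:
  assumes w: "w permutes {1..B}" and ab: "a < b" "a \<in> {1..B}" "b \<in> {1..B}" and lt: "w a < w b"
  shows "ilen (w \<circ> transpose a b) = ilen w + 1 + 2 * card {c. a < c \<and> c < b \<and> w a < w c \<and> w c < w b}"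
proof -
  let ?A = "{1..B}"
  let ?t = "transpose a b"
  let ?E = "{c. a < c \<and> c < b \<and> w a < w c \<and> w c < w b}"
  have tp: "?t permutes ?A" using ab by (intro permutes_swap_id) auto
  have wt: "(w \<circ> ?t) permutes ?A" using w ab by (intro permutes_comp_transpose) auto
  have inj: "w x = w y \<longleftrightarrow> x = y" for x y
    using permutes_inj[OF w] by (auto dest: injD)
  \<comment> \<open>The same pair of values is compared at its new and at its old positions.\<close>
  define f :: "nat \<Rightarrow> nat \<Rightarrow> int" where
    "f i j = (if ?t i < ?t j \<and> w j < w i then 1 else 0) - (if i < j \<and> w j < w i then 1 else 0)" for i j
  have perm: "(\<Sum>i\<in>?A. h (?t i)) = (\<Sum>i\<in>?A. h i)" for h :: "nat \<Rightarrow> int"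
    using sum.permute[OF tp, of h] by (simp add: o_def)
  have "int (ilen (w \<circ> ?t)) = (\<Sum>i\<in>?A. \<Sum>j\<in>?A. if i < j \<and> w (?t j) < w (?t i) then 1 else 0)"
    using ilen_as_sum[OF wt] by simp
  also have "\<dots> = (\<Sum>i\<in>?A. \<Sum>j\<in>?A. if ?t i < j \<and> w (?t j) < w i then 1 else 0)"
    using perm[of "\<lambda>i. \<Sum>j\<in>?A. if ?t i < j \<and> w (?t j) < w i then 1 else 0"] by simp
  also have "\<dots> = (\<Sum>i\<in>?A. \<Sum>j\<in>?A. if ?t i < ?t j \<and> w j < w i then 1 else 0)"
  proof (rule sum.cong[OF refl])
    fix i
    show "(\<Sum>j\<in>?A. if ?t i < j \<and> w (?t j) < w i then 1 else 0) =
        (\<Sum>j\<in>?A. if ?t i < ?t j \<and> w j < w i then 1 else (0::int))"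
      using perm[of "\<lambda>j. if ?t i < ?t j \<and> w j < w i then 1 else 0"] by simp
  qed
  finally have lt_sum: "int (ilen (w \<circ> ?t)) = (\<Sum>i\<in>?A. \<Sum>j\<in>?A. if ?t i < ?t j \<and> w j < w i then 1 else 0)" .
  have "int (ilen (w \<circ> ?t)) - int (ilen w) = (\<Sum>i\<in>?A. \<Sum>j\<in>?A. f i j)"
    unfolding lt_sum ilen_as_sum[OF w] f_def by (simp add: sum_subtractf)
  also have "\<dots> = (\<Sum>c\<in>?A - {a, b}. f a c + f b c + f c a + f c b) + (f a a + f a b + f b a + f b b)"
    using ab by (intro sum_two_rows) (auto simp: f_def)
  also have "f a a + f a b + f b a + f b b = 1"
    using ab lt by (auto simp: f_def)
  also have "(\<Sum>c\<in>?A - {a, b}. f a c + f b c + f c a + f c b) = (\<Sum>c\<in>?A - {a, b}. if c \<in> ?E then 2 else 0)"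
  proof (intro sum.cong refl)
    fix c assume c: "c \<in> ?A - {a, b}"
    then have tc: "?t c = c" by (auto simp: transpose_def)
    show "f a c + f b c + f c a + f c b = (if c \<in> ?E then 2 else 0)"
      using c ab lt inj[of a c] inj[of b c] unfolding f_def tc by auto
  qed
  also have "\<dots> = 2 * int (card ?E)"
  proof -
    have "(?A - {a, b}) \<inter> ?E = ?E" using ab by auto
    then show ?thesis by (simp add: sum.If_cases)
  qed
  finally show ?thesis by linarith
qed

lemma covers_iff:
  assumes w: "w permutes {1..B}" and ab: "a < b" "a \<in> {1..B}" "b \<in> {1..B}"
  shows "covers w a b \<longleftrightarrow> w a < w b \<and> (\<forall>c. a < c \<and> c < b \<longrightarrow> \<not> (w a < w c \<and> w c < w b))"
proof (cases "w a < w b")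
  case True
  have "finite {c. a < c \<and> c < b \<and> w a < w c \<and> w c < w b}"
    by (rule finite_subset[of _ "{..b}"]) auto
  then show ?thesis using ilen_comp_transpose[OF w ab True] True
    by (auto simp: covers_def)
next
  case False
  moreover have "w a \<noteq> w b" using permutes_inj[OF w] ab by (auto dest: injD)
  ultimately have lt: "w b < w a" by simp
  have wt: "(w \<circ> transpose a b) permutes {1..B}" using w ab by (intro permutes_comp_transpose) auto
  have "ilen (w \<circ> transpose a b) < ilen w"
    using ilen_comp_transpose[OF wt ab] lt by (simp add: comp_assoc)
  then show ?thesis using False by (simp add: covers_def)
qed

lemma covers_commute: "covers w a b \<longleftrightarrow> covers w b a"
  by (simp add: covers_def transpose_commute)

lemma ilen_less_iff:
  assumes w: "w permutes {1..B}" and ab: "a < b" "a \<in> {1..B}" "b \<in> {1..B}"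
  shows "ilen w < ilen (w \<circ> transpose a b) \<longleftrightarrow> w a < w b"
    and "ilen (w \<circ> transpose a b) < ilen w \<longleftrightarrow> w b < w a"
proof -
  have ne: "w a \<noteq> w b" using permutes_inj[OF w] ab by (auto dest: injD)
  have wt: "(w \<circ> transpose a b) permutes {1..B}" using w ab by (intro permutes_comp_transpose) auto
  have "ilen w < ilen (w \<circ> transpose a b)" if "w a < w b"
    using ilen_comp_transpose[OF w ab that] by simp
  moreover have "ilen (w \<circ> transpose a b) < ilen w" if "w b < w a"
    using ilen_comp_transpose[OF wt ab] that by (simp add: comp_assoc)
  ultimately show "ilen w < ilen (w \<circ> transpose a b) \<longleftrightarrow> w a < w b"
    "ilen (w \<circ> transpose a b) < ilen w \<longleftrightarrow> w b < w a"
    using ne by force+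
qed

text \<open>For distinct positions this says that the transposition lengthens w. The form is
  symmetric in x and y for injective w, which suits Monk's operator, where the second position may
  lie on either side of the first.\<close>

definition raises :: "(nat \<Rightarrow> nat) \<Rightarrow> nat \<Rightarrow> nat \<Rightarrow> bool" where
  "raises w x y \<longleftrightarrow> (x < y \<longleftrightarrow> w x < w y)"

lemma ilen_less_iff_raises:
  assumes w: "w permutes {1..B}" and ab: "a \<noteq> b" "a \<in> {1..B}" "b \<in> {1..B}"
  shows "ilen w < ilen (w \<circ> transpose a b) \<longleftrightarrow> raises w a b"
proof (cases "a < b")
  case True
  then show ?thesis using ilen_less_iff[OF w _ ab(2,3)] by (simp add: raises_def)
next
  case False
  then have "b < a" using ab by simp
  moreover have "w a \<noteq> w b" using permutes_inj[OF w] ab by (auto dest: injD)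
  ultimately show ?thesis
    using ilen_less_iff[OF w _ ab(3,2)] by (auto simp: raises_def transpose_commute)
qed

text \<open>Each raising step adds at least 1, so a total of 2 forces two covers. The length
  condition now depends on the end point alone; chains with the same end point can therefore be
  compared through the local conditions \<open>raises\<close>.\<close>

lemma two_covers:
  assumes w: "w permutes {1..B}"
    and xy: "x \<noteq> y" "x \<in> {1..B}" "y \<in> {1..B}" "x' \<noteq> y'" "x' \<in> {1..B}" "y' \<in> {1..B}"
  shows "covers w x y \<and> covers (w \<circ> transpose x y) x' y' \<longleftrightarrow>
    raises w x y \<and> raises (w \<circ> transpose x y) x' y' \<and>
    ilen (w \<circ> transpose x y \<circ> transpose x' y') = ilen w + 2"
proof -
  have wt: "(w \<circ> transpose x y) permutes {1..B}" using w xy by (intro permutes_comp_transpose) auto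
  show ?thesis
    using ilen_less_iff_raises[OF w xy(1-3)] ilen_less_iff_raises[OF wt xy(4-6)]
    unfolding covers_def by auto
qed

lemma comp_transpose_inv:
  assumes "w permutes S"
  shows "transpose x y \<circ> w = w \<circ> transpose (inv w x) (inv w y)"
proof
  fix z
  have b: "inj w" "surj w" using permutes_inj[OF assms] permutes_surj[OF assms] .
  show "(transpose x y \<circ> w) z = (w \<circ> transpose (inv w x) (inv w y)) z"
    using b by (auto simp: transpose_def surj_f_inv_f inv_f_f split: if_splits)
qed

text \<open>Left multiplication by \<open>simple_refl j\<close> exchanges the positions of the
  values j and j + 1. No value lies strictly between these, so the correction term of
  \<open>ilen_comp_transpose\<close> vanishes.\<close>

lemma ilen_simple_comp:
  assumes w: "w permutes {1..B}" and j: "1 \<le> j" "Suc j \<le> B"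
  shows "inv w j < inv w (Suc j) \<Longrightarrow> ilen (simple_refl j \<circ> w) = Suc (ilen w)"
    and "inv w (Suc j) < inv w j \<Longrightarrow> ilen w = Suc (ilen (simple_refl j \<circ> w))"
proof -
  have jS: "j \<in> {1..B}" "Suc j \<in> {1..B}" using j by auto
  have up: "ilen (simple_refl j \<circ> v) = Suc (ilen v)"
    if v: "v permutes {1..B}" and l: "inv v j < inv v (Suc j)" for v
  proof -
    have iS: "inv v j \<in> {1..B}" "inv v (Suc j) \<in> {1..B}"
      using permutes_in_image[OF permutes_inv[OF v]] jS by blast+
    have vi: "v (inv v x) = x" for x using permutes_inverses(1)[OF v] .
    show ?thesis
      using ilen_comp_transpose[OF v l iS] by (simp add: simple_refl_def comp_transpose_inv[OF v] vi)
  qed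
  show "inv w j < inv w (Suc j) \<Longrightarrow> ilen (simple_refl j \<circ> w) = Suc (ilen w)"
    using up[OF w] .
  assume d: "inv w (Suc j) < inv w j"
  let ?v = "simple_refl j \<circ> w"
  have sp: "simple_refl j permutes {1..B}" unfolding simple_refl_def using jS by (intro permutes_swap_id)
  have v: "?v permutes {1..B}" using w sp by (rule permutes_compose)
  have "inv ?v = inv w \<circ> simple_refl j"
    using permutes_bij[OF w] permutes_bij[OF sp] by (simp add: o_inv_distrib simple_refl_def)
  then have "inv ?v j < inv ?v (Suc j)" using d by (simp add: simple_refl_def)
  from up[OF v this] show "ilen w = Suc (ilen ?v)"
    by (simp add: simple_refl_def flip: comp_assoc)
qed

section \<open>Descents, reduced words and the Coxeter length\<close>

lemma strict_mono_permutes_id: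
  fixes f :: "nat \<Rightarrow> nat"
  assumes f: "f permutes S" and m: "strict_mono f"
  shows "f = id"
proof
  fix x
  have "strict_mono (inv f)"
  proof (rule strict_monoI)
    fix x y :: nat assume "x < y"
    show "inv f x < inv f y"
    proof (rule ccontr)
      assume "\<not> inv f x < inv f y"
      then have "f (inv f y) \<le> f (inv f x)" using strict_mono_less_eq[OF m] by simp
      then show False using \<open>x < y\<close> permutes_inverses(1)[OF f] by simp
    qed
  qed
  then have "f x \<le> inv f (f x)" by (rule strict_mono_imp_increasing)
  moreover have "x \<le> f x" using m by (rule strict_mono_imp_increasing)
  ultimately show "f x = id x" using permutes_inverses(2)[OF f] by simp
qed

lemma inv_neq_Suc: "w permutes S \<Longrightarrow> inv w j \<noteq> inv w (Suc j)"
  using permutes_inj[OF permutes_inv] by (metis injD n_not_Suc_n)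

text \<open>Without a descent \<open>inv w\<close> is strictly increasing on all natural numbers,
  including the borders at 0 and at B, and hence the identity.\<close>

lemma descent_exists:
  assumes w: "w permutes {1..B}" and ne: "w \<noteq> id"
  obtains j where "1 \<le> j" "Suc j \<le> B" "inv w (Suc j) < inv w j"
proof (rule ccontr)
  assume a: "\<not> thesis"
  have iw: "inv w permutes {1..B}" using w by (rule permutes_inv)
  have "inv w j < inv w (Suc j)" for j
  proof (cases "1 \<le> j \<and> Suc j \<le> B")
    case True
    then have "\<not> inv w (Suc j) < inv w j" using a that by blast
    with inv_neq_Suc[OF w, of j] show ?thesis by simp
  next
    case False
    then consider "j = 0" | "B < Suc j" by auto
    then show ?thesis
    proof cases
      case 1
      have z: "inv w 0 = 0" using permutes_not_in[OF iw, of 0] by simp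
      moreover have "inv w 1 \<noteq> inv w 0" using permutes_inj[OF iw] by (metis injD zero_neq_one)
      ultimately show ?thesis using 1 z by simp
    next
      case 2
      then have s: "inv w (Suc j) = Suc j" using permutes_not_in[OF iw, of "Suc j"] by simp
      have "inv w j \<le> j"
      proof (cases "j \<in> {1..B}")
        case True
        then have "inv w j \<in> {1..B}" using permutes_in_image[OF iw] by blast
        then show ?thesis using 2 by simp
      next
        case False
        then show ?thesis using permutes_not_in[OF iw] by simp
      qed
      then show ?thesis using s by simp
    qed
  qed
  then have "strict_mono (inv w)" by (simp add: strict_mono_Suc_iff)
  then have "inv w = id" using strict_mono_permutes_id[OF iw] by simp
  then have "w = id" by (metis inv_id inv_inv_eq permutes_bij[OF w])
  with ne show False by simp
qed

lemma word_perm_Nil [simp]: "word_perm [] = id"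
  by (simp add: word_perm_def)

lemma word_perm_Cons [simp]: "word_perm (k # ks) = simple_refl k \<circ> word_perm ks"
  by (simp add: word_perm_def)

lemma simple_refl_permutes: "1 \<le> k \<Longrightarrow> Suc k \<le> B \<Longrightarrow> simple_refl k permutes {1..B}"
  unfolding simple_refl_def by (intro permutes_swap_id) auto

lemma word_perm_permutes:
  assumes "set ks \<subseteq> {1..<B}"
  shows "word_perm ks permutes {1..B}"
  using assms
proof (induction ks)
  case (Cons k ks)
  then show ?case
    unfolding word_perm_Cons by (intro permutes_compose simple_refl_permutes) auto
qed (simp add: permutes_id)

lemma ilen_id [simp]: "ilen id = 0"
proof -
  have "perm_inversions id = {}" by (auto simp: perm_inversions_def)
  then show ?thesis by (simp add: ilen_def)
qed

lemma ilen_word_perm_le: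
  assumes "set ks \<subseteq> {1..<B}"
  shows "ilen (word_perm ks) \<le> length ks"
  using assms
proof (induction ks)
  case (Cons k ks)
  let ?v = "word_perm ks"
  have v: "?v permutes {1..B}" using Cons.prems by (intro word_perm_permutes) auto
  have k: "1 \<le> k" "Suc k \<le> B" using Cons.prems by auto
  have "ilen ?v \<le> length ks" using Cons by simp
  moreover have "ilen (simple_refl k \<circ> ?v) \<le> Suc (ilen ?v)"
    using ilen_simple_comp[OF v k] inv_neq_Suc[OF v, of k] by linarith
  ultimately show ?case by (simp add: comp_def)
qed simp

lemma ilen_word_exists:
  assumes "w permutes {1..B}"
  shows "\<exists>ks. set ks \<subseteq> {1..<B} \<and> word_perm ks = w \<and> length ks = ilen w"
  using assms
proof (induction "ilen w" arbitrary: w rule: less_induct)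
  case less
  show ?case
  proof (cases "w = id")
    case True
    then show ?thesis by (intro exI[of _ "[]"]) simp
  next
    case False
    obtain j where j: "1 \<le> j" "Suc j \<le> B" and d: "inv w (Suc j) < inv w j"
      using descent_exists[OF less.prems False] .
    let ?v = "simple_refl j \<circ> w"
    have v: "?v permutes {1..B}"
      using permutes_compose[OF less.prems simple_refl_permutes[OF j]] .
    have l: "ilen w = Suc (ilen ?v)" using ilen_simple_comp(2)[OF less.prems j d] .
    obtain ks where "set ks \<subseteq> {1..<B}" "word_perm ks = ?v" "length ks = ilen ?v"
      using less.hyps[OF _ v] l by auto
    then show ?thesis using j l
      by (intro exI[of _ "j # ks"]) (auto simp: simple_refl_def simp flip: comp_assoc)
  qed
qed

lemma coxeter_length_eq_ilen:
  assumes w: "w permutes {1..B}"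
  shows "coxeter_length w = ilen w"
  unfolding coxeter_length_def
proof (rule Least_equality)
  obtain ks where "set ks \<subseteq> {1..<B}" "word_perm ks = w" "length ks = ilen w"
    using ilen_word_exists[OF w] by blast
  then show "\<exists>is. length is = ilen w \<and> set is \<subseteq> {1..} \<and> word_perm is = w"
    by (intro exI[of _ ks]) auto
next
  fix n assume "\<exists>is. length is = n \<and> set is \<subseteq> {1..} \<and> word_perm is = w"
  then obtain ks where ks: "length ks = n" "set ks \<subseteq> {1..}" "word_perm ks = w" by blast
  \<comment> \<open>The word may use letters beyond B, so the bound is taken in a larger symmetric
    group.\<close>
  have "set ks \<subseteq> {1..<Suc (Max (insert 0 (set ks)))}"
    using ks(2) by (auto simp: less_Suc_eq_le)
  from ilen_word_perm_le[OF this] show "ilen w \<le> n" using ks by simp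
qed

lemma S_inf_permutes:
  assumes "w \<in> S_inf"
  obtains n where "w permutes {1..n}"
proof -
  have w: "w permutes {1..}" and f: "finite {i. w i \<noteq> i}" using assms by (auto simp: S_inf_def)
  let ?n = "Max (insert 0 {i. w i \<noteq> i})"
  have "w permutes {1..?n}"
  proof (rule permutes_superset[OF w])
    fix x assume "x \<in> {1..} - {1..?n}"
    then have "x > ?n" by auto
    then show "w x = x" using f Max_ge[of "insert 0 {i. w i \<noteq> i}" x] by auto
  qed
  then show thesis by (rule that)
qed

lemma permutes_S_inf:
  assumes "w permutes {1..n}"
  shows "w \<in> S_inf"
proof -
  have "{i. w i \<noteq> i} \<subseteq> {1..n}" using permutes_not_in[OF assms] by blast
  moreover have "w permutes {1..}" using assms by (rule permutes_subset) auto
  ultimately show ?thesis by (auto simp: S_inf_def intro: finite_subset)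
qed

subsection \<open>Monk and label operators\<close>

text \<open>\<open>Zop\<close> is Monk's operator for \<open>x\<^sub>r\<close>, restricted to exchanges of values \<open>\<ge> k\<close>; the full operator is
  \<open>k = 1\<close>.\<close>

definition Zop ::
    "nat \<Rightarrow> nat \<Rightarrow> nat \<Rightarrow> ((nat \<Rightarrow> nat) \<Rightarrow> 'a::comm_ring_1) \<Rightarrow> (nat \<Rightarrow> nat) \<Rightarrow> 'a" where
  "Zop B k r g w = (if w permutes {1..B} then
     \<Sum>b\<in>{1..B} - {r}. if k \<le> w r \<and> k \<le> w b \<and> covers w r b
       then (if r < b then 1 else -1) * g (w \<circ> transpose r b) else 0 else 0)"

text \<open>The label \<open>w w\<^sub>i(b\<^sub>i)\<close> of a step is the smaller exchanged value, which stands at position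
  \<open>inv w k \<le> r\<close> before the step.\<close>

definition Uop ::
    "nat \<Rightarrow> nat \<Rightarrow> nat \<Rightarrow> ((nat \<Rightarrow> nat) \<Rightarrow> 'a::comm_ring_1) \<Rightarrow> (nat \<Rightarrow> nat) \<Rightarrow> 'a" where
  "Uop B r k g w = (if w permutes {1..B} \<and> inv w k \<le> r then
     \<Sum>b\<in>{r<..B}. if covers w (inv w k) b then g (w \<circ> transpose (inv w k) b) else 0 else 0)"

fun Uword ::
    "nat \<Rightarrow> nat \<Rightarrow> nat list \<Rightarrow> ((nat \<Rightarrow> nat) \<Rightarrow> 'a::comm_ring_1) \<Rightarrow> (nat \<Rightarrow> nat) \<Rightarrow> 'a" where
  "Uword B r [] g = g"
| "Uword B r (k # ks) g = Uop B r k (Uword B r ks g)"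

definition Hop ::
    "nat \<Rightarrow> nat \<Rightarrow> nat \<Rightarrow> nat \<Rightarrow> ((nat \<Rightarrow> nat) \<Rightarrow> 'a::comm_ring_1) \<Rightarrow> (nat \<Rightarrow> nat) \<Rightarrow> 'a" where
  "Hop B r k m g w = (\<Sum>R | R \<subseteq> {k..B} \<and> card R = m. Uword B r (sorted_list_of_set R) g w)"

section \<open>Commutation of the restricted Monk operators\<close>

lemma sum_pair_split:
  fixes f :: "'a \<Rightarrow> 'a \<Rightarrow> 'b::comm_monoid_add"
  assumes "finite A" "i \<in> A" "j \<in> A" "i \<noteq> j"
  shows "(\<Sum>b\<in>A - {i}. \<Sum>c\<in>A - {j}. f b c) =
    (\<Sum>b\<in>A - {i, j}. \<Sum>c\<in>A - {i, j, b}. f b c) +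
    (\<Sum>c\<in>A - {i, j}. f c c + f c i + f j c) + f j i"
proof -
  let ?C = "A - {i, j}"
  have Ai: "A - {i} = insert j ?C" and Aj: "A - {j} = insert i ?C" using assms by auto
  have in1: "(\<Sum>c\<in>A - {j}. f b c) = f b i + (f b b + (\<Sum>c\<in>A - {i, j, b}. f b c))" if "b \<in> ?C" for b
  proof -
    have C: "?C = insert b (A - {i, j, b})" using that by auto
    have "(\<Sum>c\<in>?C. f b c) = f b b + (\<Sum>c\<in>A - {i, j, b}. f b c)"
      using assms by (subst C) simp
    then show ?thesis unfolding Aj using assms by simp
  qed
  have in2: "(\<Sum>c\<in>A - {j}. f j c) = f j i + (\<Sum>c\<in>?C. f j c)" unfolding Aj using assms by simp
  have "(\<Sum>b\<in>A - {i}. \<Sum>c\<in>A - {j}. f b c) =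
      (\<Sum>c\<in>A - {j}. f j c) + (\<Sum>b\<in>?C. \<Sum>c\<in>A - {j}. f b c)"
    unfolding Ai using assms by simp
  also have "(\<Sum>b\<in>?C. \<Sum>c\<in>A - {j}. f b c) =
      (\<Sum>b\<in>?C. f b i + (f b b + (\<Sum>c\<in>A - {i, j, b}. f b c)))"
    by (rule sum.cong[OF refl in1])
  finally show ?thesis unfolding in2 by (simp add: sum.distrib ac_simps)
qed

lemma transpose_commute_disjoint:
  assumes "a \<noteq> c" "a \<noteq> d" "b \<noteq> c" "b \<noteq> d"
  shows "w \<circ> transpose a b \<circ> transpose c d = w \<circ> transpose c d \<circ> transpose a b"
  using assms by (auto simp: fun_eq_iff transpose_def)

lemma transpose_three_cycle:
  assumes "i \<noteq> j" "i \<noteq> c" "j \<noteq> c"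
  shows "w \<circ> transpose j c \<circ> transpose i j = w \<circ> transpose i c \<circ> transpose j c"
    and "w \<circ> transpose i j \<circ> transpose i c = w \<circ> transpose i c \<circ> transpose j c"
  using assms by (auto simp: fun_eq_iff transpose_def)

text \<open>The case of three positions i, j, c. The letters A, B, C stand for i < c, j < c, i < j,
  and D, E, F for w i < w c, w j < w c, w i < w j. The hypotheses are the transitivity laws; p and
  p' belong to the two end points, which arise from w by the two 3-cycles.\<close>

lemma exchange_identity:
  fixes p p' :: "'a::comm_ring_1"
  assumes "C \<and> B \<longrightarrow> A" "\<not> C \<and> \<not> B \<longrightarrow> \<not> A" "F \<and> E \<longrightarrow> D" "\<not> F \<and> \<not> E \<longrightarrow> \<not> D"
  shows "(if A = D \<and> B = (\<not> F) then (if A then 1 else -1) * (if B then 1 else -1) * p else 0) +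
    (if A = D \<and> (\<not> C) = E then (if A then 1 else -1) * (if \<not> C then 1 else -1) * p' else 0) +
    (if C = F \<and> B = D then (if C then 1 else -1) * (if B then 1 else -1) * p' else 0) =
    (if B = E \<and> A = F then (if B then 1 else -1) * (if A then 1 else -1) * p' else 0) +
    (if B = E \<and> C = D then (if B then 1 else -1) * (if C then 1 else -1) * p else 0) +
    (if (\<not> C) = (\<not> F) \<and> A = E then (if \<not> C then 1 else -1) * (if A then 1 else -1) * p else 0)"
  by (cases A; cases B; cases C; cases D; cases E; cases F) (use assms in simp_all)

text \<open>Two-step chains are sorted by the positions they move. Four distinct positions give
  commuting transpositions. Three positions leave two end points, for which the signed contributions
  agree. Two positions lead back to w, which has the wrong length.\<close>

lemma Zop_commute:
  fixes g :: "(nat \<Rightarrow> nat) \<Rightarrow> 'a::comm_ring_1"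
  assumes ij: "i \<in> {1..B}" "j \<in> {1..B}"
  shows "Zop B k i (Zop B k j g) w = Zop B k j (Zop B k i g) w"
proof (cases "w permutes {1..B} \<and> i \<noteq> j")
  case False
  then show ?thesis by (auto simp: Zop_def)
next
  case True
  then have w: "w permutes {1..B}" and ne: "i \<noteq> j" by auto
  let ?A = "{1..B}"
  define s :: "nat \<Rightarrow> nat \<Rightarrow> 'a" where "s x y = (if x < y then 1 else -1)" for x y
  \<comment> \<open>\<open>G\<close> carries the length condition of \<open>two_covers\<close>, so
    that everything else in a term is local.\<close>
  define G where "G u = (if ilen u = ilen w + 2 then g u else 0)" for u
  define T where "T x y b c = (if k \<le> w x \<and> k \<le> w b \<and> k \<le> (w \<circ> transpose x b) y \<and>
     k \<le> (w \<circ> transpose x b) c \<and> raises w x b \<and> raises (w \<circ> transpose x b) y c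
     then s x b * s y c * G (w \<circ> transpose x b \<circ> transpose y c) else 0)" for x y b c
  have expand: "Zop B k x (Zop B k y g) w = (\<Sum>b\<in>?A - {x}. \<Sum>c\<in>?A - {y}. T x y b c)"
    if xy: "x \<in> ?A" "y \<in> ?A" for x y
  proof -
    have "(if k \<le> w x \<and> k \<le> w b \<and> covers w x b
        then s x b * Zop B k y g (w \<circ> transpose x b) else 0) = (\<Sum>c\<in>?A - {y}. T x y b c)"
      if b: "b \<in> ?A - {x}" for b
    proof -
      have wt: "(w \<circ> transpose x b) permutes {1..B}"
        using w xy b by (intro permutes_comp_transpose) auto
      have "(if k \<le> w x \<and> k \<le> w b \<and> covers w x b
        then s x b * Zop B k y g (w \<circ> transpose x b) else 0) = (\<Sum>c\<in>?A - {y}.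
          if k \<le> w x \<and> k \<le> w b \<and> covers w x b then s x b *
          (if k \<le> (w \<circ> transpose x b) y \<and> k \<le> (w \<circ> transpose x b) c \<and> covers (w \<circ> transpose x b) y c
            then s y c * g (w \<circ> transpose x b \<circ> transpose y c) else 0) else 0)"
        using wt by (cases "k \<le> w x \<and> k \<le> w b \<and> covers w x b")
          (auto simp: Zop_def s_def sum_distrib_left cong: if_cong intro!: sum.cong)
      also have "\<dots> = (\<Sum>c\<in>?A - {y}. T x y b c)"
      proof (rule sum.cong[OF refl])
        fix c assume c: "c \<in> ?A - {y}"
        have "covers w x b \<and> covers (w \<circ> transpose x b) y c \<longleftrightarrow>
          raises w x b \<and> raises (w \<circ> transpose x b) y c \<and>
          ilen (w \<circ> transpose x b \<circ> transpose y c) = ilen w + 2"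
          using xy b c by (intro two_covers[OF w]) auto
        then show "(if k \<le> w x \<and> k \<le> w b \<and> covers w x b then s x b *
          (if k \<le> (w \<circ> transpose x b) y \<and> k \<le> (w \<circ> transpose x b) c \<and> covers (w \<circ> transpose x b) y c
            then s y c * g (w \<circ> transpose x b \<circ> transpose y c) else 0) else 0) = T x y b c"
          unfolding T_def G_def by (simp add: mult.assoc) blast
      qed
      finally show ?thesis .
    qed
    note inner = this
    have "Zop B k x (Zop B k y g) w = (\<Sum>b\<in>?A - {x}. if k \<le> w x \<and> k \<le> w b \<and> covers w x b
        then s x b * Zop B k y g (w \<circ> transpose x b) else 0)"
      unfolding Zop_def[of B k x] s_def using w by simp
    also have "\<dots> = (\<Sum>b\<in>?A - {x}. \<Sum>c\<in>?A - {y}. T x y b c)"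
      by (rule sum.cong[OF refl inner])
    finally show ?thesis .
  qed
  have inj: "w x = w y \<longleftrightarrow> x = y" for x y using permutes_inj[OF w] by (auto dest: injD)
  have bounce: "T x y y x = 0" if "x \<noteq> y" for x y
    by (simp add: T_def G_def comp_assoc transpose_commute[of y x])
  have four: "T i j b c = T j i c b" if "b \<in> ?A - {i, j}" "c \<in> ?A - {i, j, b}" for b c
  proof -
    have d: "b \<noteq> i" "b \<noteq> j" "c \<noteq> i" "c \<noteq> j" "b \<noteq> c" using that by auto
    have v: "(w \<circ> transpose i b) j = w j" "(w \<circ> transpose i b) c = w c"
      "(w \<circ> transpose j c) i = w i" "(w \<circ> transpose j c) b = w b"
      using d ne by (auto simp: transpose_def)
    have e: "w \<circ> transpose j c \<circ> transpose i b = w \<circ> transpose i b \<circ> transpose j c"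
      using d ne by (intro transpose_commute_disjoint) auto
    show ?thesis unfolding T_def v raises_def e by (simp add: mult.commute conj_ac)
  qed
  have three: "T i j c c + T i j c i + T i j j c = T j i c c + T j i c j + T j i i c"
    if "c \<in> ?A - {i, j}" for c
  proof -
    have d: "c \<noteq> i" "c \<noteq> j" "i \<noteq> c" "j \<noteq> c" "j \<noteq> i" using that ne by auto
    note e1 = transpose_three_cycle[OF ne d(3,4), of w]
    note e2 = transpose_three_cycle[OF d(5) d(4,3), of w]
    have v: "transpose x y x = y" "transpose x y y = x" for x y :: nat by simp_all
    have v': "transpose i c j = j" "transpose j c i = i" "transpose i j c = c" "transpose j i c = c"
      using d ne by (auto simp: transpose_def)
    define p where "p = w \<circ> transpose i c \<circ> transpose j c"
    define p' where "p' = w \<circ> transpose j c \<circ> transpose i c"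
    have q: "w \<circ> transpose i c \<circ> transpose j i = p'" "w \<circ> transpose i j \<circ> transpose j c = p'"
      "w \<circ> transpose j c \<circ> transpose i j = p" "w \<circ> transpose j i \<circ> transpose i c = p"
      using e1 e2 by (simp_all add: p_def p'_def transpose_commute[of j i])
    have neqs: "w i \<noteq> w j" "w i \<noteq> w c" "w j \<noteq> w c" using d ne inj by auto
    show ?thesis
    proof (cases "k \<le> w i \<and> k \<le> w j \<and> k \<le> w c")
      \<comment> \<open>Each of the six chains involves all three values, so one value below the
        threshold makes every term vanish.\<close>
      case False
      then show ?thesis unfolding T_def o_apply v v'
        by (cases "k \<le> w i"; cases "k \<le> w j"; cases "k \<le> w c") simp_all
    next
      case True
      then have k: "k \<le> w i" "k \<le> w j" "k \<le> w c" by auto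
      have E: "T i j c c = (if (i < c \<longleftrightarrow> w i < w c) \<and> (j < c \<longleftrightarrow> w j < w i) then s i c * s j c * G p else 0)"
        "T j i c c = (if (j < c \<longleftrightarrow> w j < w c) \<and> (i < c \<longleftrightarrow> w i < w j) then s j c * s i c * G p' else 0)"
        "T i j c i = (if (i < c \<longleftrightarrow> w i < w c) \<and> (j < i \<longleftrightarrow> w j < w c) then s i c * s j i * G p' else 0)"
        "T j i c j = (if (j < c \<longleftrightarrow> w j < w c) \<and> (i < j \<longleftrightarrow> w i < w c) then s j c * s i j * G p else 0)"
        "T i j j c = (if (i < j \<longleftrightarrow> w i < w j) \<and> (j < c \<longleftrightarrow> w i < w c) then s i j * s j c * G p' else 0)"
        "T j i i c = (if (j < i \<longleftrightarrow> w j < w i) \<and> (i < c \<longleftrightarrow> w j < w c) then s j i * s i c * G p else 0)"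
        unfolding T_def q p_def[symmetric] p'_def[symmetric] raises_def o_apply v v'
        by (simp_all only: k simp_thms)
      have neg: "(j < i) = (\<not> i < j)" "(w j < w i) = (\<not> w i < w j)" using d neqs by auto
      have tr: "i < j \<and> j < c \<longrightarrow> i < c" "\<not> i < j \<and> \<not> j < c \<longrightarrow> \<not> i < c"
        "w i < w j \<and> w j < w c \<longrightarrow> w i < w c" "\<not> w i < w j \<and> \<not> w j < w c \<longrightarrow> \<not> w i < w c"
        by auto
      show ?thesis unfolding E s_def neg by (rule exchange_identity[OF tr])
    qed
  qed
  have "(\<Sum>b\<in>?A - {i, j}. \<Sum>c\<in>?A - {i, j, b}. T i j b c) =
      (\<Sum>b\<in>?A - {i, j}. \<Sum>c\<in>?A - {i, j, b}. T j i c b)"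
    by (intro sum.cong refl four) auto
  also have "\<dots> = (\<Sum>b\<in>?A - {i, j}. \<Sum>c | c \<in> ?A - {i, j} \<and> b \<noteq> c. T j i c b)"
    by (intro sum.cong refl) auto
  also have "\<dots> = (\<Sum>c\<in>?A - {i, j}. \<Sum>b | b \<in> ?A - {i, j} \<and> b \<noteq> c. T j i c b)"
    by (rule sum.swap_restrict) auto
  also have "\<dots> = (\<Sum>c\<in>?A - {j, i}. \<Sum>b\<in>?A - {j, i, c}. T j i c b)"
    by (intro sum.cong refl) auto
  finally have s1: "(\<Sum>b\<in>?A - {i, j}. \<Sum>c\<in>?A - {i, j, b}. T i j b c) =
    (\<Sum>b\<in>?A - {j, i}. \<Sum>c\<in>?A - {j, i, b}. T j i b c)" .
  have s2: "(\<Sum>c\<in>?A - {i, j}. T i j c c + T i j c i + T i j j c) =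
    (\<Sum>c\<in>?A - {j, i}. T j i c c + T j i c j + T j i i c)"
    by (intro sum.cong three) auto
  have "Zop B k i (Zop B k j g) w = (\<Sum>b\<in>?A - {i, j}. \<Sum>c\<in>?A - {i, j, b}. T i j b c) +
    (\<Sum>c\<in>?A - {i, j}. T i j c c + T i j c i + T i j j c) + T i j j i"
    unfolding expand[OF ij] using ij ne by (intro sum_pair_split) auto
  moreover have "Zop B k j (Zop B k i g) w = (\<Sum>b\<in>?A - {j, i}. \<Sum>c\<in>?A - {j, i, b}. T j i b c) +
    (\<Sum>c\<in>?A - {j, i}. T j i c c + T j i c j + T j i i c) + T j i i j"
    unfolding expand[OF ij(2,1)] using ij ne by (intro sum_pair_split) auto
  ultimately show ?thesis using s1 s2 bounce[of i j] bounce[of j i] ne by simp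
qed

section \<open>The zipper: passing from r to r + 1\<close>

lemma inv_in_range:
  assumes "w permutes S" "k \<in> S"
  shows "inv w k \<in> S"
  using permutes_in_image[OF permutes_inv[OF assms(1)]] assms(2) by blast

lemma inv_eqI: "w permutes S \<Longrightarrow> w a = k \<Longrightarrow> inv w k = a"
  using permutes_inverses(2) by force

lemma covers_less:
  assumes "w permutes {1..B}" "a < b" "a \<in> {1..B}" "b \<in> {1..B}" "covers w a b"
  shows "w a < w b"
  using covers_iff[OF assms(1-4)] assms(5) by simp

text \<open>If k stands before position r + 1, the exchange of these two positions, when it is a
  cover, occurs on the left in \<open>Uop B r k\<close> and again in \<open>Zop B k (Suc r)\<close>
  with sign -1, and not at all on the right. If k stands at r + 1, the Monk sum on the left is the
  label sum on the right. If k stands later, the terms agree one by one.\<close>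

lemma Zop_Suc_lower:
  fixes g :: "(nat \<Rightarrow> nat) \<Rightarrow> 'a::comm_ring_1"
  assumes r: "Suc r \<le> B" and k: "k \<in> {1..B}"
  shows "Zop B k (Suc r) g w + Uop B r k g w = Zop B (Suc k) (Suc r) g w + Uop B (Suc r) k g w"
proof (cases "w permutes {1..B}")
  case False
  then show ?thesis by (simp add: Zop_def Uop_def)
next
  case w: True
  let ?A = "{1..B}" and ?q = "Suc r"
  define a where "a = inv w k"
  have wa: "w a = k" unfolding a_def by (rule permutes_inverses(1)[OF w])
  have aA: "a \<in> ?A" unfolding a_def by (rule inv_in_range[OF w k])
  have qA: "?q \<in> ?A" using r by simp
  have inj: "w x = w y \<longleftrightarrow> x = y" for x y using permutes_inj[OF w] by (auto dest: injD)
  have ins: "{r<..B} = insert ?q {?q<..B}" using r by auto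
  have U: "Uop B r k g w = (if a \<le> r then (if covers w a ?q then g (w \<circ> transpose a ?q) else 0) +
      (\<Sum>b\<in>{?q<..B}. if covers w a b then g (w \<circ> transpose a b) else 0) else 0)"
    "Uop B ?q k g w = (if a \<le> ?q then
      (\<Sum>b\<in>{?q<..B}. if covers w a b then g (w \<circ> transpose a b) else 0) else 0)"
    unfolding Uop_def a_def[symmetric] using w by (simp_all add: ins)
  have nc: "\<not> covers w x y" if "x < y" "x \<in> ?A" "y \<in> ?A" "w y < w x" for x y
    using covers_less[OF w that(1-3)] that(4) by auto
  consider "w ?q < k" | "w ?q = k" | "k < w ?q" by linarith
  then show ?thesis
  proof cases
    case 1
    then have "a \<noteq> ?q" using wa by auto
    moreover have "\<not> covers w a ?q" if "a < ?q" using nc[OF that aA qA] 1 wa by simp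
    ultimately show ?thesis using 1 unfolding U by (auto simp: Zop_def)
  next
    case 2
    then have aq: "a = ?q" using wa inj by metis
    have "Zop B k ?q g w = (\<Sum>b\<in>?A - {?q}. if k \<le> w ?q \<and> k \<le> w b \<and> covers w ?q b
          then (if ?q < b then 1 else - 1) * g (w \<circ> transpose ?q b) else 0)"
      unfolding Zop_def using w by simp
    also have "\<dots> = (\<Sum>b\<in>?A - {?q}. if b \<in> {?q<..B} \<and> covers w ?q b then g (w \<circ> transpose ?q b) else 0)"
    proof (rule sum.cong[OF refl])
      fix b assume b: "b \<in> ?A - {?q}"
      have "w b \<noteq> w ?q" using b inj by auto
      then show "(if k \<le> w ?q \<and> k \<le> w b \<and> covers w ?q b
          then (if ?q < b then 1 else - 1) * g (w \<circ> transpose ?q b) else 0) =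
          (if b \<in> {?q<..B} \<and> covers w ?q b then g (w \<circ> transpose ?q b) else 0)"
        using b nc[of b ?q] nc[of ?q b] qA 2 by (auto simp: covers_commute[of w ?q b])
    qed
    also have "\<dots> = (\<Sum>b\<in>{?q<..B}. if covers w ?q b then g (w \<circ> transpose ?q b) else 0)"
      by (rule sum.mono_neutral_cong_right) auto
    finally have "Zop B k ?q g w = (\<Sum>b\<in>{?q<..B}. if covers w ?q b then g (w \<circ> transpose ?q b) else 0)" .
    then show ?thesis using 2 unfolding U aq by (simp add: Zop_def)
  next
    case 3
    then have aq: "a \<noteq> ?q" using wa by auto
    have split: "Zop B x ?q g w = (if x \<le> k \<and> covers w ?q a
        then (if ?q < a then 1 else -1) * g (w \<circ> transpose ?q a) else 0) +
        (\<Sum>b\<in>?A - {?q} - {a}. if Suc k \<le> w b \<and> covers w ?q b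
          then (if ?q < b then 1 else -1) * g (w \<circ> transpose ?q b) else 0)" if x: "x = k \<or> x = Suc k" for x
    proof -
      have *: "Zop B x ?q g w = (\<Sum>b\<in>?A - {?q}. if x \<le> w ?q \<and> x \<le> w b \<and> covers w ?q b
          then (if ?q < b then 1 else -1) * g (w \<circ> transpose ?q b) else 0)"
        using w by (simp add: Zop_def)
      let ?f = "\<lambda>x b. if x \<le> w ?q \<and> x \<le> w b \<and> covers w ?q b
          then (if ?q < b then 1 else -1) * g (w \<circ> transpose ?q b) else 0"
      have "Zop B x ?q g w = ?f x a + (\<Sum>b\<in>?A - {?q} - {a}. ?f x b)"
        unfolding * by (rule sum.remove) (use aA aq in auto)
      also have "?f x a = (if x \<le> k \<and> covers w ?q a
        then (if ?q < a then 1 else -1) * g (w \<circ> transpose ?q a) else 0)"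
        using x 3 wa by auto
      also have "(\<Sum>b\<in>?A - {?q} - {a}. ?f x b) =
          (\<Sum>b\<in>?A - {?q} - {a}. if Suc k \<le> w b \<and> covers w ?q b
          then (if ?q < b then 1 else -1) * g (w \<circ> transpose ?q b) else 0)"
      proof (rule sum.cong[OF refl])
        fix b assume "b \<in> ?A - {?q} - {a}"
        then have "w b \<noteq> k" using inj wa by auto
        then have "x \<le> w ?q \<and> x \<le> w b \<longleftrightarrow> Suc k \<le> w b" using x 3 by auto
        then show "?f x b = (if Suc k \<le> w b \<and> covers w ?q b
            then (if ?q < b then 1 else -1) * g (w \<circ> transpose ?q b) else 0)" by auto
      qed
      finally show ?thesis .
    qed
    show ?thesis
    proof (cases "a < ?q")
      case True
      then show ?thesis unfolding U split[of k, simplified] split[of "Suc k", simplified]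
        by (simp add: covers_commute[of w ?q a] transpose_commute[of ?q a])
    next
      case False
      then have "?q < a" using aq by simp
      then show ?thesis unfolding U split[of k, simplified] split[of "Suc k", simplified]
        using nc[of ?q a] aA qA 3 wa by simp
    qed
  qed
qed

text \<open>A Monk step before a step with label k turns into a Monk step after it, with threshold k
  + 1 and r in place of r + 1. With \<open>Zop_Suc_lower\<close> this closes the induction over the
  threshold. Steps on disjoint positions are exchanged; the chains on the position of k, on r + 1
  and on a third position c share one end point and are balanced against each other.\<close>

lemma zipper:
  fixes g :: "(nat \<Rightarrow> nat) \<Rightarrow> 'a::comm_ring_1"
  assumes r: "Suc r \<le> B" and k: "k \<in> {1..B}"
  shows "Zop B k (Suc r) (Uop B (Suc r) k g) w = Uop B r k (Zop B (Suc k) (Suc r) g) w"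
proof (cases "w permutes {1..B}")
  case False
  then show ?thesis by (simp add: Zop_def Uop_def)
next
  case w: True
  let ?A = "{1..B}" and ?q = "Suc r"
  define s :: "nat \<Rightarrow> nat \<Rightarrow> 'a" where "s x y = (if x < y then 1 else -1)" for x y
  define a where "a = inv w k"
  have wa: "w a = k" unfolding a_def by (rule permutes_inverses(1)[OF w])
  have aA: "a \<in> ?A" unfolding a_def by (rule inv_in_range[OF w k])
  have qA: "?q \<in> ?A" using r by simp
  have inj: "w x = w y \<longleftrightarrow> x = y" for x y using permutes_inj[OF w] by (auto dest: injD)
  have ins: "{r<..B} = insert ?q {?q<..B}" using r by auto
  have nc: "\<not> covers w x y" if "x < y" "x \<in> ?A" "y \<in> ?A" "w y < w x" for x y
    using covers_less[OF w that(1-3)] that(4) by auto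
  have wt: "(w \<circ> transpose x y) permutes ?A" if "x \<in> ?A" "y \<in> ?A" for x y
    using w that by (intro permutes_comp_transpose)
  have L: "Zop B k ?q (Uop B ?q k g) w = (\<Sum>b\<in>?A - {?q}. if k \<le> w ?q \<and> k \<le> w b \<and> covers w ?q b
      then s ?q b * Uop B ?q k g (w \<circ> transpose ?q b) else 0)"
    unfolding Zop_def s_def using w by simp
  have R: "Uop B r k (Zop B (Suc k) ?q g) w = (if a \<le> r then
      \<Sum>b\<in>{r<..B}. if covers w a b then Zop B (Suc k) ?q g (w \<circ> transpose a b) else 0 else 0)"
    unfolding Uop_def a_def[symmetric] using w by simp
  have Lz: "Zop B k ?q (Uop B ?q k g) w = 0"
    if "\<And>b. b \<in> ?A - {?q} \<Longrightarrow> k \<le> w ?q \<Longrightarrow> k \<le> w b \<Longrightarrow> covers w ?q b \<Longrightarrow> Uop B ?q k g (w \<circ> transpose ?q b) = 0"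
    unfolding L using that by (intro sum.neutral) auto
  \<comment> \<open>Both sides vanish unless k stands to the left of position r + 1 and is smaller
    than the value there.\<close>
  consider "w ?q < k" | "w ?q = k" | "k < w ?q" "?q < a" | "k < w ?q" "a < ?q"
    using wa by (metis less_linear)
  then show ?thesis
  proof cases
    case 1
    have "Zop B k ?q (Uop B ?q k g) w = 0" using 1 by (intro Lz) simp
    moreover have "Uop B r k (Zop B (Suc k) ?q g) w = 0"
    proof -
      have "Zop B (Suc k) ?q g (w \<circ> transpose a b) = 0" if "a \<le> r" "b \<in> {r<..B}" "covers w a b" for b
      proof -
        have "b \<noteq> ?q" using nc[of a ?q] aA qA that 1 wa by auto
        then have "(w \<circ> transpose a b) ?q = w ?q" using that by (auto simp: transpose_def)
        then show ?thesis using 1 by (simp add: Zop_def)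
      qed
      then show ?thesis unfolding R by (auto intro!: sum.neutral)
    qed
    ultimately show ?thesis by simp
  next
    case 2
    then have aq: "a = ?q" using wa inj by metis
    have "Zop B k ?q (Uop B ?q k g) w = 0"
    proof (rule Lz)
      fix b assume b: "b \<in> ?A - {?q}" "k \<le> w b" "covers w ?q b"
      have "inv (w \<circ> transpose ?q b) k = b" using wt[OF qA, of b] b 2 by (intro inv_eqI) auto
      moreover have "\<not> b < ?q"
      proof
        assume "b < ?q"
        moreover have "w b \<noteq> w ?q" using inj b by auto
        ultimately show False using nc[of b ?q] b qA 2 by (auto simp: covers_commute[of w ?q b])
      qed
      ultimately show "Uop B ?q k g (w \<circ> transpose ?q b) = 0" using b by (simp add: Uop_def)
    qed
    then show ?thesis unfolding R aq by simp
  next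
    case 3
    have "Zop B k ?q (Uop B ?q k g) w = 0"
    proof (rule Lz)
      fix b assume b: "b \<in> ?A - {?q}" "k \<le> w b" "covers w ?q b"
      have "b \<noteq> a" using nc[of ?q a] b aA qA 3 wa by auto
      then have "inv (w \<circ> transpose ?q b) k = a" using wt[OF qA, of b] b 3 wa
        by (intro inv_eqI) (auto simp: transpose_def)
      then show "Uop B ?q k g (w \<circ> transpose ?q b) = 0" using 3 by (simp add: Uop_def)
    qed
    then show ?thesis unfolding R using 3 by simp
  next
    case 4
    let ?C = "{?q<..B}"
    define G where "G u = (if ilen u = ilen w + 2 then g u else 0)" for u
    define X1 where "X1 c = (if covers w ?q a \<and> covers (w \<circ> transpose ?q a) ?q c
      then g (w \<circ> transpose ?q a \<circ> transpose ?q c) else 0)" for c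
    define X2 where "X2 c = (if k \<le> w c \<and> covers w ?q c \<and> covers (w \<circ> transpose ?q c) a c
      then g (w \<circ> transpose ?q c \<circ> transpose a c) else 0)" for c
    define X3 where "X3 c = (if covers w a c \<and> Suc k \<le> w c \<and> covers (w \<circ> transpose a c) ?q a
      then g (w \<circ> transpose a c \<circ> transpose ?q a) else 0)" for c
    define Y where "Y b c = (if k \<le> w b \<and> covers w ?q b \<and> covers (w \<circ> transpose ?q b) a c
      then s ?q b * g (w \<circ> transpose ?q b \<circ> transpose a c) else 0)" for b c
    define Y' where "Y' b c = (if Suc k \<le> w b \<and> covers w a c \<and> covers (w \<circ> transpose a c) ?q b
      then s ?q b * g (w \<circ> transpose a c \<circ> transpose ?q b) else 0)" for b c
    have Cd: "c \<in> ?A" "c \<noteq> ?q" "c \<noteq> a" "a < c" "?q < c" if "c \<in> ?C" for c using that 4 by auto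
    have "Zop B k ?q (Uop B ?q k g) w =
        s ?q a * (\<Sum>c\<in>?C. X1 c) + (\<Sum>b\<in>?A - {?q} - {a}. \<Sum>c\<in>?C. Y b c)"
    proof -
      have "Zop B k ?q (Uop B ?q k g) w = (if k \<le> w ?q \<and> k \<le> w a \<and> covers w ?q a
          then s ?q a * Uop B ?q k g (w \<circ> transpose ?q a) else 0) +
          (\<Sum>b\<in>?A - {?q} - {a}. if k \<le> w ?q \<and> k \<le> w b \<and> covers w ?q b
          then s ?q b * Uop B ?q k g (w \<circ> transpose ?q b) else 0)"
        unfolding L by (rule sum.remove) (use aA 4 in auto)
      also have "(if k \<le> w ?q \<and> k \<le> w a \<and> covers w ?q a
          then s ?q a * Uop B ?q k g (w \<circ> transpose ?q a) else 0) = s ?q a * (\<Sum>c\<in>?C. X1 c)"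
      proof -
        have i: "inv (w \<circ> transpose ?q a) k = ?q"
          using wt[OF qA aA] wa by (intro inv_eqI) auto
        have "Uop B ?q k g (w \<circ> transpose ?q a) = (\<Sum>c\<in>?C. if covers (w \<circ> transpose ?q a) ?q c
            then g (w \<circ> transpose ?q a \<circ> transpose ?q c) else 0)"
          unfolding Uop_def i using wt[OF qA aA] by simp
        then show ?thesis using 4 wa unfolding X1_def by (cases "covers w ?q a") simp_all
      qed
      also have "(\<Sum>b\<in>?A - {?q} - {a}. if k \<le> w ?q \<and> k \<le> w b \<and> covers w ?q b
          then s ?q b * Uop B ?q k g (w \<circ> transpose ?q b) else 0) = (\<Sum>b\<in>?A - {?q} - {a}. \<Sum>c\<in>?C. Y b c)"
      proof (rule sum.cong[OF refl])
        fix b assume b: "b \<in> ?A - {?q} - {a}"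
        have i: "inv (w \<circ> transpose ?q b) k = a"
          using wt[OF qA, of b] b wa 4 by (intro inv_eqI) (auto simp: transpose_def)
        have "Uop B ?q k g (w \<circ> transpose ?q b) = (\<Sum>c\<in>?C. if covers (w \<circ> transpose ?q b) a c
            then g (w \<circ> transpose ?q b \<circ> transpose a c) else 0)"
          unfolding Uop_def i using wt[OF qA, of b] b 4 by simp
        then show "(if k \<le> w ?q \<and> k \<le> w b \<and> covers w ?q b
          then s ?q b * Uop B ?q k g (w \<circ> transpose ?q b) else 0) = (\<Sum>c\<in>?C. Y b c)"
          using 4 unfolding Y_def
          by (cases "k \<le> w b \<and> covers w ?q b") (auto simp: sum_distrib_left intro!: sum.cong)
      qed
      finally show ?thesis .
    qed
    also have "s ?q a = -1" using 4 by (simp add: s_def)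
    also have "(\<Sum>b\<in>?A - {?q} - {a}. \<Sum>c\<in>?C. Y b c) = (\<Sum>c\<in>?C. \<Sum>b\<in>?A - {?q} - {a}. Y b c)"
      by (rule sum.swap)
    also have "\<dots> = (\<Sum>c\<in>?C. X2 c + (\<Sum>b\<in>?A - {?q} - {a} - {c}. Y' b c))"
    proof (rule sum.cong[OF refl])
      fix c assume c: "c \<in> ?C"
      note cd = Cd[OF c]
      have "(\<Sum>b\<in>?A - {?q} - {a}. Y b c) = Y c c + (\<Sum>b\<in>?A - {?q} - {a} - {c}. Y b c)"
        by (rule sum.remove) (use cd in auto)
      also have "Y c c = X2 c" using cd by (simp add: Y_def X2_def s_def)
      also have "(\<Sum>b\<in>?A - {?q} - {a} - {c}. Y b c) = (\<Sum>b\<in>?A - {?q} - {a} - {c}. Y' b c)"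
      proof (rule sum.cong[OF refl])
        fix b assume b: "b \<in> ?A - {?q} - {a} - {c}"
        then have d: "b \<in> ?A" "?q \<noteq> b" "a \<noteq> b" "c \<noteq> b" "?q \<noteq> a" "?q \<noteq> c" "a \<noteq> c" using 4 cd by auto
        have e: "w \<circ> transpose ?q b \<circ> transpose a c = w \<circ> transpose a c \<circ> transpose ?q b"
          using d by (intro transpose_commute_disjoint) auto
        have v: "(w \<circ> transpose ?q b) a = w a" "(w \<circ> transpose ?q b) c = w c"
          "(w \<circ> transpose a c) ?q = w ?q" "(w \<circ> transpose a c) b = w b"
          using d by (auto simp: transpose_def)
        have "w b \<noteq> k" using d wa inj by auto
        then have "k \<le> w b \<longleftrightarrow> Suc k \<le> w b" by auto
        moreover have "covers w ?q b \<and> covers (w \<circ> transpose ?q b) a c \<longleftrightarrow>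
            covers w a c \<and> covers (w \<circ> transpose a c) ?q b"
          unfolding two_covers[OF w d(2) qA d(1) d(7) aA cd(1)] two_covers[OF w d(7) aA cd(1) d(2) qA d(1)] e
            raises_def v
          by blast
        ultimately show "Y b c = Y' b c" unfolding Y_def Y'_def e by simp
      qed
      finally show "(\<Sum>b\<in>?A - {?q} - {a}. Y b c) = X2 c + (\<Sum>b\<in>?A - {?q} - {a} - {c}. Y' b c)" .
    qed
    finally have LHS: "Zop B k ?q (Uop B ?q k g) w =
        (\<Sum>c\<in>?C. - X1 c + X2 c + (\<Sum>b\<in>?A - {?q} - {a} - {c}. Y' b c))"
      by (simp add: sum.distrib sum_negf sum_subtractf)
    have "Uop B r k (Zop B (Suc k) ?q g) w =
        (if covers w a ?q then Zop B (Suc k) ?q g (w \<circ> transpose a ?q) else 0) +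
        (\<Sum>c\<in>?C. if covers w a c then Zop B (Suc k) ?q g (w \<circ> transpose a c) else 0)"
      unfolding R ins using 4 by simp
    \<comment> \<open>After this exchange position r + 1 holds k, which is below the threshold k +
      1.\<close>
    also have "Zop B (Suc k) ?q g (w \<circ> transpose a ?q) = 0"
      using wa by (simp add: Zop_def)
    also have "(\<Sum>c\<in>?C. if covers w a c then Zop B (Suc k) ?q g (w \<circ> transpose a c) else 0) =
        (\<Sum>c\<in>?C. - X3 c + (\<Sum>b\<in>?A - {?q} - {a} - {c}. Y' b c))"
    proof (rule sum.cong[OF refl])
      fix c assume c: "c \<in> ?C"
      note cd = Cd[OF c]
      define v where "v = w \<circ> transpose a c"
      have v: "v ?q = w ?q" "v a = w c" "v c = k" using cd 4 wa by (auto simp: v_def transpose_def)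
      have vp: "v permutes ?A" unfolding v_def by (rule wt[OF aA cd(1)])
      let ?f = "\<lambda>b. if Suc k \<le> v ?q \<and> Suc k \<le> v b \<and> covers v ?q b
          then s ?q b * g (v \<circ> transpose ?q b) else 0"
      have "Zop B (Suc k) ?q g v = (\<Sum>b\<in>?A - {?q}. ?f b)"
        unfolding Zop_def s_def using vp by simp
      also have "\<dots> = ?f a + (\<Sum>b\<in>?A - {?q} - {a}. ?f b)"
        by (rule sum.remove) (use aA 4 in auto)
      also have "(\<Sum>b\<in>?A - {?q} - {a}. ?f b) = ?f c + (\<Sum>b\<in>?A - {?q} - {a} - {c}. ?f b)"
        by (rule sum.remove) (use cd in auto)
      also have "?f c = 0" using v by simp
      finally have Z: "Zop B (Suc k) ?q g v = ?f a + (\<Sum>b\<in>?A - {?q} - {a} - {c}. ?f b)" by simp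
      show "(if covers w a c then Zop B (Suc k) ?q g (w \<circ> transpose a c) else 0) =
          - X3 c + (\<Sum>b\<in>?A - {?q} - {a} - {c}. Y' b c)"
      proof (cases "covers w a c")
        case True
        have "?f a = - X3 c" using True v 4 by (simp add: X3_def v_def[symmetric] s_def)
        moreover have "(\<Sum>b\<in>?A - {?q} - {a} - {c}. ?f b) = (\<Sum>b\<in>?A - {?q} - {a} - {c}. Y' b c)"
        proof (rule sum.cong[OF refl])
          fix b assume "b \<in> ?A - {?q} - {a} - {c}"
          then have vb: "v b = w b" by (auto simp: v_def transpose_def)
          show "?f b = Y' b c" using True v vb 4 by (simp add: Y'_def flip: v_def)
        qed
        ultimately show ?thesis using True unfolding v_def[symmetric] Z by simp
      next
        case False
        then show ?thesis by (simp add: X3_def Y'_def flip: v_def)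
      qed
    qed
    finally have RHS: "Uop B r k (Zop B (Suc k) ?q g) w =
        (\<Sum>c\<in>?C. - X3 c + (\<Sum>b\<in>?A - {?q} - {a} - {c}. Y' b c))" by simp
    \<comment> \<open>Since k < w (r + 1), the term \<open>X1\<close> asks for k < w c,
      \<open>X2\<close> for w (r + 1) < w c, and \<open>X3\<close> for k < w c < w (r + 1). So
      \<open>X1\<close> splits into the two others.\<close>
    have "- X1 c + X2 c = - X3 c" if c: "c \<in> ?C" for c
    proof -
      note cd = Cd[OF c]
      have ne: "?q \<noteq> a" "?q \<noteq> c" "a \<noteq> c" "a \<noteq> ?q" using cd 4 by auto
      define p where "p = w \<circ> transpose ?q a \<circ> transpose ?q c"
      have e: "w \<circ> transpose ?q c \<circ> transpose a c = p" "w \<circ> transpose a c \<circ> transpose ?q a = p"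
        using ne unfolding p_def by (auto simp: fun_eq_iff transpose_def)
      have neqs: "w a \<noteq> w ?q" "w a \<noteq> w c" "w ?q \<noteq> w c" using ne inj by auto
      have v: "(w \<circ> transpose ?q a) ?q = w a" "(w \<circ> transpose ?q a) c = w c"
        "(w \<circ> transpose ?q c) a = w a" "(w \<circ> transpose ?q c) c = w ?q"
        "(w \<circ> transpose a c) ?q = w ?q" "(w \<circ> transpose a c) a = w c"
        using ne by (auto simp: transpose_def)
      have X: "X1 c = (if raises w ?q a \<and> raises (w \<circ> transpose ?q a) ?q c then G p else 0)"
        "X2 c = (if k \<le> w c \<and> raises w ?q c \<and> raises (w \<circ> transpose ?q c) a c then G p else 0)"
        "X3 c = (if Suc k \<le> w c \<and> raises w a c \<and> raises (w \<circ> transpose a c) ?q a then G p else 0)"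
        using two_covers[OF w ne(1) qA aA ne(2) qA cd(1)] two_covers[OF w ne(2) qA cd(1) ne(3) aA cd(1)]
          two_covers[OF w ne(3) aA cd(1) ne(1) qA aA]
        unfolding X1_def X2_def X3_def G_def e p_def[symmetric] by auto
      show ?thesis unfolding X raises_def v using 4 cd neqs wa by auto
    qed
    then show ?thesis unfolding LHS RHS by (intro sum.cong) auto
  qed
qed

section \<open>Linearity and congruence of the operators\<close>

lemma Zop_add: "Zop B k r (\<lambda>v. g v + h v) w = Zop B k r g w + Zop B k r h w"
proof -
  have "(if c then s * (x + y) else 0) = (if c then s * x else 0) + (if c then s * y else 0)"
    for c and s x y :: 'a by (simp add: distrib_left)
  then show ?thesis by (simp only: Zop_def sum.distrib) simp
qed

lemma Uop_add: "Uop B r k (\<lambda>v. g v + h v) w = Uop B r k g w + Uop B r k h w"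
  by (auto simp: Uop_def simp flip: sum.distrib intro!: sum.cong)

lemma Zop_mult: "Zop B k r (\<lambda>v. c * g v) w = c * Zop B k r g w"
proof -
  have "(if b then s * (c * y) else 0) = c * (if b then s * y else 0)"
    for b and s y :: 'a by (simp add: mult.left_commute)
  then show ?thesis by (simp only: Zop_def sum_distrib_left[symmetric]) simp
qed

lemma Uop_mult: "Uop B r k (\<lambda>v. c * g v) w = c * Uop B r k g w"
  by (auto simp: Uop_def sum_distrib_left intro!: sum.cong)

lemma Zop_zero [simp]: "Zop B k r (\<lambda>v. 0) w = 0"
  using Zop_mult[of B k r 0 "\<lambda>v. 0"] by simp

lemma Uop_zero: "Uop B r k (\<lambda>v. 0) w = 0"
  by (simp add: Uop_def)

lemma Uop_sum: "Uop B r k (\<lambda>v. \<Sum>i\<in>I. g i v) w = (\<Sum>i\<in>I. Uop B r k (g i) w)"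
  by (induction I rule: infinite_finite_induct) (simp_all add: Uop_zero Uop_add)

lemma Uword_sum: "Uword B r ks (\<lambda>v. \<Sum>i\<in>I. g i v) = (\<lambda>w. \<Sum>i\<in>I. Uword B r ks (g i) w)"
  by (induction ks) (simp_all add: Uop_sum)

lemma Uword_add: "Uword B r ks (\<lambda>v. g v + h v) = (\<lambda>w. Uword B r ks g w + Uword B r ks h w)"
  by (induction ks) (simp_all add: Uop_add)

lemma Uword_mult: "Uword B r ks (\<lambda>v. c * g v) = (\<lambda>w. c * Uword B r ks g w)"
  by (induction ks) (simp_all add: Uop_mult)

lemma Uword_append: "Uword B r (ks @ ks') g = Uword B r ks (Uword B r ks' g)"
  by (induction ks) simp_all

lemma Uop_cong:
  assumes "\<And>a b. w permutes {1..B} \<Longrightarrow> a \<in> {1..B} \<Longrightarrow> a \<le> r \<Longrightarrow> b \<in> {r<..B} \<Longrightarrow> w a = k \<Longrightarrow> covers w a b \<Longrightarrow>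
    g (w \<circ> transpose a b) = h (w \<circ> transpose a b)"
    and "k \<in> {1..B}"
  shows "Uop B r k g w = Uop B r k h w"
  using assms(1)[of "inv w k"] inv_in_range[of w "{1..B}" k] assms(2)
  by (auto simp: Uop_def permutes_inverses(1) intro!: sum.cong)

section \<open>Sums of increasing words as complete symmetric polynomials in Monk operators\<close>

lemma Hop_0 [simp]: "Hop B r k 0 g = g"
proof
  fix w
  have "{R. R \<subseteq> {k..B} \<and> card R = 0} = {{}}"
    by (auto simp: finite_subset dest: finite_subset)
  then show "Hop B r k 0 g w = g w" by (simp add: Hop_def)
qed

lemma Hop_empty: "B < k \<Longrightarrow> Hop B r k (Suc m) g w = 0"
proof -
  assume "B < k"
  then have "{R. R \<subseteq> {k..B} \<and> card R = Suc m} = {}" by auto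
  then show ?thesis by (simp only: Hop_def sum.empty)
qed

lemma sorted_list_of_set_insert_Min:
  assumes "finite R" "\<And>x. x \<in> R \<Longrightarrow> k < x"
  shows "sorted_list_of_set (insert k R) = k # sorted_list_of_set R"
proof -
  have "k \<notin> R" using assms(2) by blast
  then have "sorted_list_of_set (insert k R) = insort k (sorted_list_of_set R)"
    using assms(1) by simp
  also have "\<dots> = k # sorted_list_of_set R"
    using assms by (intro insort_is_Cons) (auto simp: less_imp_le)
  finally show ?thesis .
qed

lemma Hop_Suc:
  assumes "k \<le> B"
  shows "Hop B r k (Suc m) g = (\<lambda>w. Hop B r (Suc k) (Suc m) g w + Uop B r k (Hop B r (Suc k) m g) w)"
proof
  fix w
  let ?F = "\<lambda>k m. {R. R \<subseteq> {k..B} \<and> card R = m}"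
  have fin: "finite (?F k m)" for k m by (rule finite_subset[of _ "Pow {k..B}"]) auto
  have finR: "finite R" if "R \<subseteq> {x..B}" for R x using that finite_subset by blast
  have eq: "?F k (Suc m) = ?F (Suc k) (Suc m) \<union> insert k ` ?F (Suc k) m"
  proof (intro equalityI subsetI)
    fix R assume R: "R \<in> ?F k (Suc m)"
    show "R \<in> ?F (Suc k) (Suc m) \<union> insert k ` ?F (Suc k) m"
    proof (cases "k \<in> R")
      case True
      have "x \<ge> Suc k" if "x \<in> R - {k}" for x using R that by (cases "x = k") force+
      then have "R - {k} \<in> ?F (Suc k) m" using R True finR[of R k] by auto
      then show ?thesis using True by (intro UnI2 image_eqI[of _ _ "R - {k}"]) auto
    next
      case False
      then have "x \<ge> Suc k" if "x \<in> R" for x using R that by (cases "x = k") force+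
      then show ?thesis using R by auto
    qed
  next
    fix R assume "R \<in> ?F (Suc k) (Suc m) \<union> insert k ` ?F (Suc k) m"
    then consider "R \<in> ?F (Suc k) (Suc m)" | P where "P \<in> ?F (Suc k) m" "R = insert k P" by blast
    then show "R \<in> ?F k (Suc m)"
    proof cases
      case 2
      then have "k \<notin> P" by auto
      then show ?thesis using 2 assms finR[of P "Suc k"] by auto
    qed auto
  qed
  have inj: "inj_on (insert k) (?F (Suc k) m)"
  proof (rule inj_onI)
    fix P Q assume P: "P \<in> ?F (Suc k) m" "Q \<in> ?F (Suc k) m" "insert k P = insert k Q"
    then have "k \<notin> P" "k \<notin> Q" by auto
    then show "P = Q" using P(3) by (metis Diff_insert_absorb)
  qed
  have "Hop B r k (Suc m) g w = Hop B r (Suc k) (Suc m) g w +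
      (\<Sum>R\<in>insert k ` ?F (Suc k) m. Uword B r (sorted_list_of_set R) g w)"
    unfolding Hop_def eq using fin by (intro sum.union_disjoint) auto
  also have "(\<Sum>R\<in>insert k ` ?F (Suc k) m. Uword B r (sorted_list_of_set R) g w) =
      (\<Sum>R\<in>?F (Suc k) m. Uop B r k (Uword B r (sorted_list_of_set R) g) w)"
  proof (subst sum.reindex[OF inj], rule sum.cong[OF refl])
    fix R assume "R \<in> ?F (Suc k) m"
    then have "sorted_list_of_set (insert k R) = k # sorted_list_of_set R"
      using finR[of R "Suc k"] by (intro sorted_list_of_set_insert_Min) auto
    then show "((\<lambda>R. Uword B r (sorted_list_of_set R) g w) \<circ> insert k) R =
        Uop B r k (Uword B r (sorted_list_of_set R) g) w"
      unfolding o_apply by (simp only: Uword.simps)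
  qed
  also have "\<dots> = Uop B r k (Hop B r (Suc k) m g) w"
    unfolding Hop_def Uop_sum ..
  finally show "Hop B r k (Suc m) g w =
    Hop B r (Suc k) (Suc m) g w + Uop B r k (Hop B r (Suc k) m g) w" .
qed

text \<open>This is the recursion h_{m+1}(x_1, ..., x_{r+1}) = h_{m+1}(x_1, ..., x_r) + x_{r+1}
  h_m(x_1, ..., x_{r+1}) with the restricted Monk operator as x_{r+1}. The induction on k is
  descending: \<open>Hop_Suc\<close> splits off the label k, \<open>zipper\<close> moves the Monk
  step behind it, and \<open>Zop_Suc_lower\<close> adjusts the threshold of what is left.\<close>

lemma Hop_row_Suc:
  fixes g :: "(nat \<Rightarrow> nat) \<Rightarrow> 'a::comm_ring_1"
  assumes r: "Suc r \<le> B" and k: "1 \<le> k"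
  shows "Hop B (Suc r) k (Suc m) g =
    (\<lambda>w. Hop B r k (Suc m) g w + Zop B k (Suc r) (Hop B (Suc r) k m g) w)"
  using k
proof (induction "Suc B - k" arbitrary: k m)
  case 0
  then have kB: "B < k" by simp
  have "Zop B k (Suc r) h w = 0" for h :: "(nat \<Rightarrow> nat) \<Rightarrow> 'a" and w
  proof (cases "w permutes {1..B}")
    case True
    then have "w (Suc r) \<in> {1..B}" using permutes_in_image[OF True, of "Suc r"] r by simp
    then show ?thesis using kB by (auto simp: Zop_def)
  qed (simp add: Zop_def)
  then show ?case by (simp add: Hop_empty[OF kB] fun_eq_iff)
next
  case (Suc d)
  then have kB: "k \<le> B" and kk: "k \<in> {1..B}" by auto
  have IH: "Hop B (Suc r) (Suc k) (Suc n) g =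
    (\<lambda>w. Hop B r (Suc k) (Suc n) g w + Zop B (Suc k) (Suc r) (Hop B (Suc r) (Suc k) n g) w)" for n
    using Suc.hyps(1)[of "Suc k" n] Suc.hyps(2) by simp
  note low = Zop_Suc_lower[OF r kk]
  show ?case
  proof
    fix w
    show "Hop B (Suc r) k (Suc m) g w = Hop B r k (Suc m) g w + Zop B k (Suc r) (Hop B (Suc r) k m g) w"
    proof (cases m)
      case 0
      show ?thesis
        using low[of g w] fun_cong[OF IH[of 0], of w]
        by (simp add: 0 Hop_Suc[OF kB] algebra_simps)
    next
      case (Suc n)
      let ?H = "Hop B (Suc r) (Suc k)"
      have A: "Zop B k (Suc r) (Hop B (Suc r) k m g) w =
          Zop B k (Suc r) (?H m g) w + Uop B r k (Zop B (Suc k) (Suc r) (?H n g)) w"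
        unfolding Suc Hop_Suc[OF kB] Zop_add zipper[OF r kk] ..
      have Bq: "Uop B r k (?H m g) w = Uop B r k (Hop B r (Suc k) m g) w +
          Uop B r k (Zop B (Suc k) (Suc r) (?H n g)) w"
        unfolding Suc IH[of n] Uop_add ..
      show ?thesis
        unfolding A using Bq low[of "?H m g" w] fun_cong[OF IH[of m], of w]
        by (simp add: Hop_Suc[OF kB] algebra_simps)
    qed
  qed
qed

text \<open>No position \<le> 0 holds a label \<ge> 1.\<close>

lemma Hop_row_0:
  assumes "1 \<le> k"
  shows "Hop B 0 k (Suc m) g = (\<lambda>w. 0)"
  using assms
proof (induction "Suc B - k" arbitrary: k m)
  case 0
  then have "B < k" by simp
  show ?case by (rule ext) (rule Hop_empty[OF \<open>B < k\<close>])
next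
  case (Suc d)
  then have kB: "k \<le> B" and kk: "k \<in> {1..B}" by auto
  have "Uop B 0 k h w = 0" for h :: "(nat \<Rightarrow> nat) \<Rightarrow> 'a" and w
    using inv_in_range[OF _ kk, of w] by (auto simp: Uop_def)
  moreover have "Hop B 0 (Suc k) (Suc m) g = (\<lambda>w. 0)" using Suc by simp
  ultimately show ?case by (simp add: Hop_Suc[OF kB])
qed

text \<open>By \<open>Hop_row_Suc\<close> and \<open>Hop_row_0\<close> the operator
  \<open>Hop\<close> is built by sums from Monk operators with the same threshold. The lemma is
  applied first with a Monk operator as X and then, using the result, with another
  \<open>Hop\<close>.\<close>

lemma commutes_Hop:
  fixes X :: "((nat \<Rightarrow> nat) \<Rightarrow> 'a::comm_ring_1) \<Rightarrow> (nat \<Rightarrow> nat) \<Rightarrow> 'a"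
  assumes add: "\<And>g h. X (\<lambda>w. g w + h w) = (\<lambda>w. X g w + X h w)"
    and zero: "X (\<lambda>w. 0) = (\<lambda>w. 0)"
    and com: "\<And>i g. i \<in> {1..B} \<Longrightarrow> X (Zop B k i g) = Zop B k i (X g)"
    and r: "r \<le> B" and k: "1 \<le> k"
  shows "X (Hop B r k m g) = Hop B r k m (X g)"
  using r
proof (induction r arbitrary: m)
  case 0
  then show ?case by (cases m) (simp_all add: Hop_row_0[OF k] zero)
next
  case (Suc r)
  show ?case
  proof (induction m)
    case (Suc m)
    have "X (Hop B r k (Suc m) g) = Hop B r k (Suc m) (X g)"
      using Suc.prems \<open>Suc r \<le> B\<close> by (intro \<open>\<And>m. r \<le> B \<Longrightarrow> X (Hop B r k m g) = Hop B r k m (X g)\<close>) simp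
    then show ?case
      unfolding Hop_row_Suc[OF \<open>Suc r \<le> B\<close> k] add using com[of "Suc r"] \<open>Suc r \<le> B\<close> Suc by simp
  qed simp
qed

lemma Hop_add: "Hop B r k m (\<lambda>v. g v + h v) w = Hop B r k m g w + Hop B r k m h w"
  by (simp add: Hop_def Uword_add sum.distrib)

lemma Hop_commute:
  fixes g :: "(nat \<Rightarrow> nat) \<Rightarrow> 'a::comm_ring_1"
  assumes "r \<le> B" "1 \<le> k"
  shows "Hop B r k p (Hop B r k q g) = Hop B r k q (Hop B r k p g)"
proof -
  have Z: "Zop B k i (Hop B r k m h) = Hop B r k m (Zop B k i h)"
    if i: "i \<in> {1..B}" for i m and h :: "(nat \<Rightarrow> nat) \<Rightarrow> 'a"
  proof (rule commutes_Hop[OF _ _ _ assms])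
    show "Zop B k i (\<lambda>w. g w + h w) = (\<lambda>w. Zop B k i g w + Zop B k i h w)"
      for g h :: "(nat \<Rightarrow> nat) \<Rightarrow> 'a" by (simp add: fun_eq_iff Zop_add)
    show "Zop B k i (\<lambda>w. 0 :: 'a) = (\<lambda>w. 0)" by (simp add: fun_eq_iff)
    show "Zop B k i (Zop B k j g) = Zop B k j (Zop B k i g)" if "j \<in> {1..B}"
      for j and g :: "(nat \<Rightarrow> nat) \<Rightarrow> 'a" by (rule ext) (rule Zop_commute[OF i that])
  qed
  show ?thesis
  proof (rule commutes_Hop[OF _ _ _ assms])
    show "Hop B r k p (\<lambda>w. g w + h w) = (\<lambda>w. Hop B r k p g w + Hop B r k p h w)"
      for g h :: "(nat \<Rightarrow> nat) \<Rightarrow> 'a" by (simp add: fun_eq_iff Hop_add)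
    show "Hop B r k p (\<lambda>w. 0) = (\<lambda>w. 0 :: 'a)"
      using Hop_add[of B r k p "\<lambda>w. 0 :: 'a" "\<lambda>w. 0"] by (simp add: fun_eq_iff)
    show "Hop B r k p (Zop B k i g) = Zop B k i (Hop B r k p g)" if "i \<in> {1..B}"
      for i and g :: "(nat \<Rightarrow> nat) \<Rightarrow> 'a" using Z[OF that] by simp
  qed
qed

subsection \<open>The Monk and Pieri formulas\<close>

text \<open>A generator of the nilCoxeter algebra, acting on functions through left multiplication
  of the argument. With it, \<open>rcop\<close> over the staircase becomes the Fomin-Stanley product
  for Schubert polynomials.\<close>

definition dop :: "nat \<Rightarrow> ((nat \<Rightarrow> nat) \<Rightarrow> 'a::comm_ring_1) \<Rightarrow> (nat \<Rightarrow> nat) \<Rightarrow> 'a" where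
  "dop j g w = (if ilen (simple_refl j \<circ> w) < ilen w then g (simple_refl j \<circ> w) else 0)"

lemma ilen_simple_comp_cases:
  assumes "w permutes {1..B}" "1 \<le> j" "Suc j \<le> B"
  shows "ilen (simple_refl j \<circ> w) = Suc (ilen w) \<or> ilen w = Suc (ilen (simple_refl j \<circ> w))"
  using ilen_simple_comp[OF assms] inv_neq_Suc[OF assms(1), of j] by linarith

lemma simple_refl_comp_permutes:
  assumes "w permutes {1..B}" "1 \<le> j" "Suc j \<le> B"
  shows "(simple_refl j \<circ> w) permutes {1..B}"
  using assms by (intro permutes_compose simple_refl_permutes)

lemma simple_refl_less_iff:
  assumes "\<not> (x = j \<and> y = Suc j)" "\<not> (x = Suc j \<and> y = j)"
  shows "simple_refl j x < simple_refl j y \<longleftrightarrow> x < y"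
  using assms by (auto simp: simple_refl_def transpose_def)

lemma simple_refl_eq [simp]: "simple_refl j j = Suc j" "simple_refl j (Suc j) = j"
  by (simp_all add: simple_refl_def)

lemma simple_refl_involutory [simp]: "simple_refl j (simple_refl j x) = x"
  by (simp add: simple_refl_def)

lemma simple_refl_comp_involutory: "simple_refl j \<circ> (simple_refl j \<circ> w) = w"
  by (simp add: fun_eq_iff)

lemma Zop_1:
  assumes w: "w permutes {1..B}" and r: "r \<in> {1..B}"
  shows "Zop B 1 r g w = (\<Sum>b\<in>{1..B} - {r}. if covers w r b
    then (if r < b then 1 else -1) * g (w \<circ> transpose r b) else 0)"
proof -
  have "1 \<le> w b" if "b \<in> {1..B}" for b
    using permutes_in_image[OF w, of b] that by simp
  then show ?thesis unfolding Zop_def using w r by (auto intro!: sum.cong)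
qed

text \<open>The terms of both sides match except for the cover \<open>w \<rightarrow> simple_refl j \<circ> w\<close> itself.\<close>

lemma Zop_dop:
  fixes g :: "(nat \<Rightarrow> nat) \<Rightarrow> 'a::comm_ring_1"
  assumes w: "w permutes {1..B}" and j: "1 \<le> j" "Suc j \<le> B" and r: "r \<in> {1..B}"
  shows "Zop B 1 r (dop j g) w = dop j (Zop B 1 r g) w +
    (if w r = j then g w else if w r = Suc j then - g w else 0)"
proof -
  let ?A = "{1..B} - {r}"
  define s :: "nat \<Rightarrow> 'a" where "s b = (if r < b then 1 else -1)" for b
  define v where "v = simple_refl j \<circ> w"
  have v: "v permutes {1..B}" unfolding v_def by (rule simple_refl_comp_permutes[OF w j])
  define P where "P b = (if covers w r b then s b * dop j g (w \<circ> transpose r b) else 0)" for b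
  define Q where "Q b = (if ilen v < ilen w \<and> covers v r b then s b * g (v \<circ> transpose r b) else 0)" for b
  define D where "D b = (if w r = j \<and> w b = Suc j then g w else if w r = Suc j \<and> w b = j then - g w else 0)" for b
  have "P b = Q b + D b" if b: "b \<in> ?A" for b
  proof -
    have bB: "b \<in> {1..B}" "r \<noteq> b" using b by auto
    define u where "u = w \<circ> transpose r b"
    define u' where "u' = v \<circ> transpose r b"
    have u'_eq: "u' = simple_refl j \<circ> u" by (simp add: u_def u'_def v_def comp_assoc)
    have u: "u permutes {1..B}" unfolding u_def using w r bB by (intro permutes_comp_transpose)
    note cu = ilen_simple_comp_cases[OF u j, folded u'_eq]
    note cw = ilen_simple_comp_cases[OF w j, folded v_def]
    note rw = ilen_less_iff_raises[OF w bB(2) r bB(1), folded u_def]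
    note rv = ilen_less_iff_raises[OF v bB(2) r bB(1), folded u'_def]
    have P: "P b = (if ilen u = Suc (ilen w) \<and> ilen u' < ilen u then s b * g u' else 0)"
      unfolding P_def dop_def covers_def u_def[symmetric] u'_eq[symmetric] by simp
    have Q: "Q b = (if ilen v < ilen w \<and> ilen u' = Suc (ilen v) then s b * g u' else 0)"
      unfolding Q_def covers_def u'_def[symmetric] by simp
    show ?thesis
    proof (cases "w r = j \<and> w b = Suc j \<or> w r = Suc j \<and> w b = j")
      \<comment> \<open>The permutations w, v, u, u' form a square. Its sides by
        \<open>simple_refl j\<close> change the length by exactly one, and its two transpositions
        both raise or both lower the length, so the two length patterns are equivalent.\<close>
      case False
      have "raises w r b \<longleftrightarrow> raises v r b"
        unfolding raises_def v_def o_apply using False by (subst simple_refl_less_iff) auto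
      then have "ilen u = Suc (ilen w) \<and> ilen u' < ilen u \<longleftrightarrow> ilen v < ilen w \<and> ilen u' = Suc (ilen v)"
        using cu cw rw rv by linarith
      then show ?thesis unfolding P Q D_def using False by auto
    next
      \<comment> \<open>The transposition of positions is itself the left multiplication by
        \<open>simple_refl j\<close>, so the chain goes to v and back to w. It occurs on one side
        only, depending on whether v is longer, and the sign makes the difference the same in both
        cases.\<close>
      case True
      have "u = v"
      proof
        fix x
        have inj: "w x = w y \<longleftrightarrow> x = y" for y using permutes_inj[OF w] by (auto dest: injD)
        show "u x = v x"
          using True inj[of r] inj[of b] unfolding u_def v_def
          by (auto simp: simple_refl_def transpose_def)
      qed
      then have u': "u' = w" unfolding u'_eq v_def by (simp add: simple_refl_comp_involutory)
      have "raises w r b \<longleftrightarrow> (r < b \<longleftrightarrow> w r = j)" using True by (auto simp: raises_def)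
      then show ?thesis unfolding P Q D_def s_def using True rw cw bB(2) unfolding u' \<open>u = v\<close>
        by (auto simp: not_less)
    qed
  qed
  then have "(\<Sum>b\<in>?A. P b) = (\<Sum>b\<in>?A. Q b) + (\<Sum>b\<in>?A. D b)"
    by (simp add: sum.distrib)
  moreover have "(\<Sum>b\<in>?A. P b) = Zop B 1 r (dop j g) w"
    unfolding Zop_1[OF w r] P_def s_def ..
  moreover have "(\<Sum>b\<in>?A. Q b) = dop j (Zop B 1 r g) w"
    unfolding dop_def v_def[symmetric] Zop_1[OF v r] Q_def s_def by simp
  moreover have "(\<Sum>b\<in>?A. D b) = (if w r = j then g w else if w r = Suc j then - g w else 0)"
  proof -
    have in_A: "inv w x \<in> ?A" if "x \<in> {1..B}" "w r \<noteq> x" for x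
      using inv_in_range[OF w that(1)] permutes_inverses(1)[OF w, of x] that(2) by auto
    have wx: "w b = x \<longleftrightarrow> b = inv w x" for b x
      using permutes_inverses[OF w] by auto
    have D: "D b = (if b = inv w (Suc j) then (if w r = j then g w else 0) else 0) +
        (if b = inv w j then (if w r = Suc j then - g w else 0) else 0)" for b
      unfolding D_def wx[of b] by auto
    have "(\<Sum>b\<in>?A. if b = inv w (Suc j) then (if w r = j then g w else 0) else 0) =
        (if w r = j then g w else 0)"
      using in_A[of "Suc j"] j by (subst sum.delta) auto
    moreover have "(\<Sum>b\<in>?A. if b = inv w j then (if w r = Suc j then - g w else 0) else 0) =
        (if w r = Suc j then - g w else 0)"
      using in_A[of j] j by (subst sum.delta) auto
    ultimately show ?thesis unfolding D sum.distrib by auto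
  qed
  ultimately show ?thesis by simp
qed

text \<open>Summing over all subsets of the boxes in \<open>L\<close> amounts to the product of the operators
  \<open>1 + x\<^sub>i d\<^sub>i\<^sub>+\<^sub>j\<^sub>-\<^sub>1\<close>, where \<open>d\<^sub>j\<close> is \<open>dop j\<close>.\<close>

fun rcop :: "(nat \<Rightarrow> 'a::comm_ring_1) \<Rightarrow> (nat \<times> nat) list \<Rightarrow> ((nat \<Rightarrow> nat) \<Rightarrow> 'a) \<Rightarrow> (nat \<Rightarrow> nat) \<Rightarrow> 'a" where
  "rcop x [] g = g"
| "rcop x ((i, j) # L) g = (\<lambda>w. rcop x L g w + x i * dop (i + j - 1) (rcop x L g) w)"

text \<open>The columns decrease because rows of an rc-graph are read from right to left.\<close>

definition stair_row :: "nat \<Rightarrow> nat \<Rightarrow> (nat \<times> nat) list" where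
  "stair_row i m = map (Pair i) (rev [1..<Suc m])"

definition stair :: "nat \<Rightarrow> nat \<Rightarrow> (nat \<times> nat) list" where
  "stair B i = concat (map (\<lambda>i. stair_row i (B - i)) [i..<B])"

definition id_indicator :: "(nat \<Rightarrow> nat) \<Rightarrow> 'a::comm_ring_1" where
  "id_indicator w = (if w = id then 1 else 0)"

lemma stair_row_Suc: "stair_row i (Suc m) = (i, Suc m) # stair_row i m"
  by (simp add: stair_row_def)

lemma stair_Cons: "i < B \<Longrightarrow> stair B i = stair_row i (B - i) @ stair B (Suc i)"
  by (simp add: stair_def upt_conv_Cons)

lemma stair_Nil: "B \<le> i \<Longrightarrow> stair B i = []"
  by (simp add: stair_def)

lemma set_stair_row: "set (stair_row i m) = {i} \<times> {1..m}"
  by (auto simp: stair_row_def)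

lemma set_stair: "set (stair B k) = {(i, j). k \<le> i \<and> 1 \<le> j \<and> i + j \<le> B}"
  by (auto simp: stair_def set_stair_row)

lemma distinct_stair: "distinct (stair B k)"
proof (induction "B - k" arbitrary: k)
  case 0
  then show ?case by (simp add: stair_Nil)
next
  case (Suc d)
  then have "distinct (stair B (Suc k))" by simp
  moreover have "distinct (stair_row k (B - k))"
    by (simp add: stair_row_def distinct_map inj_on_def)
  moreover have "set (stair_row k (B - k)) \<inter> set (stair B (Suc k)) = {}"
    by (auto simp: set_stair stair_row_def)
  ultimately show ?case using Suc.hyps(2) by (simp add: stair_Cons)
qed

lemma dop_cong: "g (simple_refl j \<circ> w) = h (simple_refl j \<circ> w) \<Longrightarrow> dop j g w = dop j h w"
  by (simp add: dop_def)

text \<open>Passing one factor of the row produces boundary terms by \<open>Zop_dop\<close>. Along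
  the row they telescope: only the condition \<open>w r = i + m\<close> at the first factor and
  \<open>v r = i\<close> behind the last one remain.\<close>

lemma rcop_row_zipper:
  fixes g :: "(nat \<Rightarrow> nat) \<Rightarrow> 'a::comm_ring_1"
  assumes w: "w permutes {1..B}" and r: "r \<in> {1..B}" and i: "1 \<le> i" "i + m \<le> B"
  shows "Zop B 1 r (rcop x (stair_row i m) g) w +
      (if w r = i + m then x i * rcop x (stair_row i m) g w else 0) =
    rcop x (stair_row i m) (\<lambda>v. Zop B 1 r g v + (if v r = i then x i * g v else 0)) w"
  using w i
proof (induction m arbitrary: w)
  case 0
  then show ?case by (simp add: stair_row_def)
next
  case (Suc m)
  let ?J = "i + m"
  define G where "G = rcop x (stair_row i m) g"
  define G' where "G' = rcop x (stair_row i m) (\<lambda>v. Zop B 1 r g v + (if v r = i then x i * g v else 0))"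
  have J: "1 \<le> ?J" "Suc ?J \<le> B" using Suc.prems by auto
  have IH: "Zop B 1 r G v + (if v r = ?J then x i * G v else 0) = G' v" if "v permutes {1..B}" for v
    unfolding G_def G'_def using Suc.IH[OF that] Suc.prems by simp
  let ?v = "simple_refl ?J \<circ> w"
  have v: "?v permutes {1..B}" by (rule simple_refl_comp_permutes[OF Suc.prems(1) J])
  have vr: "?v r = ?J \<longleftrightarrow> w r = Suc ?J"
    by (metis o_apply simple_refl_eq(2) simple_refl_involutory)
  have d: "dop ?J G' w = dop ?J (Zop B 1 r G) w + (if w r = Suc ?J then x i * dop ?J G w else 0)"
    unfolding dop_def IH[OF v, symmetric] vr by simp
  have "Zop B 1 r (\<lambda>v. G v + x i * dop ?J G v) w = Zop B 1 r G w + x i * (dop ?J (Zop B 1 r G) w +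
    (if w r = ?J then G w else if w r = Suc ?J then - G w else 0))"
    unfolding Zop_add Zop_mult Zop_dop[OF Suc.prems(1) J r] ..
  then show ?case
    unfolding stair_row_Suc rcop.simps G_def[symmetric] G'_def[symmetric]
    using IH[OF Suc.prems(1)] d by (auto simp: algebra_simps)
qed

lemma rcop_append: "rcop x (L @ L') g = rcop x L (rcop x L' g)"
  by (induction L) auto

lemma rcop_mult: "rcop x L (\<lambda>v. c * g v) = (\<lambda>w. c * rcop x L g w)"
  by (induction L) (auto simp: dop_def fun_eq_iff algebra_simps)

lemma descent_in_range:
  assumes w: "w permutes {1..n}" and j: "1 \<le> j" and l: "ilen (simple_refl j \<circ> w) < ilen w"
  shows "Suc j \<le> n"
proof (rule ccontr)
  assume n: "\<not> Suc j \<le> n"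
  have w': "w permutes {1..Suc j}" using w by (rule permutes_subset) (use n in auto)
  have "inv w (Suc j) < inv w j"
    using ilen_simple_comp(1)[OF w' j] inv_neq_Suc[OF w, of j] l by force
  moreover have "inv w (Suc j) = Suc j" using permutes_not_in[OF permutes_inv[OF w]] n by simp
  moreover have "inv w j \<le> Suc j" using inv_in_range[OF w', of j] j by simp
  ultimately show False by simp
qed

lemma rcop_cong:
  assumes "\<And>v. v permutes {1..n} \<Longrightarrow> g v = h v" "w permutes {1..n}"
    and "\<And>i j. (i, j) \<in> set L \<Longrightarrow> 1 \<le> i \<and> 1 \<le> j"
  shows "rcop x L g w = rcop x L h w"
  using assms(2,3)
proof (induction L arbitrary: w)
  case Nil
  then show ?case using assms(1) by simp
next
  case (Cons p L)
  obtain i j where p: "p = (i, j)" by fastforce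
  let ?k = "i + j - 1"
  have "1 \<le> i" "1 \<le> j" using Cons.prems(2)[of i j] p by simp_all
  then have k: "1 \<le> ?k" by arith
  have IH: "rcop x L g v = rcop x L h v" if "v permutes {1..n}" for v
    by (rule Cons.IH[OF that]) (rule Cons.prems(2), simp)
  have "dop ?k (rcop x L g) w = dop ?k (rcop x L h) w"
  proof (cases "ilen (simple_refl ?k \<circ> w) < ilen w")
    case True
    have "(simple_refl ?k \<circ> w) permutes {1..n}"
      using simple_refl_comp_permutes[OF Cons.prems(1) k] descent_in_range[OF Cons.prems(1) k True] by simp
    then show ?thesis by (intro dop_cong IH)
  qed (simp add: dop_def)
  then show ?case using IH[OF Cons.prems(1)] by (simp add: p)
qed

text \<open>Labels above i belong to simple reflections that fix every y \<le> i.\<close>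

lemma rcop_support:
  assumes "\<And>v. g v \<noteq> 0 \<Longrightarrow> \<forall>y\<le>i. v y = y"
    and "\<And>a b. (a, b) \<in> set L \<Longrightarrow> i < a + b - 1" and "rcop x L g w \<noteq> 0"
  shows "\<forall>y\<le>i. w y = y"
  using assms(2,3)
proof (induction L arbitrary: w)
  case Nil
  then show ?case using assms(1) by simp
next
  case (Cons p L)
  obtain a b where p: "p = (a, b)" by fastforce
  let ?k = "a + b - 1"
  have ik: "i < ?k" using Cons.prems(1)[of a b] p by simp
  have IH: "rcop x L g v \<noteq> 0 \<Longrightarrow> \<forall>y\<le>i. v y = y" for v using Cons.IH Cons.prems(1) by simp
  have "rcop x L g w \<noteq> 0 \<or> rcop x L g (simple_refl ?k \<circ> w) \<noteq> 0"
    using Cons.prems(2) by (auto simp: p dop_def split: if_splits)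
  then show ?case
  proof
    assume "rcop x L g (simple_refl ?k \<circ> w) \<noteq> 0"
    then have a: "simple_refl ?k (w y) = y" if "y \<le> i" for y using IH that by fastforce
    show ?thesis
    proof (intro allI impI)
      fix y assume y: "y \<le> i"
      have "w y = simple_refl ?k y" using a[OF y] by (metis simple_refl_involutory)
      then show "w y = y" using y ik by (simp add: simple_refl_def transpose_def)
    qed
  qed (rule IH)
qed

lemma Zop_id_indicator:
  assumes "w permutes {1..B}" "r \<in> {1..B}"
  shows "Zop B 1 r id_indicator w = (0::'a::comm_ring_1)"
  unfolding Zop_1[OF assms]
proof (intro sum.neutral ballI)
  fix b
  have "w \<circ> transpose r b \<noteq> id" if "covers w r b"
    using that unfolding covers_def by (metis ilen_id nat.distinct(1))
  then show "(if covers w r b then (if r < b then 1 else - 1) * id_indicator (w \<circ> transpose r b) else 0) = (0 :: 'a)"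
    by (simp add: id_indicator_def)
qed

text \<open>Rows are split off from the top. For row i the boundary condition at the first factor
  reads \<open>w r = B\<close>, which n < B excludes. The one behind the last factor reads
  \<open>v r = i\<close>; on the support of the later rows, which fix i, this means r = i. So the
  factor x_r is created by row r alone.\<close>

lemma monk_rows:
  fixes x :: "nat \<Rightarrow> 'a::comm_ring_1"
  assumes "w permutes {1..n}" "r \<in> {1..n}" "n < B" "1 \<le> i" "i \<le> B"
  shows "Zop B 1 r (rcop x (stair B i) id_indicator) w =
    (if i \<le> r then x r * rcop x (stair B i) id_indicator w else 0)"
  using assms
proof (induction "B - i" arbitrary: i w)
  case 0
  then have "i = B" "w permutes {1..B}" "r \<in> {1..B}" by (auto elim!: permutes_subset)
  then show ?case using 0 Zop_id_indicator[of w B r] by (simp add: stair_Nil)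
next
  case (Suc d)
  then have iB: "i < B" by simp
  define G where "G = rcop x (stair B (Suc i)) id_indicator"
  let ?R = "stair_row i (B - i)"
  have S: "rcop x (stair B i) id_indicator = rcop x ?R G"
    unfolding stair_Cons[OF iB] rcop_append G_def ..
  have wB: "w permutes {1..B}" using Suc.prems(1) by (rule permutes_subset) (use Suc.prems in auto)
  have wr: "w r \<noteq> B" using permutes_in_image[OF Suc.prems(1), of r] Suc.prems by auto
  have IH: "Zop B 1 r G v = (if Suc i \<le> r then x r * G v else 0)" if "v permutes {1..n}" for v
    unfolding G_def using Suc.hyps(2) iB Suc.prems that by (intro Suc.hyps(1)) auto
  have supp: "\<forall>y\<le>i. v y = y" if "G v \<noteq> 0" for v
  proof (rule rcop_support[OF _ _ that[unfolded G_def]])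
    show "\<forall>y\<le>i. v y = y" if "id_indicator v \<noteq> (0::'a)" for v
      using that by (simp add: id_indicator_def split: if_splits)
    show "i < a + b - 1" if "(a, b) \<in> set (stair B (Suc i))" for a b
      using that by (simp add: set_stair) arith
  qed
  have step: "Zop B 1 r G v + (if v r = i then x i * G v else 0) = (if i \<le> r then x r else 0) * G v"
    if v: "v permutes {1..n}" for v
  proof (cases "G v = 0")
    case False
    then have "v i = i" using supp by simp
    then have "v r = i \<longleftrightarrow> r = i" using injD[OF permutes_inj[OF v], of r i] by auto
    then show ?thesis using IH[OF v] by auto
  qed (use IH[OF v] in simp)
  have "Zop B 1 r (rcop x ?R G) w = rcop x ?R (\<lambda>v. Zop B 1 r G v + (if v r = i then x i * G v else 0)) w"
    using rcop_row_zipper[OF wB, of r i "B - i" x G] wr Suc.prems iB by simp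
  also have "\<dots> = rcop x ?R (\<lambda>v. (if i \<le> r then x r else 0) * G v) w"
    using step Suc.prems by (intro rcop_cong[of n]) (auto simp: stair_row_def)
  finally show ?case unfolding S rcop_mult by simp
qed

section \<open>Expansion of the staircase product over rc-graphs\<close>

fun dword :: "nat list \<Rightarrow> ((nat \<Rightarrow> nat) \<Rightarrow> 'a::comm_ring_1) \<Rightarrow> (nat \<Rightarrow> nat) \<Rightarrow> 'a" where
  "dword [] g = g"
| "dword (k # ks) g = dop k (dword ks g)"

definition box_label :: "nat \<times> nat \<Rightarrow> nat" where
  "box_label p = fst p + snd p - 1"

lemma rcop_expand:
  fixes x :: "nat \<Rightarrow> 'a::comm_ring_1"
  assumes "distinct L"
  shows "rcop x L g w = (\<Sum>R\<in>Pow (set L). (\<Prod>(i, j)\<in>R. x i) *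
    dword (map box_label (filter (\<lambda>p. p \<in> R) L)) g w)"
  using assms
proof (induction L arbitrary: w)
  case (Cons p L)
  obtain i j where p: "p = (i, j)" by fastforce
  have pL: "p \<notin> set L" and L: "distinct L" using Cons.prems by auto
  let ?D = "\<lambda>R L. dword (map box_label (filter (\<lambda>p. p \<in> R) L)) g"
  let ?X = "\<lambda>R. \<Prod>(i, j)\<in>R. x i"
  have d: "dop k (rcop x L g) w = (\<Sum>R\<in>Pow (set L). ?X R * dop k (?D R L) w)" for k
    unfolding dop_def Cons.IH[OF L] by simp
  have inj: "inj_on (insert p) (Pow (set L))"
    using pL by (intro inj_onI) (metis Diff_insert_absorb PowD subsetD)
  have "(\<Sum>R\<in>Pow (set (p # L)). ?X R * ?D R (p # L) w) =
      (\<Sum>R\<in>Pow (set L). ?X R * ?D R (p # L) w) + (\<Sum>R\<in>insert p ` Pow (set L). ?X R * ?D R (p # L) w)"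
    unfolding list.set Pow_insert using pL by (intro sum.union_disjoint) auto
  also have "(\<Sum>R\<in>Pow (set L). ?X R * ?D R (p # L) w) = (\<Sum>R\<in>Pow (set L). ?X R * ?D R L w)"
    using pL by (intro sum.cong refl) auto
  also have "(\<Sum>R\<in>insert p ` Pow (set L). ?X R * ?D R (p # L) w) =
      (\<Sum>R\<in>Pow (set L). x i * (?X R * dop (i + j - 1) (?D R L) w))"
  proof (subst sum.reindex[OF inj], rule sum.cong[OF refl], unfold o_apply)
    fix R assume R: "R \<in> Pow (set L)"
    then have "finite R" "p \<notin> R" using pL finite_subset by auto
    then have "?X (insert p R) = x i * ?X R" by (simp add: p)
    moreover have "filter (\<lambda>q. q \<in> insert p R) (p # L) = p # filter (\<lambda>q. q \<in> R) L"
      using pL by (auto intro!: filter_cong)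
    ultimately show "?X (insert p R) * ?D (insert p R) (p # L) w = x i * (?X R * dop (i + j - 1) (?D R L) w)"
      by (simp only: list.map dword.simps) (simp add: box_label_def p mult.assoc)
  qed
  finally show ?case
    unfolding p rcop.simps Cons.IH[OF L] d by (simp add: sum_distrib_left)
qed simp

text \<open>Every letter has to shorten the permutation, so the word ends at the identity exactly if
  it is reduced for w.\<close>

lemma dword_id_indicator:
  assumes "w permutes {1..B}" "set ks \<subseteq> {1..<B}"
  shows "dword ks id_indicator w = (if word_perm ks = w \<and> length ks = ilen w then 1 else (0::'a::comm_ring_1))"
  using assms
proof (induction ks arbitrary: w)
  case Nil
  then show ?case by (auto simp: id_indicator_def)
next
  case (Cons k ks)
  have k: "1 \<le> k" "Suc k \<le> B" using Cons.prems by auto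
  define v where "v = simple_refl k \<circ> w"
  have v: "v permutes {1..B}" unfolding v_def by (rule simple_refl_comp_permutes[OF Cons.prems(1) k])
  have IH: "dword ks id_indicator v = (if word_perm ks = v \<and> length ks = ilen v then 1 else (0::'a))"
    by (rule Cons.IH[OF v]) (use Cons.prems(2) in simp)
  have eq: "word_perm ks = v \<longleftrightarrow> word_perm (k # ks) = w"
    unfolding word_perm_Cons v_def by (metis simple_refl_comp_involutory)
  have le: "ilen v \<le> length ks" if "word_perm ks = v"
    using ilen_word_perm_le[of ks B] Cons.prems(2) that by simp
  define b where "b \<longleftrightarrow> word_perm (k # ks) = w"
  show ?case
    using ilen_simple_comp_cases[OF Cons.prems(1) k, folded v_def] le
    unfolding dword.simps dop_def v_def[symmetric] IH eq b_def[symmetric] by auto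
qed

lemma reduced_letters:
  assumes "w permutes {1..n}" "set ks \<subseteq> {1..}" "word_perm ks = w" "length ks = ilen w"
  shows "set ks \<subseteq> {1..<n}"
  using assms
proof (induction ks arbitrary: w)
  case (Cons k ks)
  define v where "v = simple_refl k \<circ> w"
  have v: "word_perm ks = v"
    using Cons.prems(3) unfolding word_perm_Cons v_def by (metis simple_refl_comp_involutory)
  have k: "1 \<le> k" using Cons.prems(2) by simp
  have "set ks \<subseteq> {1..<Suc (Max (insert 0 (set ks)))}"
    using Cons.prems(2) by (auto simp: less_Suc_eq_le)
  from ilen_word_perm_le[OF this] have "ilen v \<le> length ks" unfolding v .
  then have less: "ilen v < ilen w" using Cons.prems(4) by simp
  have kn: "Suc k \<le> n" by (rule descent_in_range[OF Cons.prems(1) k less[unfolded v_def]])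
  have vn: "v permutes {1..n}" unfolding v_def by (rule simple_refl_comp_permutes[OF Cons.prems(1) k kn])
  have "length ks = ilen v"
    using ilen_simple_comp_cases[OF Cons.prems(1) k kn, folded v_def] less Cons.prems(4) by simp
  with v have "set ks \<subseteq> {1..<n}" by (intro Cons.IH[OF vn]) (use Cons.prems(2) in auto)
  then show ?case using k kn by simp
qed simp

lemma sorted_list_of_set_filter:
  assumes "sorted xs" "distinct xs"
  shows "sorted_list_of_set {x \<in> set xs. P x} = filter P xs"
proof -
  have "sorted_list_of_set (set (filter P xs)) = filter P xs"
    using assms by (intro sorted_list_of_set.idem_if_sorted_distinct) (auto simp: sorted_wrt_filter)
  then show ?thesis by simp
qed

lemma graph_word_stair:
  assumes R: "R \<subseteq> set (stair B 1)"
  shows "graph_word R = map box_label (filter (\<lambda>p. p \<in> R) (stair B 1))"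
proof -
  define row where "row i = map (\<lambda>j. i + j - 1) (rev (sorted_list_of_set {j. (i, j) \<in> R}))" for i
  have rows: "sorted_list_of_set (fst ` R) = filter (\<lambda>i. i \<in> fst ` R) [1..<B]"
  proof -
    have "{i \<in> set [1..<B]. i \<in> fst ` R} = fst ` R" using R by (force simp: set_stair)
    then show ?thesis using sorted_list_of_set_filter[of "[1..<B]" "\<lambda>i. i \<in> fst ` R"] by simp
  qed
  have row: "row i = map box_label (filter (\<lambda>p. p \<in> R) (stair_row i (B - i)))" if "i < B" for i
  proof -
    have "{j \<in> set [1..<Suc (B - i)]. (i, j) \<in> R} = {j. (i, j) \<in> R}"
      using R that by (auto simp: set_stair)
    moreover have "sorted_list_of_set {j \<in> set [1..<Suc (B - i)]. (i, j) \<in> R} =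
        filter (\<lambda>j. (i, j) \<in> R) [1..<Suc (B - i)]"
      by (intro sorted_list_of_set_filter) (simp_all del: upt_Suc)
    ultimately have "sorted_list_of_set {j. (i, j) \<in> R} = filter (\<lambda>j. (i, j) \<in> R) [1..<Suc (B - i)]"
      by (simp only:)
    then show ?thesis
      unfolding row_def stair_row_def
      by (simp add: rev_filter filter_map o_def box_label_def del: upt_Suc)
  qed
  have empty: "row i = []" if "i \<notin> fst ` R" for i
  proof -
    have "{j. (i, j) \<in> R} = {}" using that by force
    then show ?thesis by (simp add: row_def)
  qed
  have skip: "concat (map row (filter (\<lambda>i. i \<in> fst ` R) xs)) = concat (map row xs)" for xs
    by (induction xs) (auto simp: empty)
  have "graph_word R = concat (map row [1..<B])"
    unfolding graph_word_def rows row_def[symmetric] by (rule skip)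
  also have "\<dots> = map box_label (filter (\<lambda>p. p \<in> R) (stair B 1))"
    unfolding stair_def map_concat filter_concat map_map o_def
    by (intro arg_cong[of _ _ concat] map_cong refl row) simp
  finally show ?thesis .
qed

text \<open>The labels of a reduced word of w are below B, so all rc-graphs of w lie in the
  staircase i + j \<le> B. In particular the right-hand side is independent of the choice of
  B.\<close>

lemma schubert_eq_rcop:
  assumes w: "w permutes {1..B}"
  shows "schubert w = rcop var (stair B 1) id_indicator w"
proof -
  let ?S = "Pow (set (stair B 1))"
  have rc: "rc_graph w R \<longleftrightarrow> R \<in> ?S \<and> word_perm (graph_word R) = w \<and> length (graph_word R) = ilen w" for R
  proof
    assume a: "rc_graph w R"
    then have b: "finite R" "R \<subseteq> {1..} \<times> {1..}" "set (graph_word R) \<subseteq> {1..}"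
      "word_perm (graph_word R) = w" "length (graph_word R) = ilen w"
      by (auto simp: rc_graph_def reduced_word_def coxeter_length_eq_ilen[OF w])
    have "R \<subseteq> set (stair B 1)"
    proof
      fix p assume p: "p \<in> R"
      obtain i j where ij: "p = (i, j)" by fastforce
      have "{j. (i, j) \<in> R} \<subseteq> snd ` R" by force
      then have fin: "finite (fst ` R)" "finite {j. (i, j) \<in> R}"
        using b(1) finite_subset by auto
      have "i + j - 1 \<in> set (graph_word R)"
        unfolding graph_word_def using p ij fin by (force simp: image_iff)
      then have "i + j - 1 < B" using reduced_letters[OF w b(3-5)] by auto
      then show "p \<in> set (stair B 1)" using b(2) p ij by (auto simp: set_stair)
    qed
    then show "R \<in> ?S \<and> word_perm (graph_word R) = w \<and> length (graph_word R) = ilen w" using b by simp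
  next
    assume a: "R \<in> ?S \<and> word_perm (graph_word R) = w \<and> length (graph_word R) = ilen w"
    then have R: "R \<subseteq> set (stair B 1)" by simp
    have "set (graph_word R) \<subseteq> {1..}"
      unfolding graph_word_stair[OF R] by (auto simp: set_stair box_label_def)
    moreover have "finite R" using R by (rule finite_subset) simp
    ultimately show "rc_graph w R"
      using a R
      by (auto simp: rc_graph_def reduced_word_def coxeter_length_eq_ilen[OF w] set_stair subset_iff)
  qed
  have "rcop var (stair B 1) id_indicator w = (\<Sum>R\<in>?S. (\<Prod>(i, j)\<in>R. var i) *
    (if word_perm (graph_word R) = w \<and> length (graph_word R) = ilen w then 1 else 0))"
    unfolding rcop_expand[OF distinct_stair]
  proof (rule sum.cong[OF refl])
    fix R assume "R \<in> ?S"
    then have R: "R \<subseteq> set (stair B 1)" by simp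
    have "set (graph_word R) \<subseteq> {1..<B}"
      unfolding graph_word_stair[OF R] by (auto simp: set_stair box_label_def)
    then show "(\<Prod>(i, j)\<in>R. var i) * dword (map box_label (filter (\<lambda>p. p \<in> R) (stair B 1))) id_indicator w =
      (\<Prod>(i, j)\<in>R. var i) * (if word_perm (graph_word R) = w \<and> length (graph_word R) = ilen w then 1 else 0)"
      using dword_id_indicator[OF w, of "graph_word R", where 'a = mpoly] by (simp add: graph_word_stair[OF R])
  qed
  also have "\<dots> = (\<Sum>R\<in>?S. if word_perm (graph_word R) = w \<and> length (graph_word R) = ilen w
    then \<Prod>(i, j)\<in>R. var i else 0)"
    by (intro sum.cong refl) simp
  also have "\<dots> = (\<Sum>R | rc_graph w R. \<Prod>(i, j)\<in>R. var i)"
    unfolding rc by (subst sum.inter_filter[symmetric]) simp_all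
  finally show ?thesis by (simp add: schubert_def)
qed

text \<open>Otherwise position n + 1, which holds the value n + 1, would lie between r and b in
  position and in value. So a cover enlarges the range by at most one; this is the source of all
  bounds n + m \<le> B below.\<close>

lemma covers_range:
  assumes w: "w permutes {1..n}" and "n < B" "r \<in> {1..n}" "b \<in> {1..B}" "r \<noteq> b" "covers w r b"
  shows "b \<le> Suc n"
proof (rule ccontr)
  assume n: "\<not> b \<le> Suc n"
  have wB: "w permutes {1..B}" using w by (rule permutes_subset) (use assms in auto)
  have "w (Suc n) = Suc n" "w b = b" using permutes_not_in[OF w] n by auto
  moreover have "w r \<le> n" using permutes_in_image[OF w, of r] assms by auto
  ultimately have "w r < w (Suc n)" "w (Suc n) < w b" using n by auto
  moreover have "r < Suc n" "Suc n < b" using n assms by auto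
  ultimately show False using covers_iff[OF wB, of r b] assms by auto
qed

text \<open>Monk's rule for x_r. With n < B no cover is lost, since all of them have b \<le> n +
  1.\<close>

lemma schubert_monk:
  assumes "w permutes {1..n}" "r \<in> {1..n}" "n < B"
  shows "Zop B 1 r schubert w = var r * schubert w"
proof -
  have wB: "w permutes {1..B}" using assms(1) by (rule permutes_subset) (use assms in auto)
  have rB: "r \<in> {1..B}" using assms by auto
  have "Zop B 1 r schubert w = Zop B 1 r (rcop var (stair B 1) id_indicator) w"
    unfolding Zop_1[OF wB rB]
  proof (rule sum.cong[OF refl])
    fix b assume "b \<in> {1..B} - {r}"
    then have "schubert (w \<circ> transpose r b) = rcop var (stair B 1) id_indicator (w \<circ> transpose r b)"
      using wB rB by (intro schubert_eq_rcop permutes_comp_transpose) auto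
    then show "(if covers w r b then (if r < b then 1 else - 1) * schubert (w \<circ> transpose r b) else 0) =
      (if covers w r b then (if r < b then 1 else - 1) *
        rcop var (stair B 1) id_indicator (w \<circ> transpose r b) else 0)" by simp
  qed
  also have "\<dots> = var r * rcop var (stair B 1) id_indicator w"
    using monk_rows[OF assms, of 1 var] assms by simp
  finally show ?thesis by (simp add: schubert_eq_rcop[OF wB])
qed

text \<open>The complete symmetric polynomial h_m(x_1, ..., x_r), in the form that
  \<open>Hop_row_Suc\<close> produces.\<close>

fun hpoly :: "nat \<Rightarrow> nat \<Rightarrow> mpoly" where
  "hpoly r 0 = 1"
| "hpoly 0 (Suc m) = 0"
| "hpoly (Suc r) (Suc m) = hpoly r (Suc m) + var (Suc r) * hpoly (Suc r) m"

lemma schubert_pieri: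
  assumes "w permutes {1..n}" "r \<le> n" "n + m \<le> B"
  shows "Hop B r 1 m schubert w = hpoly r m * schubert w"
  using assms
proof (induction r m arbitrary: w n rule: hpoly.induct)
  case (1 r)
  then show ?case by simp
next
  case (2 m)
  then show ?case by (simp add: Hop_row_0)
next
  case (3 r m)
  have rB: "Suc r \<le> B" and nB: "n < B" using "3.prems" by auto
  have wB: "w permutes {1..B}" using "3.prems"(1) by (rule permutes_subset) (use nB in auto)
  have rn: "Suc r \<in> {1..n}" and rB': "Suc r \<in> {1..B}" using "3.prems" rB by auto
  have "Zop B 1 (Suc r) (Hop B (Suc r) 1 m schubert) w = Zop B 1 (Suc r) (\<lambda>v. hpoly (Suc r) m * schubert v) w"
    unfolding Zop_1[OF wB rB']
  proof (rule sum.cong[OF refl])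
    fix b assume b: "b \<in> {1..B} - {Suc r}"
    have "Hop B (Suc r) 1 m schubert (w \<circ> transpose (Suc r) b) = hpoly (Suc r) m * schubert (w \<circ> transpose (Suc r) b)"
      if c: "covers w (Suc r) b"
    \<comment> \<open>The Monk step may leave {1..n}, so the hypothesis is used with n + 1 and one
      step fewer.\<close>
    proof (rule "3.IH"(2)[of _ "Suc n"])
      have "b \<le> Suc n" using covers_range[OF "3.prems"(1) nB rn _ _ c] b by auto
      moreover have "w permutes {1..Suc n}" using "3.prems"(1) by (rule permutes_subset) auto
      ultimately show "(w \<circ> transpose (Suc r) b) permutes {1..Suc n}"
        using b "3.prems" by (intro permutes_comp_transpose) auto
    qed (use "3.prems" in auto)
    then show "(if covers w (Suc r) b then (if Suc r < b then 1 else - 1) *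
        Hop B (Suc r) 1 m schubert (w \<circ> transpose (Suc r) b) else 0) =
      (if covers w (Suc r) b then (if Suc r < b then 1 else - 1) *
        (hpoly (Suc r) m * schubert (w \<circ> transpose (Suc r) b)) else 0)" by simp
  qed
  also have "\<dots> = hpoly (Suc r) m * (var (Suc r) * schubert w)"
    unfolding Zop_mult schubert_monk[OF "3.prems"(1) rn nB] ..
  finally have Z: "Zop B 1 (Suc r) (Hop B (Suc r) 1 m schubert) w = hpoly (Suc r) m * (var (Suc r) * schubert w)" .
  have "Hop B r 1 (Suc m) schubert w = hpoly r (Suc m) * schubert w"
    using "3.prems" by (intro "3.IH"(1)) auto
  then show ?case
    unfolding Hop_row_Suc[OF rB order.refl] Z by (simp add: algebra_simps)
qed

subsection \<open>Linear independence of Schubert polynomials\<close>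

definition free_of_var :: "nat \<Rightarrow> mpoly \<Rightarrow> bool" where
  "free_of_var y p \<longleftrightarrow> (\<forall>m. Poly_Mapping.lookup p m \<noteq> 0 \<longrightarrow> Poly_Mapping.lookup m y = 0)"

lemma var_power: "var i ^ k = Poly_Mapping.single (Poly_Mapping.single i k) 1"
  by (induction k) (simp_all add: var_def mult_single flip: single_add)

lemma lookup_single_mult:
  "Poly_Mapping.lookup (Poly_Mapping.single s 1 * (p :: mpoly)) m =
    Sum_any (\<lambda>q. Poly_Mapping.lookup p q when m = s + q)"
proof -
  have "Poly_Mapping.lookup (Poly_Mapping.single s 1) l * Sum_any (\<lambda>q. Poly_Mapping.lookup p q when m = l + q) =
      (Sum_any (\<lambda>q. Poly_Mapping.lookup p q when m = l + q) when l = s)" for l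
    by (simp add: lookup_single when_def)
  then show ?thesis unfolding lookup_mult by simp
qed

lemma lookup_var_power_mult:
  assumes p: "free_of_var i p" and m: "Poly_Mapping.lookup m i = 0"
  shows "Poly_Mapping.lookup (var i ^ k * p) (m + Poly_Mapping.single i d) =
    (if k = d then Poly_Mapping.lookup p m else 0)"
proof -
  have "(Poly_Mapping.lookup p q when m + Poly_Mapping.single i d = Poly_Mapping.single i k + q) =
      ((Poly_Mapping.lookup p q when k = d) when q = m)" for q
  proof (cases "Poly_Mapping.lookup p q = 0")
    case False
    then have q: "Poly_Mapping.lookup q i = 0" using p by (simp add: free_of_var_def)
    have "m + Poly_Mapping.single i d = Poly_Mapping.single i k + q \<longleftrightarrow> k = d \<and> q = m"
    proof
      assume e: "m + Poly_Mapping.single i d = Poly_Mapping.single i k + q"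
      have l: "Poly_Mapping.lookup m y + Poly_Mapping.lookup (Poly_Mapping.single i d) y =
          Poly_Mapping.lookup (Poly_Mapping.single i k) y + Poly_Mapping.lookup q y" for y
        using arg_cong[OF e, of "\<lambda>x. Poly_Mapping.lookup x y"] by (simp add: lookup_add)
      have kd: "k = d" using l[of i] m q by simp
      moreover have "q = m" using l unfolding kd by (intro poly_mapping_eqI) simp
      ultimately show "k = d \<and> q = m" ..
    qed (simp add: add.commute)
    then show ?thesis by (auto simp: when_def)
  qed simp
  then show ?thesis unfolding var_power lookup_single_mult by (simp add: when_def)
qed

lemma free_of_var_var_mult:
  assumes "free_of_var y p" "i \<noteq> y"
  shows "free_of_var y (var i * p)"
  unfolding free_of_var_def
proof (intro allI impI)
  fix m assume "Poly_Mapping.lookup (var i * p) m \<noteq> 0"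
  then have "Sum_any (\<lambda>q. Poly_Mapping.lookup p q when m = Poly_Mapping.single i 1 + q) \<noteq> 0"
    using lookup_single_mult[of "Poly_Mapping.single i 1" p m] by (simp add: var_def)
  then obtain q where "(Poly_Mapping.lookup p q when m = Poly_Mapping.single i 1 + q) \<noteq> 0"
    by (rule Sum_any.not_neutral_obtains_not_neutral)
  then have "Poly_Mapping.lookup p q \<noteq> 0" "m = Poly_Mapping.single i 1 + q" by (auto simp: when_def split: if_splits)
  then show "Poly_Mapping.lookup m y = 0"
    using assms by (simp add: free_of_var_def lookup_add lookup_single)
qed

lemma free_of_var_add: "free_of_var y p \<Longrightarrow> free_of_var y q \<Longrightarrow> free_of_var y (p + q)"
  unfolding free_of_var_def lookup_add by (metis add.right_neutral)

lemma free_of_var_zero [simp]: "free_of_var y 0"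
  by (simp add: free_of_var_def)

lemma free_of_var_rcop:
  assumes "\<And>v. free_of_var y (g v)" "\<And>i j. (i, j) \<in> set L \<Longrightarrow> i \<noteq> y"
  shows "free_of_var y (rcop var L g w)"
  using assms(2)
proof (induction L arbitrary: w)
  case (Cons p L)
  obtain i j where p: "p = (i, j)" by fastforce
  have IH: "free_of_var y (rcop var L g v)" for v
  proof (rule Cons.IH)
    show "i \<noteq> y" if "(i, j) \<in> set L" for i j using Cons.prems[of i j] that by simp
  qed
  then have "free_of_var y (dop (i + j - 1) (rcop var L g) w)" by (simp add: dop_def)
  then show ?case using IH Cons.prems[of i j] by (simp add: p free_of_var_add free_of_var_var_mult)
qed (use assms in simp)

lemma free_of_var_id_indicator: "free_of_var y (id_indicator v)"
  by (auto simp: free_of_var_def id_indicator_def lookup_one when_def)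

lemma word_perm_append: "word_perm (ks @ ks') = word_perm ks \<circ> word_perm ks'"
proof (induction ks)
  case (Cons k ks)
  have "word_perm ((k # ks) @ ks') = simple_refl k \<circ> word_perm (ks @ ks')"
    unfolding append_Cons word_perm_Cons ..
  then show ?case unfolding Cons.IH word_perm_Cons comp_assoc .
qed simp

lemma simple_refl_le: "simple_refl k y \<le> Suc y" "simple_refl k y = Suc y \<Longrightarrow> y = k"
  by (cases "y = k"; cases "y = Suc k"; simp add: simple_refl_def transpose_def)+

text \<open>A simple reflection raises a value by at most one, and only if that value is its letter.
  The letters act from the right end of the word; reaching i + length requires each of them to act,
  which forces i, i + 1, ... in this order.\<close>

lemma word_perm_decreasing:
  assumes "sorted_wrt (>) ws" "set ws \<subseteq> {i..}"
  shows "word_perm ws i \<le> i + length ws \<and>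
    (word_perm ws i = i + length ws \<longrightarrow> ws = rev [i..<i + length ws])"
  using assms
proof (induction ws)
  case (Cons k ws)
  let ?y = "word_perm ws i"
  have IH: "?y \<le> i + length ws" "?y = i + length ws \<Longrightarrow> ws = rev [i..<i + length ws]"
    using Cons.IH Cons.prems by simp_all
  have e: "word_perm (k # ws) i = simple_refl k ?y" unfolding word_perm_Cons by simp
  note le = simple_refl_le[of k ?y]
  have "k # ws = rev [i..<i + length (k # ws)]" if "simple_refl k ?y = i + length (k # ws)"
  proof -
    have y: "?y = i + length ws" "?y = k" using that le IH(1) by auto
    then show ?thesis using IH(2) by simp
  qed
  moreover have "simple_refl k ?y \<le> i + length (k # ws)" using le(1) IH(1) by simp
  ultimately show ?case unfolding e by blast
qed simp

lemma dword_nonzero: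
  assumes "dword ks g u \<noteq> 0"
  obtains v where "g v \<noteq> 0" "u = word_perm ks \<circ> v"
proof -
  have "\<exists>v. g v \<noteq> 0 \<and> u = word_perm ks \<circ> v"
    using assms
  proof (induction ks arbitrary: u)
    case Nil
    then show ?case by auto
  next
    case (Cons k ks)
    then have "dword ks g (simple_refl k \<circ> u) \<noteq> 0" by (auto simp: dop_def split: if_splits)
    then obtain v where v: "g v \<noteq> 0" "simple_refl k \<circ> u = word_perm ks \<circ> v" using Cons.IH by blast
    have "u = simple_refl k \<circ> (simple_refl k \<circ> u)" by (simp only: simple_refl_comp_involutory)
    also have "\<dots> = word_perm (k # ks) \<circ> v" unfolding v(2) word_perm_Cons comp_assoc ..
    finally show ?case using v(1) by blast
  qed
  then show thesis using that by blast
qed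

text \<open>The value a at position i is carried down to i. At each step the next smaller value
  stands to the right of position i, because all positions before i are fixed, so the step shortens
  the permutation.\<close>

lemma dword_run:
  assumes "u permutes {1..B}" "\<forall>y<i. u y = y" "1 \<le> i" "i \<le> a" "a \<le> B" "u i = a"
  shows "dword (rev [i..<a]) g u = g (word_perm [i..<a] \<circ> u) \<and>
    (word_perm [i..<a] \<circ> u) permutes {1..B} \<and> (\<forall>y<Suc i. (word_perm [i..<a] \<circ> u) y = y)"
  using assms(4,1,2,5,6)
proof (induction a arbitrary: u rule: dec_induct)
  case base
  then show ?case by (auto simp: less_Suc_eq)
next
  case (step a)
  define v where "v = simple_refl a \<circ> u"
  have a: "1 \<le> a" "Suc a \<le> B" using step.hyps step.prems assms(3) by auto
  have v: "v permutes {1..B}" unfolding v_def by (rule simple_refl_comp_permutes[OF step.prems(1) a])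
  have fix_v: "\<forall>y<i. v y = y" using step.prems(2) step.hyps by (auto simp: v_def simple_refl_def transpose_def)
  have vi: "v i = a" using step.prems(4) by (simp add: v_def)
  have i: "inv u (Suc a) = i" using step.prems by (intro inv_eqI)
  have "\<not> inv u a < i"
  proof
    assume "inv u a < i"
    then have "u (inv u a) = inv u a" using step.prems(2) by blast
    then show False using permutes_inverses(1)[OF step.prems(1), of a] \<open>inv u a < i\<close> step.hyps by simp
  qed
  then have "inv u (Suc a) < inv u a" using i inv_neq_Suc[OF step.prems(1), of a] by simp
  then have less: "ilen v < ilen u" using ilen_simple_comp(2)[OF step.prems(1) a] by (simp only: v_def)
  have IH: "dword (rev [i..<a]) g v = g (word_perm [i..<a] \<circ> v) \<and>
    (word_perm [i..<a] \<circ> v) permutes {1..B} \<and> (\<forall>y<Suc i. (word_perm [i..<a] \<circ> v) y = y)"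
    by (rule step.IH[OF v fix_v _ vi]) (use step.prems in simp)
  have w: "word_perm [i..<Suc a] \<circ> u = word_perm [i..<a] \<circ> v"
    using step.hyps unfolding v_def by (simp add: word_perm_append comp_assoc)
  have d: "dword (rev [i..<Suc a]) g u = dword (rev [i..<a]) g v"
    using step.hyps less by (simp add: dop_def v_def)
  show ?case unfolding d w by (rule IH)
qed

text \<open>If \<open>u\<close> fixes everything below \<open>i\<close>, then \<open>x\<^sub>i\<close> has degree at least \<open>u i - i\<close> in its polynomial,
  and the coefficient of the lowest power is the polynomial of a permutation that fixes \<open>i\<close> as well.\<close>

lemma lookup_stair_lead:
  assumes u: "u permutes {1..B}" "\<forall>y<i. u y = y" and i: "1 \<le> i" "i < B"
    and a: "i \<le> a" "a \<le> u i" and m: "Poly_Mapping.lookup m i = 0"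
  shows "Poly_Mapping.lookup (rcop var (stair B i) id_indicator u) (m + Poly_Mapping.single i (a - i)) =
    (if u i = a then Poly_Mapping.lookup (rcop var (stair B (Suc i)) id_indicator (word_perm [i..<a] \<circ> u)) m else 0)"
proof -
  define G where "G = rcop var (stair B (Suc i)) id_indicator"
  let ?row = "stair_row i (B - i)"
  define ws where "ws R = map box_label (filter (\<lambda>p. p \<in> R) ?row)" for R
  have G: "free_of_var i (G v)" for v
    unfolding G_def by (intro free_of_var_rcop free_of_var_id_indicator) (auto simp: set_stair)
  have Gi: "v i = i" if "G v \<noteq> 0" for v
  proof -
    have "\<forall>y\<le>i. v y = y"
    proof (rule rcop_support[OF _ _ that[unfolded G_def]])
      show "\<forall>y\<le>i. v y = y" if "id_indicator v \<noteq> (0::mpoly)" for v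
        using that by (simp add: id_indicator_def split: if_splits)
      show "i < a + b - 1" if "(a, b) \<in> set (stair B (Suc i))" for a b
        using that by (simp add: set_stair) arith
    qed
    then show ?thesis by simp
  qed
  have dist: "distinct ?row" by (simp add: stair_row_def distinct_map inj_on_def del: upt_Suc)
  have fd: "free_of_var i (dword ks G u)" for ks u
    by (induction ks arbitrary: u) (auto simp: G dop_def)
  have uiB: "u i \<le> B" using permutes_in_image[OF u(1), of i] i by simp
  have ws: "sorted_wrt (>) (ws R)" "set (ws R) \<subseteq> {i..}" "set (ws R) = box_label ` R"
    "length (ws R) = card R" if R: "R \<subseteq> set ?row" for R
  proof -
    have "sorted_wrt (>) (map box_label ?row)"
      using i by (simp add: stair_row_def sorted_wrt_map box_label_def sorted_wrt_rev del: upt_Suc)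
        (auto intro!: sorted_wrt_mono_rel[OF _ strict_sorted_list_of_set] sorted_wrt_upt simp del: upt_Suc
          intro: sorted_wrt_mono_rel[OF _ sorted_wrt_upt])
    then show "sorted_wrt (>) (ws R)" unfolding ws_def by (simp add: sorted_wrt_map sorted_wrt_filter)
    show "set (ws R) \<subseteq> {i..}" by (auto simp: ws_def set_stair_row box_label_def)
    have fR: "set (filter (\<lambda>p. p \<in> R) ?row) = R" using R by auto
    then show "set (ws R) = box_label ` R" by (simp add: ws_def)
    show "length (ws R) = card R"
      using distinct_card[of "filter (\<lambda>p. p \<in> R) ?row"] dist fR by (simp add: ws_def)
  qed
  have inj: "inj_on box_label (set ?row)"
    by (auto simp: inj_on_def set_stair_row box_label_def)
  have prod_x: "(\<Prod>(i, j)\<in>R. var i) = var i ^ card R" if "R \<subseteq> set ?row" for R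
  proof -
    have "(\<Prod>p\<in>R. var (fst p)) = (\<Prod>p\<in>R. var i)"
      by (rule prod.cong[OF refl]) (use that in \<open>auto simp: set_stair_row\<close>)
    then show ?thesis by (simp add: split_def)
  qed
  have "rcop var (stair B i) id_indicator u = (\<Sum>R\<in>Pow (set ?row). var i ^ card R * dword (ws R) G u)"
    unfolding stair_Cons[OF i(2)] rcop_append G_def[symmetric] rcop_expand[OF dist] ws_def
    by (intro sum.cong refl) (simp add: prod_x)
  then have "Poly_Mapping.lookup (rcop var (stair B i) id_indicator u) (m + Poly_Mapping.single i (a - i)) =
      (\<Sum>R\<in>Pow (set ?row). if card R = a - i then Poly_Mapping.lookup (dword (ws R) G u) m else 0)"
    by (simp add: lookup_sum lookup_var_power_mult[OF fd m])
  also have "\<dots> = (if u i = a then Poly_Mapping.lookup (G (word_perm [i..<a] \<circ> u)) m else 0)"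
  proof -
    \<comment> \<open>A nonzero term needs u i \<le> i + card R = a. As a \<le> u i, equality holds,
      which leaves only the run a - 1, ..., i.\<close>
    have lead: "u i = a \<and> ws R = rev [i..<a]"
      if R: "R \<subseteq> set ?row" "card R = a - i" and nz: "dword (ws R) G u \<noteq> 0" for R
    proof -
      obtain v where v: "G v \<noteq> 0" "u = word_perm (ws R) \<circ> v" using dword_nonzero[OF nz] .
      have "u i = word_perm (ws R) i" using v(2) Gi[OF v(1)] by simp
      moreover have "i + length (ws R) = a" using ws(4)[OF R(1)] R(2) a by simp
      ultimately show ?thesis using word_perm_decreasing[OF ws(1,2)[OF R(1)]] a(2) by simp
    qed
    show ?thesis
    proof (cases "u i = a")
      case False
      then have "(if card R = a - i then Poly_Mapping.lookup (dword (ws R) G u) m else 0) = 0"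
        if "R \<in> Pow (set ?row)" for R
        using lead[of R] that by (cases "dword (ws R) G u = 0") auto
      then show ?thesis using False by (simp add: sum.neutral)
    next
      case True
      define R0 where "R0 = {i} \<times> {1..a - i}"
      have R0: "R0 \<subseteq> set ?row" using True uiB by (auto simp: R0_def set_stair_row)
      have bl: "box_label ` R0 = {i..<a}"
      proof
        show "{i..<a} \<subseteq> box_label ` R0"
        proof
          fix y assume "y \<in> {i..<a}"
          then have "y = box_label (i, Suc y - i)" "(i, Suc y - i) \<in> R0"
            by (auto simp: box_label_def R0_def)
          then show "y \<in> box_label ` R0" by (rule image_eqI)
        qed
      qed (use i a in \<open>auto simp: box_label_def R0_def\<close>)
      have eq: "R = R0" if "R \<subseteq> set ?row" "ws R = rev [i..<a]" for R
      proof -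
        have "box_label ` R = box_label ` R0" using ws(3)[OF that(1)] that(2) bl by simp
        then show ?thesis using inj_on_image_eq_iff[OF inj that(1) R0] by simp
      qed
      have "ws R0 = rev [i..<a]"
      proof -
        have "sorted_wrt (<) (rev (ws R0))" using ws(1)[OF R0] by (simp add: sorted_wrt_rev)
        moreover have "set (rev (ws R0)) = set [i..<a]" using ws(3)[OF R0] bl by simp
        ultimately have "rev (ws R0) = [i..<a]" by (intro strict_sorted_equal) auto
        then show ?thesis by (metis rev_rev_ident)
      qed
      moreover have "card R0 = a - i" by (simp add: R0_def card_cartesian_product)
      moreover have "(\<Sum>R\<in>Pow (set ?row). if card R = a - i then Poly_Mapping.lookup (dword (ws R) G u) m else 0) =
        (\<Sum>R\<in>Pow (set ?row). if R = R0 then Poly_Mapping.lookup (dword (ws R0) G u) m else 0)"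
      proof (rule sum.cong[OF refl])
        fix R assume R: "R \<in> Pow (set ?row)"
        show "(if card R = a - i then Poly_Mapping.lookup (dword (ws R) G u) m else 0) =
          (if R = R0 then Poly_Mapping.lookup (dword (ws R0) G u) m else 0)"
          using lead[of R] eq[of R] R \<open>card R0 = a - i\<close> by (cases "dword (ws R) G u = 0") auto
      qed
      moreover have "dword (rev [i..<a]) G u = G (word_perm [i..<a] \<circ> u)"
        using dword_run[OF u i(1) a(1), of G] uiB True by simp
      ultimately show ?thesis using R0 True by simp
    qed
  qed
  finally show ?thesis unfolding G_def .
qed

text \<open>A leading term argument, one variable at a time. Among the permutations with nonzero
  coefficient, those with minimal u i carry the lowest power of x_i. Comparing its coefficients
  gives a relation of the same kind for the rows after i, on permutations that also fix i; so the
  chosen coefficient was zero.\<close>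

lemma stair_independent:
  fixes c :: "(nat \<Rightarrow> nat) \<Rightarrow> int"
  assumes "finite F" "\<And>u. u \<in> F \<Longrightarrow> u permutes {1..B} \<and> (\<forall>y<i. u y = y)" "1 \<le> i" "i \<le> B"
    and "\<And>m. \<forall>y\<in>{1..<i}. Poly_Mapping.lookup m y = 0 \<Longrightarrow>
      (\<Sum>u\<in>F. c u * Poly_Mapping.lookup (rcop var (stair B i) id_indicator u) m) = 0"
  shows "\<forall>u\<in>F. c u = 0"
  using assms
proof (induction "B - i" arbitrary: i F c)
  case 0
  then have iB: "i = B" by simp
  have "u = id" if "u \<in> F" for u
  proof -
    have u: "u permutes {1..B}" "\<And>y. y < B \<Longrightarrow> u y = y" using "0.prems"(2)[OF that] iB by auto
    have "u permutes {B}"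
      by (rule permutes_superset[OF u(1)]) (use u(2) in auto)
    then show ?thesis by (simp add: permutes_sing)
  qed
  then have "F = {} \<or> F = {id}" by auto
  moreover have "c id = 0" if "F = {id}"
    using "0.prems"(5)[of 0] that iB by (simp add: stair_Nil id_indicator_def id_def)
  ultimately show ?case by auto
next
  case (Suc d)
  then have iB: "i < B" by simp
  define S where "S k = rcop var (stair B k) id_indicator" for k
  show ?case
  proof (rule ccontr)
    assume "\<not> (\<forall>u\<in>F. c u = 0)"
    define F0 where "F0 = {u \<in> F. c u \<noteq> 0}"
    have F0: "finite F0" "F0 \<noteq> {}" using \<open>\<not> (\<forall>u\<in>F. c u = 0)\<close> Suc.prems(1) by (auto simp: F0_def)
    define a where "a = Min ((\<lambda>u. u i) ` F0)"
    have a_le: "a \<le> u i" if "u \<in> F0" for u unfolding a_def using F0 that by simp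
    have "a \<in> (\<lambda>u. u i) ` F0" unfolding a_def using F0 by (intro Min_in) auto
    then obtain u0 where u0: "u0 \<in> F0" "u0 i = a" by auto
    have perm: "u permutes {1..B}" "\<forall>y<i. u y = y" if "u \<in> F0" for u
      using Suc.prems(2) that by (auto simp: F0_def)
    have ia: "i \<le> a"
    proof (rule ccontr)
      assume "\<not> i \<le> a"
      then have "u0 a = u0 i" using perm(2)[OF u0(1)] u0(2) by simp
      then show False using permutes_inj[OF perm(1)[OF u0(1)]] \<open>\<not> i \<le> a\<close> by (auto dest: injD)
    qed
    have aB: "a \<le> B" using permutes_in_image[OF perm(1)[OF u0(1)], of i] u0 iB Suc.prems(3) by auto
    define \<phi> where "\<phi> u = word_perm [i..<a] \<circ> u" for u :: "nat \<Rightarrow> nat"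
    define F1 where "F1 = {u \<in> F0. u i = a}"
    have run: "\<phi> u permutes {1..B}" "\<forall>y<Suc i. \<phi> u y = y" if "u \<in> F1" for u
      using dword_run[of u B i a "\<lambda>_. 0 :: int"] perm[of u] that Suc.prems(3) ia aB
      by (auto simp: \<phi>_def F1_def)
    have wp: "word_perm [i..<a] permutes {1..B}"
      using aB Suc.prems(3) by (intro word_perm_permutes) auto
    have inj: "inj_on \<phi> F1"
    proof (rule inj_onI)
      fix u v assume e: "\<phi> u = \<phi> v"
      show "u = v"
      proof
        fix x
        have "word_perm [i..<a] (u x) = word_perm [i..<a] (v x)"
          using fun_cong[OF e, of x] by (simp add: \<phi>_def)
        then show "u x = v x" using permutes_inj[OF wp] by (auto dest: injD)
      qed
    qed
    have fin: "finite F1" using F0 by (simp add: F1_def)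
    have "\<forall>v\<in>\<phi> ` F1. (c \<circ> inv_into F1 \<phi>) v = 0"
    proof (rule Suc.hyps(1)[of "Suc i" "\<phi> ` F1" "c \<circ> inv_into F1 \<phi>"])
      show "d = B - Suc i" using Suc.hyps(2) by simp
      show "finite (\<phi> ` F1)" using fin by simp
      show "v permutes {1..B} \<and> (\<forall>y<Suc i. v y = y)" if "v \<in> \<phi> ` F1" for v using that run by blast
      fix m :: "nat \<Rightarrow>\<^sub>0 nat" assume m: "\<forall>y\<in>{1..<Suc i}. Poly_Mapping.lookup m y = 0"
      have mi: "Poly_Mapping.lookup m i = 0" using m Suc.prems(3) by simp
      let ?m = "m + Poly_Mapping.single i (a - i)"
      have lead: "Poly_Mapping.lookup (S i u) ?m =
          (if u i = a then Poly_Mapping.lookup (S (Suc i) (\<phi> u)) m else 0)" if "u \<in> F0" for u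
        unfolding S_def \<phi>_def
        by (rule lookup_stair_lead[OF perm(1)[OF that] perm(2)[OF that] Suc.prems(3) iB ia a_le[OF that] mi])
      have "(\<Sum>v\<in>\<phi> ` F1. (c \<circ> inv_into F1 \<phi>) v * Poly_Mapping.lookup (S (Suc i) v) m) =
          (\<Sum>u\<in>F1. c u * Poly_Mapping.lookup (S (Suc i) (\<phi> u)) m)"
        by (subst sum.reindex[OF inj]) (simp add: inv_into_f_f[OF inj])
      also have "\<dots> = (\<Sum>u\<in>F0. c u * Poly_Mapping.lookup (S i u) ?m)"
      proof (rule sum.mono_neutral_cong_left)
        show "\<forall>u\<in>F0 - F1. c u * Poly_Mapping.lookup (S i u) ?m = 0"
          using lead by (auto simp: F1_def)
        show "c u * Poly_Mapping.lookup (S (Suc i) (\<phi> u)) m = c u * Poly_Mapping.lookup (S i u) ?m"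
          if "u \<in> F1" for u
          using lead[of u] that by (simp add: F1_def)
      qed (use F0 in \<open>auto simp: F1_def\<close>)
      also have "\<dots> = (\<Sum>u\<in>F. c u * Poly_Mapping.lookup (S i u) ?m)"
        by (rule sum.mono_neutral_left) (use Suc.prems(1) in \<open>auto simp: F0_def\<close>)
      also have "\<dots> = 0" unfolding S_def
        using m by (intro Suc.prems(5)) (simp add: lookup_add lookup_single)
      finally show "(\<Sum>v\<in>\<phi> ` F1. (c \<circ> inv_into F1 \<phi>) v *
        Poly_Mapping.lookup (rcop var (stair B (Suc i)) id_indicator v) m) = 0"
        unfolding S_def .
    qed (use iB in auto)
    moreover have "u0 \<in> F1" using u0 by (simp add: F1_def)
    ultimately have "c u0 = 0" using inv_into_f_f[OF inj] by auto
    then show False using u0 by (simp add: F0_def)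
  qed
qed

lemma lookup_of_int_mult: "Poly_Mapping.lookup (of_int c * (p :: mpoly)) m = c * Poly_Mapping.lookup p m"
proof (induction c rule: int_induct[of _ 0])
  case (step1 i)
  then show ?case by (simp add: algebra_simps lookup_add)
next
  case (step2 i)
  then show ?case by (simp add: algebra_simps lookup_minus)
qed simp

lemma schubert_independent:
  assumes "finite F" "F \<subseteq> S_inf" "(\<Sum>u\<in>F. of_int (c u) * schubert u) = 0"
  shows "\<forall>u\<in>F. c u = 0"
proof -
  have "\<exists>n. u permutes {1..n}" if "u \<in> F" for u
    using assms(2) S_inf_permutes[of u] that by blast
  then obtain n where n: "\<And>u. u \<in> F \<Longrightarrow> u permutes {1..n u}" by metis
  define B where "B = Suc (\<Sum>u\<in>F. n u)"
  have B: "u permutes {1..B}" if "u \<in> F" for u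
  proof (rule permutes_subset[OF n[OF that]])
    have "n u \<le> (\<Sum>u\<in>F. n u)" using assms(1) that by (intro member_le_sum) auto
    then show "{1..n u} \<subseteq> {1..B}" by (auto simp: B_def)
  qed
  show ?thesis
  proof (rule stair_independent[of F B 1])
    show "u permutes {1..B} \<and> (\<forall>y<1. u y = y)" if "u \<in> F" for u
      using B[OF that] permutes_not_in[OF B[OF that], of 0] by simp
    fix m :: "nat \<Rightarrow>\<^sub>0 nat"
    have "(\<Sum>u\<in>F. c u * Poly_Mapping.lookup (rcop var (stair B 1) id_indicator u) m) =
        Poly_Mapping.lookup (\<Sum>u\<in>F. of_int (c u) * schubert u) m"
      unfolding lookup_sum lookup_of_int_mult
      by (intro sum.cong refl) (simp only: schubert_eq_rcop[OF B])
    then show "(\<Sum>u\<in>F. c u * Poly_Mapping.lookup (rcop var (stair B 1) id_indicator u) m) = 0"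
      by (simp only: assms(3)) simp
  qed (use assms(1) in \<open>auto simp: B_def\<close>)
qed

subsection \<open>Chains as label words\<close>

definition pairs_perm :: "(nat \<times> nat) list \<Rightarrow> nat \<Rightarrow> nat" where
  "pairs_perm ps = foldr (\<circ>) (map (\<lambda>p. transpose (fst p) (snd p)) ps) id"

fun cover_chain :: "(nat \<Rightarrow> nat) \<Rightarrow> (nat \<times> nat) list \<Rightarrow> bool" where
  "cover_chain w [] = True"
| "cover_chain w (p # ps) = (covers w (fst p) (snd p) \<and> cover_chain (w \<circ> transpose (fst p) (snd p)) ps)"

text \<open>The value at the first position before a step is the value at the second position after
  it, which is what \<open>label_tableau\<close> reads.\<close>

fun chain_labels :: "(nat \<Rightarrow> nat) \<Rightarrow> (nat \<times> nat) list \<Rightarrow> nat list" where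
  "chain_labels w [] = []"
| "chain_labels w (p # ps) = w (fst p) # chain_labels (w \<circ> transpose (fst p) (snd p)) ps"

definition label_chains :: "nat \<Rightarrow> nat \<Rightarrow> (nat \<Rightarrow> nat) \<Rightarrow> nat list \<Rightarrow> (nat \<times> nat) list set" where
  "label_chains B r w ks =
    {ps. set ps \<subseteq> {1..r} \<times> {r<..B} \<and> cover_chain w ps \<and> chain_labels w ps = ks}"

lemma pairs_perm_Nil [simp]: "pairs_perm [] = id"
  by (simp add: pairs_perm_def)

lemma pairs_perm_Cons: "pairs_perm (p # ps) = transpose (fst p) (snd p) \<circ> pairs_perm ps"
  by (simp add: pairs_perm_def)

lemma length_chain_labels [simp]: "length (chain_labels w ps) = length ps"
  by (induction ps arbitrary: w) auto

lemma finite_label_chains: "finite (label_chains B r w ks)"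
proof -
  have "label_chains B r w ks \<subseteq> {ps. set ps \<subseteq> {1..r} \<times> {r<..B} \<and> length ps = length ks}"
    by (auto simp: label_chains_def)
  then show ?thesis by (rule finite_subset) (intro finite_lists_length_eq finite_cartesian_product; simp)
qed

lemma label_chains_Nil: "label_chains B r w [] = {[]}"
proof (rule set_eqI)
  show "ps \<in> label_chains B r w [] \<longleftrightarrow> ps \<in> {[]}" for ps
    by (cases ps) (simp_all add: label_chains_def)
qed

text \<open>The label determines the first position of a step, so only the second one is free, as in
  \<open>Uop\<close>.\<close>

lemma label_chains_Cons:
  assumes w: "w permutes {1..B}" and r: "r \<le> B" and k: "k \<in> {1..B}"
  shows "label_chains B r w (k # ks) = (if inv w k \<le> r then
    (\<Union>b\<in>{b \<in> {r<..B}. covers w (inv w k) b}.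
      (#) (inv w k, b) ` label_chains B r (w \<circ> transpose (inv w k) b) ks) else {})"
    (is "?L = ?R")
proof (intro equalityI subsetI)
  fix ps assume "ps \<in> ?L"
  then have a: "set ps \<subseteq> {1..r} \<times> {r<..B}" "cover_chain w ps" "chain_labels w ps = k # ks"
    by (auto simp: label_chains_def)
  then obtain a b qs where ps: "ps = (a, b) # qs" by (cases ps) auto
  have "inv w k = a" using a(3) ps by (intro inv_eqI[OF w]) simp
  then show "ps \<in> ?R" using a ps by (auto simp: label_chains_def)
next
  fix ps assume "ps \<in> ?R"
  then obtain b qs where b: "inv w k \<le> r" "b \<in> {r<..B}" "covers w (inv w k) b"
    "qs \<in> label_chains B r (w \<circ> transpose (inv w k) b) ks" "ps = (inv w k, b) # qs"
    by (auto split: if_splits)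
  moreover have "1 \<le> inv w k" using inv_in_range[OF w k] by simp
  ultimately show "ps \<in> ?L" using permutes_inverses(1)[OF w, of k] by (auto simp: label_chains_def)
qed

lemma Uword_eq_sum:
  fixes g :: "(nat \<Rightarrow> nat) \<Rightarrow> 'a::comm_ring_1"
  assumes "w permutes {1..B}" "r \<le> B" "set ks \<subseteq> {1..B}"
  shows "Uword B r ks g w = (\<Sum>ps\<in>label_chains B r w ks. g (w \<circ> pairs_perm ps))"
  using assms
proof (induction ks arbitrary: w)
  case Nil
  then show ?case by (simp add: label_chains_Nil)
next
  case (Cons k ks)
  have k: "k \<in> {1..B}" and ks: "set ks \<subseteq> {1..B}" using Cons.prems by auto
  define a where "a = inv w k"
  have aB: "a \<in> {1..B}" unfolding a_def by (rule inv_in_range[OF Cons.prems(1) k])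
  show ?case
  proof (cases "a \<le> r")
    case False
    then show ?thesis
      unfolding label_chains_Cons[OF Cons.prems(1,2) k] by (simp add: Uop_def a_def)
  next
    case True
    let ?b = "{b \<in> {r<..B}. covers w a b}"
    have wt: "(w \<circ> transpose a b) permutes {1..B}" if "b \<in> ?b" for b
      using Cons.prems(1) aB that by (intro permutes_comp_transpose) auto
    have "Uword B r (k # ks) g w = (\<Sum>b\<in>{r<..B}. if covers w a b then Uword B r ks g (w \<circ> transpose a b) else 0)"
      unfolding Uword.simps Uop_def a_def[symmetric] using Cons.prems(1) True by simp
    also have "\<dots> = (\<Sum>b\<in>?b. Uword B r ks g (w \<circ> transpose a b))"
      by (subst sum.inter_filter) simp_all
    also have "\<dots> = (\<Sum>b\<in>?b. \<Sum>ps\<in>label_chains B r (w \<circ> transpose a b) ks.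
        g (w \<circ> transpose a b \<circ> pairs_perm ps))"
    proof (rule sum.cong[OF refl])
      fix b assume "b \<in> ?b"
      show "Uword B r ks g (w \<circ> transpose a b) =
        (\<Sum>ps\<in>label_chains B r (w \<circ> transpose a b) ks. g (w \<circ> transpose a b \<circ> pairs_perm ps))"
        by (rule Cons.IH[OF wt[OF \<open>b \<in> ?b\<close>] Cons.prems(2) ks])
    qed
    also have "\<dots> = (\<Sum>b\<in>?b. \<Sum>ps\<in>(#) (a, b) ` label_chains B r (w \<circ> transpose a b) ks.
        g (w \<circ> pairs_perm ps))"
    proof (rule sum.cong[OF refl])
      fix b :: nat
      have "inj_on ((#) (a, b)) X" for X by (simp add: inj_on_def)
      then show "(\<Sum>ps\<in>label_chains B r (w \<circ> transpose a b) ks. g (w \<circ> transpose a b \<circ> pairs_perm ps)) =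
        (\<Sum>ps\<in>(#) (a, b) ` label_chains B r (w \<circ> transpose a b) ks. g (w \<circ> pairs_perm ps))"
        by (simp add: sum.reindex pairs_perm_Cons comp_assoc)
    qed
    also have "\<dots> = (\<Sum>ps\<in>label_chains B r w (k # ks). g (w \<circ> pairs_perm ps))"
      unfolding label_chains_Cons[OF Cons.prems(1,2) k] a_def[symmetric] if_P[OF True]
      by (subst sum.UNION_disjoint) (auto simp: finite_label_chains)
    finally show ?thesis .
  qed
qed

lemma S_inf_comp_transpose:
  assumes "w \<in> S_inf" "1 \<le> a" "1 \<le> b"
  shows "w \<circ> transpose a b \<in> S_inf"
proof -
  obtain n where n: "w permutes {1..n}" using S_inf_permutes[OF assms(1)] .
  have "w permutes {1..max n (max a b)}" by (rule permutes_subset[OF n]) auto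
  then have "(w \<circ> transpose a b) permutes {1..max n (max a b)}"
    using assms by (intro permutes_comp_transpose) auto
  then show ?thesis by (rule permutes_S_inf)
qed

lemma coxeter_length_S_inf: "w \<in> S_inf \<Longrightarrow> coxeter_length w = ilen w"
  by (elim S_inf_permutes) (rule coxeter_length_eq_ilen)

lemma S_inf_comp_pairs_perm:
  assumes "w \<in> S_inf" "set ps \<subseteq> {1..} \<times> {1..}"
  shows "w \<circ> pairs_perm ps \<in> S_inf"
  using assms
proof (induction ps arbitrary: w)
  case (Cons p ps)
  have "w \<circ> transpose (fst p) (snd p) \<in> S_inf"
    using Cons.prems by (intro S_inf_comp_transpose) auto
  then have "(w \<circ> transpose (fst p) (snd p)) \<circ> pairs_perm ps \<in> S_inf"
    by (rule Cons.IH) (use Cons.prems in auto)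
  then show ?case by (simp only: pairs_perm_Cons comp_assoc)
qed simp

lemma cover_chain_iff:
  "cover_chain w ps \<longleftrightarrow> (\<forall>i\<in>{1..length ps}. ilen (w \<circ> pairs_perm (take i ps)) = ilen w + i)"
proof (induction ps arbitrary: w)
  case (Cons p ps)
  let ?v = "w \<circ> transpose (fst p) (snd p)"
  have e: "w \<circ> pairs_perm (take (Suc i) (p # ps)) = ?v \<circ> pairs_perm (take i ps)" for i
    by (simp only: take_Suc_Cons pairs_perm_Cons comp_assoc)
  have "(\<forall>i\<in>{1..length (p # ps)}. ilen (w \<circ> pairs_perm (take i (p # ps))) = ilen w + i) \<longleftrightarrow>
      (\<forall>i\<in>{0..length ps}. ilen (w \<circ> pairs_perm (take (Suc i) (p # ps))) = ilen w + Suc i)"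
  proof -
    have "{1..length (p # ps)} = Suc ` {0..length ps}" by (simp add: image_Suc_atLeastAtMost)
    then show ?thesis by (simp only: ball_simps)
  qed
  also have "\<dots> \<longleftrightarrow> ilen ?v = Suc (ilen w) \<and>
      (\<forall>i\<in>{1..length ps}. ilen (?v \<circ> pairs_perm (take i ps)) = ilen w + Suc i)"
    unfolding e by (subst atLeastAtMost_insertL[of 0, symmetric]) auto
  also have "\<dots> \<longleftrightarrow> cover_chain w (p # ps)"
    unfolding cover_chain.simps Cons.IH covers_def by auto
  finally show ?case ..
qed simp

lemma chain_labels_nth:
  assumes "q < length ps"
  shows "chain_labels w ps ! q = w (pairs_perm (take (Suc q) ps) (snd (ps ! q)))"
  using assms
proof (induction ps arbitrary: w q)
  case (Cons p ps)
  show ?case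
  proof (cases q)
    case 0
    then show ?thesis by (simp add: pairs_perm_Cons)
  next
    case (Suc q')
    then show ?thesis using Cons by (simp add: pairs_perm_Cons)
  qed
qed simp

lemma cover_chain_range:
  assumes "w permutes {1..n}" "r \<le> n" "set ps \<subseteq> {1..r} \<times> {r<..}" "cover_chain w ps"
  shows "set ps \<subseteq> {1..r} \<times> {r<..n + length ps} \<and> (w \<circ> pairs_perm ps) permutes {1..n + length ps}"
  using assms
proof (induction ps arbitrary: w n)
  case (Cons p ps)
  obtain a b where p: "p = (a, b)" by fastforce
  have ab: "1 \<le> a" "a \<le> r" "r < b" "covers w a b" using Cons.prems p by auto
  have b: "b \<le> Suc n"
    by (rule covers_range[OF Cons.prems(1), of "max b (Suc n)" a]) (use ab Cons.prems in auto)
  define v where "v = w \<circ> transpose a b"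
  have "w permutes {1..Suc n}" using Cons.prems(1) by (rule permutes_subset) auto
  then have v: "v permutes {1..Suc n}"
    unfolding v_def using ab b Cons.prems by (intro permutes_comp_transpose) auto
  have ch: "cover_chain v ps" using Cons.prems(4) by (simp add: p v_def)
  have IH: "set ps \<subseteq> {1..r} \<times> {r<..Suc n + length ps} \<and> (v \<circ> pairs_perm ps) permutes {1..Suc n + length ps}"
    by (rule Cons.IH[OF v _ _ ch]) (use Cons.prems in auto)
  have e: "w \<circ> pairs_perm (p # ps) = v \<circ> pairs_perm ps"
    by (simp only: pairs_perm_Cons p v_def fst_conv snd_conv comp_assoc)
  have len: "n + length (p # ps) = Suc n + length ps" by simp
  have "set (p # ps) \<subseteq> {1..r} \<times> {r<..n + length (p # ps)}"
    using conjunct1[OF IH] ab b unfolding len by (auto simp: p)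
  then show ?case unfolding e len using conjunct2[OF IH] by (rule conjI)
qed simp

lemma chain_labels_range:
  assumes "w permutes {1..B}" "set ps \<subseteq> {1..B} \<times> {1..B}"
  shows "set (chain_labels w ps) \<subseteq> {1..B}"
  using assms
proof (induction ps arbitrary: w)
  case (Cons p ps)
  have p: "fst p \<in> {1..B}" "snd p \<in> {1..B}" using Cons.prems(2) by auto
  have wt: "(w \<circ> transpose (fst p) (snd p)) permutes {1..B}"
    using Cons.prems(1) p by (rule permutes_comp_transpose)
  have "set (chain_labels (w \<circ> transpose (fst p) (snd p)) ps) \<subseteq> {1..B}"
    by (rule Cons.IH[OF wt]) (use Cons.prems in auto)
  moreover have "w (fst p) \<in> {1..B}" using permutes_in_image[OF Cons.prems(1)] p by blast
  ultimately show ?case by simp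
qed simp

section \<open>Partitions, reading order of boxes, and tableaux as lists\<close>

lemma partition_support:
  assumes "is_partition lam"
  shows "{i. 1 \<le> i \<and> lam i \<noteq> 0} = {1..num_parts lam}"
proof -
  let ?S = "{i. 1 \<le> i \<and> lam i \<noteq> 0}"
  have fin: "finite ?S" by (rule finite_subset[of _ "{i. lam i \<noteq> 0}"]) (use assms in \<open>auto simp: is_partition_def\<close>)
  have anti: "lam j \<le> lam i" if "1 \<le> i" "i \<le> j" for i j
    using that(2,1)
  proof (induction j rule: dec_induct)
    case (step j)
    then have "lam (Suc j) \<le> lam j" using assms by (simp add: is_partition_def)
    then show ?case using step by simp
  qed simp
  have "?S = {1..Max (insert 0 ?S)}"
  proof (intro equalityI subsetI)
    fix i assume "i \<in> ?S"
    then show "i \<in> {1..Max (insert 0 ?S)}" using fin by (auto intro: Max_ge)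
  next
    fix i assume i: "i \<in> {1..Max (insert 0 ?S)}"
    have "Max (insert 0 ?S) \<in> insert 0 ?S" using fin by (intro Max_in) auto
    then have "lam (Max (insert 0 ?S)) \<noteq> 0" using i by auto
    moreover have "lam (Max (insert 0 ?S)) \<le> lam i" using i by (intro anti) auto
    ultimately show "i \<in> ?S" using i by auto
  qed
  moreover from this have "num_parts lam = Max (insert 0 ?S)"
    unfolding num_parts_def by (metis card_atLeastAtMost diff_Suc_1)
  ultimately show ?thesis by simp
qed

lemma partition_antimono:
  assumes "is_partition lam" "1 \<le> i" "i \<le> j"
  shows "lam j \<le> lam i"
  using assms(3,2)
proof (induction j rule: dec_induct)
  case (step j)
  then have "lam (Suc j) \<le> lam j" using assms(1) by (simp add: is_partition_def)
  then show ?case using step by simp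
qed simp

lemma set_boxes:
  assumes "is_partition lam"
  shows "set (boxes lam) = diagram lam"
proof -
  have "i \<in> {1..num_parts lam} \<longleftrightarrow> 1 \<le> i \<and> lam i \<noteq> 0" for i
    using partition_support[OF assms] by blast
  moreover have "(i, j) \<in> set (boxes lam) \<longleftrightarrow> i \<in> {1..num_parts lam} \<and> 1 \<le> j \<and> j \<le> lam i" for i j
  proof -
    have "(i, j) \<in> set (boxes lam) \<longleftrightarrow>
        (\<exists>x\<in>{1..<Suc (num_parts lam)}. (i, j) \<in> Pair x ` {1..<Suc (lam x)})"
      by (simp add: boxes_def del: upt_Suc)
    also have "\<dots> \<longleftrightarrow> i \<in> {1..num_parts lam} \<and> 1 \<le> j \<and> j \<le> lam i"
      by (auto simp: image_iff)
    finally show ?thesis .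
  qed
  ultimately show ?thesis by (auto simp: diagram_def)
qed

lemma distinct_boxes: "distinct (boxes lam)"
proof -
  have "distinct (concat (map (\<lambda>i. map (Pair i) [1..<Suc (lam i)]) xs))" if "distinct xs" for xs
    using that by (induction xs) (auto simp: distinct_map inj_on_def simp del: upt_Suc)
  then show ?thesis by (simp add: boxes_def del: upt_Suc)
qed

lemma box_number_nth:
  assumes "q < length (boxes lam)"
  shows "box_number lam (boxes lam ! q) = Suc q"
  unfolding box_number_def
proof (rule the_equality)
  fix k assume k: "1 \<le> k \<and> k \<le> length (boxes lam) \<and> boxes lam ! (k - 1) = boxes lam ! q"
  then have "k - 1 = q" using assms distinct_boxes[of lam] by (auto simp: nth_eq_iff_index_eq)
  then show "k = Suc q" using k by arith
qed (use assms in auto)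

lemma bij_betw_map_PiE:
  assumes "distinct xs"
  shows "bij_betw (\<lambda>T. map T xs) (set xs \<rightarrow>\<^sub>E D) {ps. length ps = length xs \<and> set ps \<subseteq> D}"
proof (rule bij_betwI')
  fix T T' assume T: "T \<in> set xs \<rightarrow>\<^sub>E D" "T' \<in> set xs \<rightarrow>\<^sub>E D"
  show "map T xs = map T' xs \<longleftrightarrow> T = T'"
    using PiE_ext[OF T] by auto
next
  fix T assume "T \<in> set xs \<rightarrow>\<^sub>E D"
  then show "map T xs \<in> {ps. length ps = length xs \<and> set ps \<subseteq> D}" by auto
next
  fix ps assume ps: "ps \<in> {ps. length ps = length xs \<and> set ps \<subseteq> D}"
  define T where "T = restrict (\<lambda>x. the (map_of (zip xs ps) x)) (set xs)"
  have nth: "T (xs ! q) = ps ! q" if "q < length xs" for q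
    using that ps assms by (simp add: T_def map_of_zip_nth)
  have "map T xs = ps" using ps nth by (intro nth_equalityI) auto
  moreover have "T \<in> set xs \<rightarrow>\<^sub>E D"
  proof (rule PiE_I)
    fix x assume "x \<in> set xs"
    then obtain q where "q < length xs" "x = xs ! q" by (auto simp: in_set_conv_nth)
    then show "T x \<in> D" using nth ps nth_mem[of q ps] by auto
  qed (simp add: T_def)
  ultimately show "\<exists>T\<in>set xs \<rightarrow>\<^sub>E D. ps = map T xs" by blast
qed

definition strict_fillings :: "nat \<Rightarrow> (nat \<Rightarrow> nat) \<Rightarrow> (nat \<times> nat \<Rightarrow> nat) set" where
  "strict_fillings B lam = {F \<in> diagram lam \<rightarrow>\<^sub>E {1..B}. row_strict lam F \<and> column_strict lam F}"

text \<open>The tableaux for all end points together; sorting them by w w(T) will give the expansion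
  of the product.\<close>

definition strict_chains :: "(nat \<Rightarrow> nat) \<Rightarrow> (nat \<Rightarrow> nat) \<Rightarrow> nat \<Rightarrow> (nat \<times> nat \<Rightarrow> nat \<times> nat) set" where
  "strict_chains w lam r = {T \<in> transposition_tableaux lam r. bruhat_chain w lam T \<and>
     row_strict lam (label_tableau w lam T) \<and> column_strict lam (label_tableau w lam T)}"

lemma partial_perm_eq: "partial_perm lam T i = pairs_perm (take i (map T (boxes lam)))"
  by (simp add: partial_perm_def pairs_perm_def take_map o_def)

lemma tableau_perm_eq: "tableau_perm lam T = pairs_perm (map T (boxes lam))"
  by (simp add: tableau_perm_def partial_perm_eq)

lemma strict_cong:
  assumes "\<And>x. x \<in> diagram lam \<Longrightarrow> E x = F x"
  shows "row_strict lam E \<longleftrightarrow> row_strict lam F" "column_strict lam E \<longleftrightarrow> column_strict lam F"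
  by (simp_all add: row_strict_def column_strict_def assms cong: conj_cong imp_cong)

lemma finite_diagram: "is_partition lam \<Longrightarrow> finite (diagram lam)"
  using set_boxes[of lam] by (metis List.finite_set)

text \<open>Positions in a tableau are unbounded, but a chain with one step per box that starts in
  {1..n} stays inside {1..B}. The filling F is the label tableau of T, so the union sorts the chains
  by their labels.\<close>

lemma strict_chains_bij:
  assumes lam: "is_partition lam" and w: "w permutes {1..n}" and r: "r \<le> n"
    and B: "n + length (boxes lam) \<le> B"
  shows "bij_betw (\<lambda>T. map T (boxes lam)) (strict_chains w lam r)
    (\<Union>F\<in>strict_fillings B lam. label_chains B r w (map F (boxes lam)))"
proof -
  let ?bs = "boxes lam"
  let ?D = "{1..r} \<times> {r<..}"
  have setb: "set ?bs = diagram lam" by (rule set_boxes[OF lam])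
  have wS: "w \<in> S_inf" using w by (rule permutes_S_inf)
  have wB: "w permutes {1..B}" using w by (rule permutes_subset) (use B in auto)
  have bij: "bij_betw (\<lambda>T. map T ?bs) (transposition_tableaux lam r) {ps. length ps = length ?bs \<and> set ps \<subseteq> ?D}"
    using bij_betw_map_PiE[OF distinct_boxes[of lam], of ?D] by (simp add: transposition_tableaux_def setb)
  have tsub: "set (map T ?bs) \<subseteq> ?D" if "T \<in> transposition_tableaux lam r" for T
    using that unfolding transposition_tableaux_def set_map setb
    by (intro image_subsetI) (erule PiE_mem)
  have chain: "bruhat_chain w lam T \<longleftrightarrow> cover_chain w (map T ?bs)" if T: "T \<in> transposition_tableaux lam r" for T
  proof -
    have "set (take i (map T ?bs)) \<subseteq> {1..} \<times> {1..}" for i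
    proof -
      have "set (take i (map T ?bs)) \<subseteq> set (map T ?bs)" by (rule set_take_subset)
      also have "\<dots> \<subseteq> ?D" by (rule tsub[OF T])
      also have "\<dots> \<subseteq> {1..} \<times> {1..}" by auto
      finally show ?thesis .
    qed
    then have "coxeter_length (w \<circ> pairs_perm (take i (map T ?bs))) = ilen (w \<circ> pairs_perm (take i (map T ?bs)))" for i
      by (intro coxeter_length_S_inf S_inf_comp_pairs_perm wS)
    then show ?thesis
      by (simp add: bruhat_chain_def partial_perm_eq cover_chain_iff coxeter_length_S_inf[OF wS])
  qed
  have label: "map (label_tableau w lam T) ?bs = chain_labels w (map T ?bs)" for T
    by (rule nth_equalityI)
      (simp_all add: label_tableau_def box_number_nth partial_perm_eq chain_labels_nth)
  have image: "(\<lambda>T. map T ?bs) ` strict_chains w lam r =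
    (\<Union>F\<in>strict_fillings B lam. label_chains B r w (map F ?bs))"
  proof (intro equalityI subsetI)
    fix ps assume "ps \<in> (\<lambda>T. map T ?bs) ` strict_chains w lam r"
    then obtain T where T: "T \<in> strict_chains w lam r" "ps = map T ?bs" by blast
    have Tt: "T \<in> transposition_tableaux lam r" using T by (simp add: strict_chains_def)
    have ch: "cover_chain w ps" using chain[OF Tt] T by (simp add: strict_chains_def)
    have "set ps \<subseteq> ?D" using tsub[OF Tt] T(2) by simp
    then have rng: "set ps \<subseteq> {1..r} \<times> {r<..B}"
      using cover_chain_range[OF w r _ ch] B T(2) by fastforce
    define F where "F = restrict (label_tableau w lam T) (diagram lam)"
    have F: "map F ?bs = chain_labels w ps"
      unfolding T(2) label[symmetric] by (simp add: F_def setb[symmetric])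
    have "set (chain_labels w ps) \<subseteq> {1..B}"
      using rng r B by (intro chain_labels_range[OF wB]) fastforce
    then have "F \<in> diagram lam \<rightarrow>\<^sub>E {1..B}"
      unfolding F[symmetric] setb[symmetric] by (auto simp: F_def setb)
    moreover have "row_strict lam F \<and> column_strict lam F"
      using T(1) strict_cong[of lam F "label_tableau w lam T"] by (simp add: strict_chains_def F_def)
    ultimately have "F \<in> strict_fillings B lam" by (simp add: strict_fillings_def)
    moreover have "ps \<in> label_chains B r w (map F ?bs)" using rng ch F by (simp add: label_chains_def)
    ultimately show "ps \<in> (\<Union>F\<in>strict_fillings B lam. label_chains B r w (map F ?bs))" by blast
  next
    fix ps assume "ps \<in> (\<Union>F\<in>strict_fillings B lam. label_chains B r w (map F ?bs))"
    then obtain F where F: "F \<in> strict_fillings B lam" and ps: "set ps \<subseteq> {1..r} \<times> {r<..B}"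
      "cover_chain w ps" "chain_labels w ps = map F ?bs" by (auto simp: label_chains_def)
    have "length ps = length ?bs" using arg_cong[OF ps(3), of length] by simp
    moreover have "set ps \<subseteq> ?D" using ps(1) by fastforce
    ultimately have "ps \<in> (\<lambda>T. map T ?bs) ` transposition_tableaux lam r"
      using bij by (auto simp: bij_betw_def)
    then obtain T where T: "T \<in> transposition_tableaux lam r" "ps = map T ?bs" by blast
    have "label_tableau w lam T x = F x" if "x \<in> diagram lam" for x
      using ps(3) that unfolding T(2) label[symmetric] setb[symmetric] by (simp add: map_eq_conv)
    then have "row_strict lam (label_tableau w lam T)" "column_strict lam (label_tableau w lam T)"
      using strict_cong[of lam "label_tableau w lam T" F] F by (simp_all add: strict_fillings_def)
    then have "T \<in> strict_chains w lam r" using T chain[OF T(1)] ps(2) by (simp add: strict_chains_def)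
    then show "ps \<in> (\<lambda>T. map T ?bs) ` strict_chains w lam r" using T(2) by blast
  qed
  have "inj_on (\<lambda>T. map T ?bs) (strict_chains w lam r)"
    using bij by (auto simp: bij_betw_def strict_chains_def intro: inj_on_subset)
  then show ?thesis using image by (simp add: bij_betw_def)
qed

lemma finite_strict_fillings: "is_partition lam \<Longrightarrow> finite (strict_fillings B lam)"
  by (rule finite_subset[of _ "diagram lam \<rightarrow>\<^sub>E {1..B}"])
    (auto simp: strict_fillings_def intro!: finite_PiE finite_diagram)

lemma finite_strict_chains:
  assumes "is_partition lam" "w permutes {1..n}" "r \<le> n"
  shows "finite (strict_chains w lam r)"
  using bij_betw_finite[OF strict_chains_bij[OF assms order.refl]]
  by (simp add: finite_strict_fillings[OF assms(1)] finite_label_chains)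

lemma sum_strict_chains:
  fixes g :: "(nat \<Rightarrow> nat) \<Rightarrow> 'a::comm_ring_1"
  assumes lam: "is_partition lam" and w: "w permutes {1..n}" and r: "r \<le> n"
    and B: "n + length (boxes lam) \<le> B"
  shows "(\<Sum>T\<in>strict_chains w lam r. g (w \<circ> tableau_perm lam T)) =
    (\<Sum>F\<in>strict_fillings B lam. Uword B r (map F (boxes lam)) g w)"
proof -
  have wB: "w permutes {1..B}" using w by (rule permutes_subset) (use B in auto)
  have inj: "F = F'" if "F \<in> strict_fillings B lam" "F' \<in> strict_fillings B lam"
    "map F (boxes lam) = map F' (boxes lam)" for F F'
  proof (rule PiE_ext)
    show "F \<in> diagram lam \<rightarrow>\<^sub>E {1..B}" "F' \<in> diagram lam \<rightarrow>\<^sub>E {1..B}"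
      using that by (simp_all add: strict_fillings_def)
    show "F x = F' x" if "x \<in> diagram lam" for x
      using \<open>map F (boxes lam) = map F' (boxes lam)\<close> that set_boxes[OF lam] by auto
  qed
  have "(\<Sum>T\<in>strict_chains w lam r. g (w \<circ> tableau_perm lam T)) =
      (\<Sum>ps\<in>(\<Union>F\<in>strict_fillings B lam. label_chains B r w (map F (boxes lam))). g (w \<circ> pairs_perm ps))"
    using sum.reindex_bij_betw[OF strict_chains_bij[OF lam w r B], of "\<lambda>ps. g (w \<circ> pairs_perm ps)"]
    by (simp add: tableau_perm_eq)
  also have "\<dots> = (\<Sum>F\<in>strict_fillings B lam. \<Sum>ps\<in>label_chains B r w (map F (boxes lam)). g (w \<circ> pairs_perm ps))"
  proof (rule sum.UNION_disjoint)
    show "\<forall>F\<in>strict_fillings B lam. \<forall>F'\<in>strict_fillings B lam. F \<noteq> F' \<longrightarrow>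
        label_chains B r w (map F (boxes lam)) \<inter> label_chains B r w (map F' (boxes lam)) = {}"
    proof (intro ballI impI)
      fix F F' assume "F \<in> strict_fillings B lam" "F' \<in> strict_fillings B lam" "F \<noteq> F'"
      then have "map F (boxes lam) \<noteq> map F' (boxes lam)" using inj by blast
      then show "label_chains B r w (map F (boxes lam)) \<inter> label_chains B r w (map F' (boxes lam)) = {}"
        unfolding label_chains_def by auto
    qed
  qed (simp_all add: finite_strict_fillings[OF lam] finite_label_chains)
  also have "\<dots> = (\<Sum>F\<in>strict_fillings B lam. Uword B r (map F (boxes lam)) g w)"
  proof (rule sum.cong[OF refl])
    fix F assume "F \<in> strict_fillings B lam"
    then have "set (map F (boxes lam)) \<subseteq> {1..B}"
      by (auto simp: strict_fillings_def set_boxes[OF lam])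
    then show "(\<Sum>ps\<in>label_chains B r w (map F (boxes lam)). g (w \<circ> pairs_perm ps)) =
      Uword B r (map F (boxes lam)) g w"
      by (intro Uword_eq_sum[OF wB, symmetric]) (use r B in auto)
  qed
  finally show ?thesis .
qed

subsection \<open>Hooks\<close>

lemma Uword_cong:
  assumes "w permutes {1..n}" "r \<le> n" "n + length ks \<le> B" "set ks \<subseteq> {1..B}"
    and "\<And>v. v permutes {1..n + length ks} \<Longrightarrow> g v = h v"
  shows "Uword B r ks g w = Uword B r ks h w"
  using assms
proof (induction ks arbitrary: w n)
  case Nil
  then show ?case by simp
next
  case (Cons k ks)
  have nB: "n < B" using Cons.prems(3) by simp
  show ?case unfolding Uword.simps
  proof (rule Uop_cong)
    fix a b assume a: "a \<in> {1..B}" "a \<le> r" "b \<in> {r<..B}" "covers w a b"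
    have b: "b \<le> Suc n" by (rule covers_range[OF Cons.prems(1) nB]) (use a Cons.prems in auto)
    define v where "v = w \<circ> transpose a b"
    have "w permutes {1..Suc n}" using Cons.prems(1) by (rule permutes_subset) auto
    then have v: "v permutes {1..Suc n}" unfolding v_def
      using a b Cons.prems by (intro permutes_comp_transpose) auto
    have "Uword B r ks g v = Uword B r ks h v"
      by (rule Cons.IH[OF v]) (use Cons.prems in auto)
    then show "Uword B r ks g (w \<circ> transpose a b) = Uword B r ks h (w \<circ> transpose a b)"
      by (simp only: v_def)
  qed (use Cons.prems in simp)
qed

lemma Uword_zero: "Uword B r ks (\<lambda>v. 0) = (\<lambda>w. 0)"
  using Uword_mult[of B r ks 0 "\<lambda>v. 0"] by simp

text \<open>After a step with label k the value k stands at a position > r.\<close>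

lemma Uop_Uop_same:
  assumes "k \<in> {1..B}"
  shows "Uop B r k (Uop B r k g) = (\<lambda>w. 0)"
proof
  fix w
  have "Uop B r k (Uop B r k g) w = Uop B r k (\<lambda>v. 0) w"
  proof (rule Uop_cong[OF _ assms])
    fix a b assume a: "w permutes {1..B}" "a \<in> {1..B}" "b \<in> {r<..B}" "w a = k"
    have "(w \<circ> transpose a b) permutes {1..B}" using a by (intro permutes_comp_transpose) auto
    then have "inv (w \<circ> transpose a b) k = b" using a by (intro inv_eqI) auto
    then show "Uop B r k g (w \<circ> transpose a b) = 0" using a by (simp add: Uop_def)
  qed
  then show "Uop B r k (Uop B r k g) w = 0" by (simp add: Uop_zero)
qed

text \<open>The reading words of fillings of the hook with leg length \<open>b\<close> and first row of length \<open>a\<close>.\<close>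

definition hook_words :: "nat \<Rightarrow> nat \<Rightarrow> nat \<Rightarrow> nat list set" where
  "hook_words B b a = {ks. length ks = b + a \<and> set ks \<subseteq> {1..B} \<and>
     (\<forall>i<b. ks ! Suc i < ks ! i) \<and> (\<forall>i. b \<le> i \<and> Suc i < b + a \<longrightarrow> ks ! i < ks ! Suc i)}"

definition hook_sum ::
    "nat \<Rightarrow> nat \<Rightarrow> nat \<Rightarrow> nat \<Rightarrow> ((nat \<Rightarrow> nat) \<Rightarrow> 'a::comm_ring_1) \<Rightarrow> (nat \<Rightarrow> nat) \<Rightarrow> 'a" where
  "hook_sum B r b a g w = (\<Sum>ks\<in>hook_words B b a. Uword B r ks g w)"

lemma finite_hook_words: "finite (hook_words B b a)"
  by (rule finite_subset[of _ "{ks. set ks \<subseteq> {1..B} \<and> length ks = b + a}"])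
    (auto simp: hook_words_def intro: finite_lists_length_eq)

lemma hook_sum_row:
  "hook_sum B r 0 a g w = Hop B r 1 a g w"
proof -
  have asc: "sorted_wrt (<) ks \<longleftrightarrow> (\<forall>i. Suc i < length ks \<longrightarrow> ks ! i < ks ! Suc i)" for ks :: "nat list"
    by (rule sorted_wrt_iff_nth_Suc_transp) (auto simp: transp_def)
  have "bij_betw sorted_list_of_set {R. R \<subseteq> {1..B} \<and> card R = a} (hook_words B 0 a)"
  proof (rule bij_betw_byWitness[where f' = set])
    show "\<forall>R\<in>{R. R \<subseteq> {1..B} \<and> card R = a}. set (sorted_list_of_set R) = R"
      using finite_subset by fastforce
    show "\<forall>ks\<in>hook_words B 0 a. sorted_list_of_set (set ks) = ks"
      by (auto simp: hook_words_def asc[symmetric] sorted_list_of_set.idem_if_sorted_distinct strict_sorted_iff)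
    show "sorted_list_of_set ` {R. R \<subseteq> {1..B} \<and> card R = a} \<subseteq> hook_words B 0 a"
    proof (intro image_subsetI)
      fix R assume R: "R \<in> {R. R \<subseteq> {1..B} \<and> card R = a}"
      then have "finite R" using finite_subset by auto
      moreover have "\<forall>i. Suc i < length (sorted_list_of_set R) \<longrightarrow>
          sorted_list_of_set R ! i < sorted_list_of_set R ! Suc i"
        unfolding asc[symmetric] by simp
      ultimately show "sorted_list_of_set R \<in> hook_words B 0 a" using R by (simp add: hook_words_def)
    qed
    show "set ` hook_words B 0 a \<subseteq> {R. R \<subseteq> {1..B} \<and> card R = a}"
      by (auto simp: hook_words_def asc[symmetric] strict_sorted_iff distinct_card)
  qed
  then show ?thesis unfolding hook_sum_def Hop_def
    by (intro sum.reindex_bij_betw[symmetric])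
qed

text \<open>\<open>hook_words B b 1\<close> is a column of length b + 1 whose last letter is the
  corner. A column followed by a row is compared at the joint: a descent extends the leg, an ascent
  extends the arm, and equal letters give zero by \<open>Uop_Uop_same\<close>.\<close>

lemma hook_sum_column_row:
  fixes g :: "(nat \<Rightarrow> nat) \<Rightarrow> 'a::comm_ring_1"
  assumes a: "1 \<le> a"
  shows "hook_sum B r b 1 (hook_sum B r 0 a g) w = hook_sum B r (Suc b) a g w + hook_sum B r b (Suc a) g w"
proof -
  \<comment> \<open>The comparison at the joint, between the letters with indices b and b + 1, is
    left open.\<close>
  define L where "L = {ks. length ks = Suc b + a \<and> set ks \<subseteq> {1..B} \<and>
     (\<forall>i<b. ks ! Suc i < ks ! i) \<and> (\<forall>i. Suc b \<le> i \<and> Suc i < Suc b + a \<longrightarrow> ks ! i < ks ! Suc i)}"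
  have finL: "finite L"
    by (rule finite_subset[of _ "{ks. set ks \<subseteq> {1..B} \<and> length ks = Suc b + a}"])
      (auto simp: L_def intro: finite_lists_length_eq)
  have "hook_sum B r b 1 (hook_sum B r 0 a g) w =
      (\<Sum>p\<in>hook_words B b 1 \<times> hook_words B 0 a. Uword B r (fst p @ snd p) g w)"
    unfolding hook_sum_def Uword_sum Uword_append sum.cartesian_product by (simp add: split_def)
  also have "\<dots> = (\<Sum>ks\<in>L. Uword B r ks g w)"
  proof (rule sum.reindex_bij_witness[of _ "\<lambda>ks. (take (Suc b) ks, drop (Suc b) ks)" "\<lambda>p. fst p @ snd p"])
    fix p assume "p \<in> hook_words B b 1 \<times> hook_words B 0 a"
    then have p: "fst p \<in> hook_words B b 1" "snd p \<in> hook_words B 0 a" by auto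
    then have l: "length (fst p) = Suc b" "length (snd p) = a" by (simp_all add: hook_words_def)
    then show "(take (Suc b) (fst p @ snd p), drop (Suc b) (fst p @ snd p)) = p" by simp
    have "(fst p @ snd p) ! i < (fst p @ snd p) ! Suc i" if "Suc b \<le> i" "Suc i < Suc b + a" for i
    proof -
      have "Suc i - Suc b = Suc (i - Suc b)" using that by simp
      then show ?thesis using p(2) l that by (simp add: nth_append hook_words_def)
    qed
    then show "fst p @ snd p \<in> L" using p l by (auto simp: L_def hook_words_def nth_append)
  next
    fix ks assume ks: "ks \<in> L"
    then have l: "length ks = Suc b + a" by (simp add: L_def)
    have "take (Suc b) ks \<in> hook_words B b 1"
      using ks set_take_subset[of "Suc b" ks] by (auto simp: L_def hook_words_def)
    moreover have "drop (Suc b) ks \<in> hook_words B 0 a"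
      using ks set_drop_subset[of "Suc b" ks] by (auto simp: L_def hook_words_def)
    ultimately show "(take (Suc b) ks, drop (Suc b) ks) \<in> hook_words B b 1 \<times> hook_words B 0 a" by simp
  qed simp_all
  also have "\<dots> = (\<Sum>ks\<in>hook_words B (Suc b) a \<union> hook_words B b (Suc a). Uword B r ks g w)"
  proof (rule sum.mono_neutral_right[OF finL])
    show "hook_words B (Suc b) a \<union> hook_words B b (Suc a) \<subseteq> L"
      by (auto simp: L_def hook_words_def)
    show "\<forall>ks\<in>L - (hook_words B (Suc b) a \<union> hook_words B b (Suc a)). Uword B r ks g w = 0"
    proof
      fix ks assume ks: "ks \<in> L - (hook_words B (Suc b) a \<union> hook_words B b (Suc a))"
      then have kL: "length ks = Suc b + a" "set ks \<subseteq> {1..B}" by (simp_all add: L_def)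
      have "ks ! b = ks ! Suc b"
      proof (rule ccontr)
        assume "ks ! b \<noteq> ks ! Suc b"
        then consider "ks ! Suc b < ks ! b" | "ks ! b < ks ! Suc b" by linarith
        then show False
        proof cases
          case 1
          then have "ks \<in> hook_words B (Suc b) a" using ks by (auto simp: L_def hook_words_def less_Suc_eq)
          then show False using ks by simp
        next
          case 2
          have "ks ! i < ks ! Suc i" if "b \<le> i" "Suc i < b + Suc a" for i
            using 2 ks that by (cases "i = b") (auto simp: L_def)
          then have "ks \<in> hook_words B b (Suc a)" using ks by (auto simp: L_def hook_words_def)
          then show False using ks by simp
        qed
      qed
      moreover have "drop b ks = ks ! b # ks ! Suc b # drop (Suc (Suc b)) ks"
        using kL a by (simp add: Cons_nth_drop_Suc)
      ultimately have "ks = take b ks @ ks ! b # ks ! b # drop (Suc (Suc b)) ks"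
        using append_take_drop_id[of b ks] by simp
      moreover have "ks ! b \<in> set ks" using kL by simp
      then have "ks ! b \<in> {1..B}" using kL by blast
      ultimately show "Uword B r ks g w = 0"
        using Uop_Uop_same[of "ks ! b" B r, where 'a = 'a]
        by (metis Uword.simps(2) Uword_append Uword_zero)
    qed
  qed
  also have "\<dots> = hook_sum B r (Suc b) a g w + hook_sum B r b (Suc a) g w"
    unfolding hook_sum_def
    by (rule sum.union_disjoint)
      (use a in \<open>auto simp: finite_hook_words, fastforce simp: hook_words_def\<close>)
  finally show ?thesis .
qed

text \<open>The recursion mirrors \<open>hook_sum_column_row\<close>: a column of length \<open>b + 1\<close> times a row of length \<open>a\<close>
  gives the two hooks that contain them.\<close>

fun hook_poly :: "nat \<Rightarrow> nat \<Rightarrow> nat \<Rightarrow> mpoly" where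
  "hook_poly r 0 a = hpoly r a"
| "hook_poly r (Suc b) a = hook_poly r b 1 * hpoly r a - hook_poly r b (Suc a)"

lemma hook_pieri:
  assumes "w permutes {1..n}" "r \<le> n" "n + b + a \<le> B" "1 \<le> a"
  shows "hook_sum B r b a schubert w = hook_poly r b a * schubert w"
  using assms(3,4)
proof (induction b arbitrary: a)
  case 0
  then show ?case by (simp only: hook_sum_row hook_poly.simps) (intro schubert_pieri[OF assms(1,2)], simp)
next
  case (Suc b)
  have "hook_sum B r b 1 (hook_sum B r 0 a schubert) w = hook_sum B r b 1 (\<lambda>v. hpoly r a * schubert v) w"
    unfolding hook_sum_def[of B r b 1]
  proof (rule sum.cong[OF refl])
    fix ks assume "ks \<in> hook_words B b 1"
    then have ks: "length ks = Suc b" "set ks \<subseteq> {1..B}" by (simp_all add: hook_words_def)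
    show "Uword B r ks (hook_sum B r 0 a schubert) w = Uword B r ks (\<lambda>v. hpoly r a * schubert v) w"
    proof (rule Uword_cong[OF assms(1,2)])
      fix v assume v: "v permutes {1..n + length ks}"
      show "hook_sum B r 0 a schubert v = hpoly r a * schubert v"
        unfolding hook_sum_row by (rule schubert_pieri[OF v]) (use assms(2) Suc.prems ks in auto)
    qed (use ks Suc.prems in auto)
  qed
  also have "\<dots> = hpoly r a * hook_sum B r b 1 schubert w"
    by (simp add: hook_sum_def Uword_mult sum_distrib_left)
  also have "\<dots> = hpoly r a * (hook_poly r b 1 * schubert w)"
    using Suc.prems by (subst Suc.IH) auto
  finally have "hook_sum B r (Suc b) a schubert w + hook_sum B r b (Suc a) schubert w =
      hpoly r a * (hook_poly r b 1 * schubert w)"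
    using hook_sum_column_row[OF Suc.prems(2), of B r b schubert w] by simp
  moreover have "hook_sum B r b (Suc a) schubert w = hook_poly r b (Suc a) * schubert w"
    using Suc.prems by (intro Suc.IH) auto
  ultimately show ?case by (simp add: algebra_simps)
qed

section \<open>Hook-shaped fillings as words\<close>

lemma sum_strict_fillings_eq:
  assumes lam: "is_partition lam"
  shows "(\<Sum>F\<in>strict_fillings B lam. f (map F (boxes lam))) =
    (\<Sum>ks\<in>(\<lambda>F. map F (boxes lam)) ` strict_fillings B lam. f ks)"
proof (rule sum.reindex[symmetric, unfolded o_def])
  have "inj_on (\<lambda>F. map F (boxes lam)) (diagram lam \<rightarrow>\<^sub>E {1..B})"
    using bij_betw_map_PiE[OF distinct_boxes[of lam], of "{1..B}"]
    by (simp add: bij_betw_def set_boxes[OF lam])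
  then show "inj_on (\<lambda>F. map F (boxes lam)) (strict_fillings B lam)"
    by (rule inj_on_subset) (auto simp: strict_fillings_def)
qed

lemma boxes_hook:
  assumes lam: "is_partition lam" and hook: "hook lam" and N: "num_parts lam = Suc b"
  shows "boxes lam = map (\<lambda>q. (Suc b - q, 1)) [0..<b] @ map (\<lambda>j. (1, Suc j)) [0..<lam 1]"
proof -
  have one: "lam i = 1" if "i \<in> {2..Suc b}" for i using hook that N by (auto simp: hook_def)
  let ?row = "\<lambda>i. map (Pair i) [1..<Suc (lam i)]"
  have "rev [1..<Suc (Suc b)] = rev [2..<Suc (Suc b)] @ [1]"
    by (simp add: upt_conv_Cons numeral_2_eq_2 del: upt_Suc)
  then have "boxes lam = concat (map ?row (rev [2..<Suc (Suc b)])) @ ?row 1"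
    unfolding boxes_def N by (simp del: upt_Suc)
  also have "map ?row (rev [2..<Suc (Suc b)]) = map (\<lambda>i. [(i, 1)]) (rev [2..<Suc (Suc b)])"
    by (rule map_cong[OF refl]) (use one in auto)
  also have "concat (map (\<lambda>i. [(i, 1)]) (rev [2..<Suc (Suc b)])) = map (\<lambda>i. (i, 1)) (rev [2..<Suc (Suc b)])"
    by (simp add: concat_map_singleton del: upt_Suc)
  also have "\<dots> = map (\<lambda>q. (Suc b - q, 1)) [0..<b]"
    by (rule nth_equalityI) (auto simp: rev_nth simp del: upt_Suc)
  also have "?row 1 = map (\<lambda>j. (1, Suc j)) [0..<lam 1]"
    by (rule nth_equalityI) (auto simp del: upt_Suc)
  finally show ?thesis .
qed

text \<open>Only the first row and the first column have more than one box, so both strictness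
  conditions together say that these two increase strictly. The leg is read from the bottom, hence
  appears as b descents that end in the corner, the letter with index b.\<close>

lemma hook_words_strict_fillings:
  assumes lam: "is_partition lam" and hook: "hook lam" and N: "num_parts lam = Suc b"
  shows "(\<lambda>F. map F (boxes lam)) ` strict_fillings B lam = hook_words B b (lam 1)"
proof -
  have supp: "{i. 1 \<le> i \<and> lam i \<noteq> 0} = {1..Suc b}" using partition_support[OF lam] N by simp
  have one: "lam i = 1" if "i \<in> {2..Suc b}" for i using hook that N by (auto simp: hook_def)
  have lam1: "1 \<le> lam 1" using supp by fastforce
  have zero: "lam i = 0" if "i > Suc b" for i
  proof (rule ccontr)
    assume "lam i \<noteq> 0"
    then have "i \<in> {1..Suc b}" unfolding supp[symmetric] using that by simp
    then show False using that by simp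
  qed
  let ?bs = "boxes lam"
  note bs = boxes_hook[OF assms]
  have len: "length ?bs = b + lam 1" unfolding bs by simp
  have col: "?bs ! q = (Suc b - q, 1)" if "q \<le> b" for q
    using that lam1 unfolding bs by (cases "q = b") (auto simp: nth_append)
  have row: "?bs ! (b + j) = (1, Suc j)" if "j < lam 1" for j
    using that unfolding bs by (simp add: nth_append)
  have diag: "(i, j) \<in> diagram lam \<longleftrightarrow> (i = 1 \<and> 1 \<le> j \<and> j \<le> lam 1) \<or> (2 \<le> i \<and> i \<le> Suc b \<and> j = 1)" for i j
  proof (cases "i = 1 \<or> i = 0")
    case False
    then consider "i \<in> {2..Suc b}" | "i > Suc b" by fastforce
    then show ?thesis by cases (use one zero in \<open>auto simp: diagram_def\<close>)
  qed (auto simp: diagram_def)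
  have words: "map F ?bs \<in> hook_words B b (lam 1) \<longleftrightarrow> row_strict lam F \<and> column_strict lam F"
    if F: "F \<in> diagram lam \<rightarrow>\<^sub>E {1..B}" for F
  proof -
    have set: "set (map F ?bs) \<subseteq> {1..B}" using F by (auto simp: set_boxes[OF lam])
    have ncol: "map F ?bs ! q = F (Suc b - q, 1)" if "q \<le> b" for q using col[OF that] that lam1 len by simp
    have nrow: "map F ?bs ! (b + j) = F (1, Suc j)" if "j < lam 1" for j using row[OF that] that len by simp
    have A: "(\<forall>q<b. map F ?bs ! Suc q < map F ?bs ! q) \<longleftrightarrow> (\<forall>q<b. F (b - q, 1) < F (Suc b - q, 1))"
      using ncol by auto
    have B: "(\<forall>q. b \<le> q \<and> Suc q < b + lam 1 \<longrightarrow> map F ?bs ! q < map F ?bs ! Suc q) \<longleftrightarrow>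
        (\<forall>j. Suc j < lam 1 \<longrightarrow> F (1, Suc j) < F (1, Suc (Suc j)))"
    proof (intro iffI allI impI)
      fix j assume a: "\<forall>q. b \<le> q \<and> Suc q < b + lam 1 \<longrightarrow> map F ?bs ! q < map F ?bs ! Suc q" "Suc j < lam 1"
      then have "map F ?bs ! (b + j) < map F ?bs ! (b + Suc j)" by simp
      then show "F (1, Suc j) < F (1, Suc (Suc j))" using a nrow[of j] nrow[of "Suc j"] by simp
    next
      fix q assume a: "\<forall>j. Suc j < lam 1 \<longrightarrow> F (1, Suc j) < F (1, Suc (Suc j))" "b \<le> q \<and> Suc q < b + lam 1"
      then obtain j where "q = b + j" "Suc j < lam 1" by (metis add_Suc_right le_add_diff_inverse nat_add_left_cancel_less)
      then show "map F ?bs ! q < map F ?bs ! Suc q" using a nrow[of j] nrow[of "Suc j"] by simp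
    qed
    have diag_step: "F (Suc q, 1) < F (Suc (Suc q), 1)"
      if "\<forall>q<b. F (b - q, 1) < F (Suc b - q, 1)" "q < b" for q
    proof -
      have "b - (b - Suc q) = Suc q" "Suc b - (b - Suc q) = Suc (Suc q)" "b - Suc q < b" using that by auto
      then show ?thesis using that(1) by metis
    qed
    have col_mono: "F (Suc p, 1) < F (Suc q, 1)"
      if "\<forall>q<b. F (b - q, 1) < F (Suc b - q, 1)" "p < q" "q \<le> b" for p q
      using that(2,3)
    proof (induction q)
      case (Suc q)
      then show ?case using diag_step[OF that(1), of q] by (cases "p = q") auto
    qed simp
    have row_mono: "F (1, Suc p) < F (1, Suc q)"
      if "\<forall>j. Suc j < lam 1 \<longrightarrow> F (1, Suc j) < F (1, Suc (Suc j))" "p < q" "q < lam 1" for p q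
      using that(2,3)
    proof (induction q)
      case (Suc q)
      then show ?case using that(1) by (cases "p = q") (auto intro: less_trans)
    qed simp
    have "map F ?bs \<in> hook_words B b (lam 1) \<longleftrightarrow> (\<forall>q<b. F (b - q, 1) < F (Suc b - q, 1)) \<and>
        (\<forall>j. Suc j < lam 1 \<longrightarrow> F (1, Suc j) < F (1, Suc (Suc j)))"
      unfolding hook_words_def mem_Collect_eq A B using set len by simp
    also have "\<dots> \<longleftrightarrow> row_strict lam F \<and> column_strict lam F"
    proof
      assume a: "(\<forall>q<b. F (b - q, 1) < F (Suc b - q, 1)) \<and>
        (\<forall>j. Suc j < lam 1 \<longrightarrow> F (1, Suc j) < F (1, Suc (Suc j)))"
      have R: "F (i, j) < F (i, j')"
        if d: "(i, j) \<in> diagram lam" "(i, j') \<in> diagram lam" "j < j'" for i j j'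
      proof -
        have "i = 1" "1 \<le> j" "j' \<le> lam 1" using d unfolding diag by auto
        then show ?thesis using row_mono[of "j - 1" "j' - 1"] a d(3) by simp
      qed
      have C: "F (i, j) < F (i', j)"
        if d: "(i, j) \<in> diagram lam" "(i', j) \<in> diagram lam" "i < i'" for i i' j
      proof -
        have "j = 1" "1 \<le> i" "i' \<le> Suc b" using d unfolding diag by auto
        then show ?thesis using col_mono[of "i - 1" "i' - 1"] a d(3) by simp
      qed
      show "row_strict lam F \<and> column_strict lam F"
        unfolding row_strict_def column_strict_def using R C by (meson less_imp_le)
    next
      assume a: "row_strict lam F \<and> column_strict lam F"
      have "F (b - q, 1) < F (Suc b - q, 1)" if "q < b" for q
      proof -
        have "(b - q, 1) \<in> diagram lam" "(Suc b - q, 1) \<in> diagram lam" "b - q < Suc b - q"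
          unfolding diag using that lam1 by auto
        then show ?thesis using a unfolding column_strict_def by blast
      qed
      moreover have "F (1, Suc j) < F (1, Suc (Suc j))" if "Suc j < lam 1" for j
      proof -
        have "(1, Suc j) \<in> diagram lam" "(1, Suc (Suc j)) \<in> diagram lam" unfolding diag using that by auto
        then show ?thesis using a unfolding row_strict_def by blast
      qed
      ultimately show "(\<forall>q<b. F (b - q, 1) < F (Suc b - q, 1)) \<and>
        (\<forall>j. Suc j < lam 1 \<longrightarrow> F (1, Suc j) < F (1, Suc (Suc j)))" by blast
    qed
    finally show ?thesis .
  qed
  show ?thesis
  proof (intro equalityI subsetI)
    fix ks assume "ks \<in> (\<lambda>F. map F ?bs) ` strict_fillings B lam"
    then show "ks \<in> hook_words B b (lam 1)" using words by (auto simp: strict_fillings_def)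
  next
    fix ks assume ks: "ks \<in> hook_words B b (lam 1)"
    then have "ks \<in> {ps. length ps = length ?bs \<and> set ps \<subseteq> {1..B}}" using len by (simp add: hook_words_def)
    then have "ks \<in> (\<lambda>F. map F ?bs) ` (set ?bs \<rightarrow>\<^sub>E {1..B})"
      using bij_betw_map_PiE[OF distinct_boxes[of lam], of "{1..B}"] by (simp only: bij_betw_def)
    then obtain F where "F \<in> diagram lam \<rightarrow>\<^sub>E {1..B}" "ks = map F ?bs" by (auto simp: set_boxes[OF lam])
    then show "ks \<in> (\<lambda>F. map F ?bs) ` strict_fillings B lam"
      using ks words[of F] by (auto simp: strict_fillings_def)
  qed
qed

lemma hook_case:
  assumes lam: "is_partition lam" and hook: "hook lam" and pos: "num_parts lam = Suc b"
    and w: "w permutes {1..n}" "r \<le> n" "n + length (boxes lam) \<le> B"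
  shows "(\<Sum>F\<in>strict_fillings B lam. Uword B r (map F (boxes lam)) schubert w) =
    hook_poly r b (lam 1) * schubert w"
proof -
  have "lam 1 \<noteq> 0" using partition_support[OF lam] pos by fastforce
  moreover have "length (boxes lam) = b + lam 1" unfolding boxes_hook[OF lam hook pos] by simp
  ultimately have "hook_sum B r b (lam 1) schubert w = hook_poly r b (lam 1) * schubert w"
    using w by (intro hook_pieri[OF w(1,2)]) auto
  then show ?thesis
    unfolding sum_strict_fillings_eq[OF lam, of "\<lambda>ks. Uword B r ks schubert w"]
      hook_words_strict_fillings[OF lam hook pos] hook_sum_def .
qed

subsection \<open>Semi-shuffles\<close>

text \<open>The values of the holes \<open>X\<close> stand at positions \<open>> r\<close>. For a semi-shuffle these positions are sorted
  by value, hence a step with label \<open>k\<close> can only move the nearest hole above \<open>k\<close> down to \<open>k\<close>.\<close>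

definition hole_state :: "nat \<Rightarrow> nat \<Rightarrow> nat set \<Rightarrow> (nat \<Rightarrow> nat) \<Rightarrow> bool" where
  "hole_state B r X v \<longleftrightarrow> v permutes {1..B} \<and> semi_shuffle r v \<and> (\<forall>h\<in>X. r < inv v h)"

section \<open>Holes as barriers\<close>

lemma semi_shuffle_less:
  assumes "semi_shuffle r v" "r < i" "i < j"
  shows "v i < v j"
  using assms(3)
proof (induction j)
  case (Suc j)
  have "v j < v (Suc j)" if "r < j" using assms(1) that by (simp add: semi_shuffle_def)
  then show ?case using Suc assms(2) by (cases "i = j") (auto intro: less_trans)
qed simp

text \<open>A hole above the label cannot be skipped. If v b > h, sortedness of the positions > r
  places h between p and b in position, and it also lies between them in value, so the step would
  not be a cover.\<close>

lemma hole_landing: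
  assumes v: "v permutes {1..B}" "semi_shuffle r v" and h: "r < inv v h" "h \<in> {1..B}"
    and p: "p \<in> {1..B}" "p \<le> r" "v p < h" and b: "b \<in> {r<..B}" "covers v p b"
  shows "v b \<le> h"
proof (rule ccontr)
  assume "\<not> v b \<le> h"
  then have hb: "h < v b" by simp
  have vh: "v (inv v h) = h" by (rule permutes_inverses(1)[OF v(1)])
  have "inv v h < b"
  proof (rule ccontr)
    assume "\<not> inv v h < b"
    then have "b \<le> inv v h" by simp
    then have "v b \<le> h" using semi_shuffle_less[OF v(2), of b "inv v h"] b(1) vh
      by (cases "b = inv v h") auto
    then show False using hb by simp
  qed
  moreover have "p < b" "b \<in> {1..B}" "p < inv v h" using p b h by auto
  ultimately show False using covers_iff[OF v(1), of p b] b(2) p hb vh by auto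
qed

text \<open>The value at b decreases, so only its left neighbour beyond r is at risk. That neighbour
  is below v b, and the cover condition keeps it from lying above v p.\<close>

lemma semi_shuffle_move:
  assumes v: "v permutes {1..B}" "semi_shuffle r v"
    and p: "p \<in> {1..B}" "p \<le> r" and b: "b \<in> {r<..B}" "covers v p b"
  shows "semi_shuffle r (v \<circ> transpose p b)"
  unfolding semi_shuffle_def
proof (intro allI impI)
  fix i assume i: "r < i"
  have pb: "p < b" "b \<in> {1..B}" using p b by auto
  have cov: "v p < v b" "\<And>c. p < c \<Longrightarrow> c < b \<Longrightarrow> \<not> (v p < v c \<and> v c < v b)"
    using covers_iff[OF v(1) pb(1) p(1) pb(2)] b(2) by auto
  have ii: "v i < v (Suc i)" using v(2) i by (simp add: semi_shuffle_def)
  consider "i = b" | "Suc i = b" | "i \<noteq> b" "Suc i \<noteq> b" by blast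
  then show "(v \<circ> transpose p b) i < (v \<circ> transpose p b) (Suc i)"
  proof cases
    case 1
    then show ?thesis using cov(1) ii p b by (auto simp: transpose_def)
  next
    case 2
    have "v i \<noteq> v p" using permutes_inj[OF v(1)] i p by (metis injD not_less)
    moreover have "\<not> (v p < v i \<and> v i < v b)" using cov(2)[of i] 2 i p by auto
    ultimately have "v i < v p" using ii 2 by auto
    then show ?thesis using 2 i p by (auto simp: transpose_def)
  next
    case 3
    then show ?thesis using ii i p by (auto simp: transpose_def)
  qed
qed

text \<open>The step opens a hole at its label and closes the one at v b, which moves to a position
  \<le> r.\<close>

lemma hole_state_move:
  assumes v: "hole_state B r X v" and p: "p \<in> {1..B}" "p \<le> r" and b: "b \<in> {r<..B}" "covers v p b"
    and Y: "\<And>x. x \<in> Y \<Longrightarrow> x = v p \<or> (x \<in> X \<and> x \<noteq> v b)"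
  shows "hole_state B r Y (v \<circ> transpose p b)"
proof -
  have vp: "v permutes {1..B}" "semi_shuffle r v" "\<And>h. h \<in> X \<Longrightarrow> r < inv v h"
    using v by (auto simp: hole_state_def)
  define v' where "v' = v \<circ> transpose p b"
  have v': "v' permutes {1..B}" unfolding v'_def
    using vp p b by (intro permutes_comp_transpose) auto
  have "semi_shuffle r v'" unfolding v'_def by (rule semi_shuffle_move[OF vp(1,2) p b])
  moreover have "r < inv v' x" if "x \<in> Y" for x
  proof (cases "x = v p")
    case True
    then have "inv v' x = b" by (intro inv_eqI[OF v']) (simp add: v'_def)
    then show ?thesis using b by simp
  next
    case False
    then have x: "x \<in> X" "x \<noteq> v b" using Y[OF that] by auto
    have "v (inv v x) = x" by (rule permutes_inverses(1)[OF vp(1)])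
    then have "v' (inv v x) = x" using False x(2) by (auto simp: v'_def transpose_def)
    then have "inv v' x = inv v x" by (intro inv_eqI[OF v'])
    then show ?thesis using vp(3)[OF x(1)] by simp
  qed
  ultimately show ?thesis using v' by (simp add: hole_state_def v'_def)
qed

text \<open>The step with label a lands at or below the hole h and so never displaces p. The step
  with label p lands above p and so never displaces a. Hence each step finds the starting position
  of the other unchanged.\<close>

lemma Uop_commute_hole:
  fixes f :: "(nat \<Rightarrow> nat) \<Rightarrow> 'a::comm_ring_1"
  assumes v: "hole_state B r {h} v" and k: "a \<in> {1..B}" "h \<in> {1..B}" "p \<in> {1..B}" "a < h" "h < p"
    and r: "r \<le> B"
  shows "Uop B r p (Uop B r a f) v = Uop B r a (Uop B r p f) v"
proof -
  have vp: "v permutes {1..B}" "semi_shuffle r v" "r < inv v h" using v by (auto simp: hole_state_def)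
  have inj: "v x = v y \<longleftrightarrow> x = y" for x y using permutes_inj[OF vp(1)] by (auto dest: injD)
  define x where "x = inv v a"
  define y where "y = inv v p"
  have vx: "v x = a" "v y = p" unfolding x_def y_def by (rule permutes_inverses(1)[OF vp(1)])+
  have xy: "x \<noteq> y" using vx k by auto
  have xB: "x \<in> {1..B}" "y \<in> {1..B}"
    unfolding x_def y_def using inv_in_range[OF vp(1)] k by blast+
  define C where "C = {r<..B}"
  have CB: "b \<in> {1..B}" if "b \<in> C" for b using that by (auto simp: C_def)
  have wt: "(v \<circ> transpose s b) permutes {1..B}" if "s \<in> {1..B}" "b \<in> C" for s b
    using vp(1) that(1) CB[OF that(2)] by (intro permutes_comp_transpose)
  have iy: "inv (v \<circ> transpose x b) p = y" if "x \<le> r" "b \<in> C" "covers v x b" for b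
  proof (rule inv_eqI[OF wt[OF xB(1) that(2)]])
    have "v b \<le> h" by (rule hole_landing[OF vp k(2) xB(1) that(1) _ _ that(3)]) (use vx k that in \<open>auto simp: C_def\<close>)
    then have "y \<noteq> b" using vx k by auto
    then show "(v \<circ> transpose x b) y = p" using xy vx by (simp add: transpose_def)
  qed
  have ix: "inv (v \<circ> transpose y b) a = x" if "y \<le> r" "b \<in> C" "covers v y b" for b
  proof (rule inv_eqI[OF wt[OF xB(2) that(2)]])
    have "v y < v b" by (rule covers_less[OF vp(1) _ xB(2) CB[OF that(2)] that(3)]) (use that in \<open>auto simp: C_def\<close>)
    then have "x \<noteq> b" using vx k by auto
    then show "(v \<circ> transpose y b) x = a" using xy vx by (simp add: transpose_def)
  qed
  define T where "T b c = (if covers v y b \<and> covers (v \<circ> transpose y b) x c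
    then f (v \<circ> transpose y b \<circ> transpose x c) else 0)" for b c
  define T' where "T' c b = (if covers v x c \<and> covers (v \<circ> transpose x c) y b
    then f (v \<circ> transpose x c \<circ> transpose y b) else 0)" for c b
  have L: "Uop B r p (Uop B r a f) v = (if x \<le> r \<and> y \<le> r then \<Sum>b\<in>C. \<Sum>c\<in>C. T b c else 0)"
  proof (cases "y \<le> r")
    case True
    have "Uop B r p (Uop B r a f) v = (\<Sum>b\<in>C. if covers v y b then Uop B r a f (v \<circ> transpose y b) else 0)"
      unfolding Uop_def[of B r p] y_def[symmetric] C_def[symmetric] using True vp(1) by simp
    also have "\<dots> = (\<Sum>b\<in>C. if x \<le> r then \<Sum>c\<in>C. T b c else 0)"
    proof (rule sum.cong[OF refl])
      fix b assume b: "b \<in> C"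
      show "(if covers v y b then Uop B r a f (v \<circ> transpose y b) else 0) = (if x \<le> r then \<Sum>c\<in>C. T b c else 0)"
      proof (cases "covers v y b")
        case c: True
        show ?thesis unfolding Uop_def ix[OF True b c] C_def[symmetric] T_def
          using c wt[OF xB(2) b] by simp
      qed (simp add: T_def)
    qed
    finally show ?thesis using True by simp
  next
    case False
    then show ?thesis by (simp add: Uop_def y_def)
  qed
  have R: "Uop B r a (Uop B r p f) v = (if x \<le> r \<and> y \<le> r then \<Sum>c\<in>C. \<Sum>b\<in>C. T' c b else 0)"
  proof (cases "x \<le> r")
    case True
    have "Uop B r a (Uop B r p f) v = (\<Sum>b\<in>C. if covers v x b then Uop B r p f (v \<circ> transpose x b) else 0)"
      unfolding Uop_def[of B r a] x_def[symmetric] C_def[symmetric] using True vp(1) by simp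
    also have "\<dots> = (\<Sum>b\<in>C. if y \<le> r then \<Sum>c\<in>C. T' b c else 0)"
    proof (rule sum.cong[OF refl])
      fix b assume b: "b \<in> C"
      show "(if covers v x b then Uop B r p f (v \<circ> transpose x b) else 0) = (if y \<le> r then \<Sum>c\<in>C. T' b c else 0)"
      proof (cases "covers v x b")
        case c: True
        show ?thesis unfolding Uop_def iy[OF True b c] C_def[symmetric] T'_def
          using c wt[OF xB(1) b] by simp
      qed (simp add: T'_def)
    qed
    finally show ?thesis using True by simp
  next
    case False
    then show ?thesis by (simp add: Uop_def x_def)
  qed
  have TT: "T b c = T' c b" if b: "b \<in> C" and c: "c \<in> C" and le: "x \<le> r" "y \<le> r" for b c
  proof (cases "b = c")
    \<comment> \<open>Both steps use position b. After the step with label p it holds p > h, which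
      is beyond the barrier for a; after the step with label a it holds a < p, which is no ascent
      for p.\<close>
    case True
    have lt: "x < b" "y < b" using le b by (auto simp: C_def)
    have nb: "y \<noteq> b" "x \<noteq> b" using lt by auto
    have "T b c = 0"
    proof -
      have "\<not> (covers v y b \<and> covers (v \<circ> transpose y b) x b)"
      proof
        assume cov: "covers v y b \<and> covers (v \<circ> transpose y b) x b"
        have "v y < v b" by (rule covers_less[OF vp(1) lt(2) xB(2) CB[OF b]]) (use cov in simp)
        have "hole_state B r {h} (v \<circ> transpose y b)"
          by (rule hole_state_move[OF v xB(2) le(2)]) (use b cov k vx \<open>v y < v b\<close> in \<open>auto simp: C_def\<close>)
        then have hs: "(v \<circ> transpose y b) permutes {1..B}" "semi_shuffle r (v \<circ> transpose y b)"
          "r < inv (v \<circ> transpose y b) h" by (auto simp: hole_state_def)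
        have "(v \<circ> transpose y b) b \<le> h"
          by (rule hole_landing[OF hs k(2) xB(1) le(1)]) (use b cov xy nb vx k in \<open>auto simp: C_def transpose_def\<close>)
        then show False using vx k by simp
      qed
      then show ?thesis using True unfolding T_def by auto
    qed
    moreover have "T' c b = 0"
    proof -
      have "\<not> covers (v \<circ> transpose x b) y b"
      proof
        assume "covers (v \<circ> transpose x b) y b"
        then have "(v \<circ> transpose x b) y < (v \<circ> transpose x b) b"
          by (rule covers_less[OF wt[OF xB(1) b] lt(2) xB(2) CB[OF b]])
        then show False using xy nb vx k by (simp add: transpose_def)
      qed
      then show ?thesis using True by (simp add: T'_def)
    qed
    ultimately show ?thesis by simp
  next
    case False
    have d: "x \<noteq> c" "y \<noteq> b" "x \<noteq> b" "y \<noteq> c" using le b c by (auto simp: C_def)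
    have e: "v \<circ> transpose y b \<circ> transpose x c = v \<circ> transpose x c \<circ> transpose y b"
      using d xy False by (intro transpose_commute_disjoint) auto
    have vv: "(v \<circ> transpose y b) x = v x" "(v \<circ> transpose y b) c = v c"
      "(v \<circ> transpose x c) y = v y" "(v \<circ> transpose x c) b = v b"
      using d xy False by (auto simp: transpose_def)
    have "covers v y b \<and> covers (v \<circ> transpose y b) x c \<longleftrightarrow> covers v x c \<and> covers (v \<circ> transpose x c) y b"
      unfolding two_covers[OF vp(1) d(2) xB(2) CB[OF b] d(1) xB(1) CB[OF c]]
        two_covers[OF vp(1) d(1) xB(1) CB[OF c] d(2) xB(2) CB[OF b]] e raises_def vv by blast
    then show ?thesis by (simp add: T_def T'_def e)
  qed
  show ?thesis
  proof (cases "x \<le> r \<and> y \<le> r")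
    case True
    have "(\<Sum>b\<in>C. \<Sum>c\<in>C. T b c) = (\<Sum>b\<in>C. \<Sum>c\<in>C. T' c b)"
      using TT True by (intro sum.cong refl) auto
    also have "\<dots> = (\<Sum>c\<in>C. \<Sum>b\<in>C. T' c b)" by (rule sum.swap)
    finally show ?thesis unfolding L R by simp
  qed (auto simp: L R)
qed

lemma Uop_cong_holes:
  assumes v: "hole_state B r X v" and k: "k \<in> {1..B}"
    and eq: "\<And>b. b \<in> {r<..B} \<Longrightarrow> covers v (inv v k) b \<Longrightarrow> inv v k \<le> r \<Longrightarrow> k < v b \<Longrightarrow>
      hole_state B r (insert k (X - {v b})) (v \<circ> transpose (inv v k) b) \<Longrightarrow>
      g (v \<circ> transpose (inv v k) b) = h (v \<circ> transpose (inv v k) b)"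
  shows "Uop B r k g v = Uop B r k h v"
proof (rule Uop_cong[OF _ k])
  fix a b assume a: "v permutes {1..B}" "a \<in> {1..B}" "a \<le> r" "b \<in> {r<..B}" "v a = k" "covers v a b"
  have i: "inv v k = a" by (rule inv_eqI[OF a(1,5)])
  have less: "k < v b" unfolding a(5)[symmetric] by (rule covers_less[OF a(1) _ a(2) _ a(6)]) (use a in auto)
  have "hole_state B r (insert k (X - {v b})) (v \<circ> transpose a b)"
    by (rule hole_state_move[OF v a(2,3,4,6)]) (use a in auto)
  then show "g (v \<circ> transpose a b) = h (v \<circ> transpose a b)"
    using eq[of b] i a less by simp
qed

lemma hole_state_mono: "hole_state B r X v \<Longrightarrow> Y \<subseteq> X \<Longrightarrow> hole_state B r Y v"
  by (auto simp: hole_state_def)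

text \<open>A step fills only holes above its label, so holes below all letters survive the
  word.\<close>

lemma Uword_cong_holes_above:
  assumes "hole_state B r X v" "set ps \<subseteq> {1..B}" "\<And>x p. x \<in> X \<Longrightarrow> p \<in> set ps \<Longrightarrow> x < p"
    and "\<And>v'. hole_state B r X v' \<Longrightarrow> g v' = h v'"
  shows "Uword B r ps g v = Uword B r ps h v"
  using assms(1-3)
proof (induction ps arbitrary: v)
  case Nil
  then show ?case using assms(4) by simp
next
  case (Cons p ps)
  show ?case unfolding Uword.simps
  proof (rule Uop_cong_holes[OF Cons.prems(1)])
    fix b assume b: "p < v b" "hole_state B r (insert p (X - {v b})) (v \<circ> transpose (inv v p) b)"
    have "X \<subseteq> insert p (X - {v b})"
    proof
      fix x assume "x \<in> X"
      then have "x < p" using Cons.prems(3)[of x p] by simp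
      then show "x \<in> insert p (X - {v b})" using b(1) \<open>x \<in> X\<close> by auto
    qed
    then show "Uword B r ps g (v \<circ> transpose (inv v p) b) = Uword B r ps h (v \<circ> transpose (inv v p) b)"
      by (intro Cons.IH hole_state_mono[OF b(2)]) (use Cons.prems in auto)
  qed (use Cons.prems in simp)
qed

text \<open>In an increasing word no step fills a hole that an earlier label has left.\<close>

lemma Uword_cong_new_holes:
  assumes "hole_state B r X v" "set bs \<subseteq> {1..B}" "sorted_wrt (<) bs"
    "\<And>x b. x \<in> X \<Longrightarrow> b \<in> set bs \<Longrightarrow> x < b"
    and "\<And>v'. hole_state B r (X \<union> set bs) v' \<Longrightarrow> g v' = h v'"
  shows "Uword B r bs g v = Uword B r bs h v"
  using assms
proof (induction bs arbitrary: v X)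
  case Nil
  then show ?case by simp
next
  case (Cons b bs)
  show ?case unfolding Uword.simps
  proof (rule Uop_cong_holes[OF Cons.prems(1)])
    fix c assume c: "b < v c" "hole_state B r (insert b (X - {v c})) (v \<circ> transpose (inv v b) c)"
    have sub: "insert b X \<subseteq> insert b (X - {v c})"
    proof
      fix x assume "x \<in> insert b X"
      then have "x \<le> b" using Cons.prems(4)[of x b] by auto
      then show "x \<in> insert b (X - {v c})" using c(1) \<open>x \<in> insert b X\<close> by auto
    qed
    show "Uword B r bs g (v \<circ> transpose (inv v b) c) = Uword B r bs h (v \<circ> transpose (inv v b) c)"
    proof (rule Cons.IH[OF hole_state_mono[OF c(2) sub]])
      show "g v' = h v'" if "hole_state B r (insert b X \<union> set bs) v'" for v'
        using that by (intro Cons.prems(5)) simp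
    qed (use Cons.prems in auto)
  qed (use Cons.prems in simp)
qed

text \<open>The step with label \<open>as ! i\<close> stops at the barrier \<open>bs ! i\<close> at
  the latest. The later barriers remain for the letters that follow, so p passes one letter at a
  time.\<close>

lemma Uop_Uword_commute:
  fixes f :: "(nat \<Rightarrow> nat) \<Rightarrow> 'a::comm_ring_1"
  assumes "length as = length bs" "hole_state B r (set bs) v" "sorted_wrt (<) bs"
    "set as \<subseteq> {1..B}" "set bs \<subseteq> {1..B}" "\<And>i. i < length bs \<Longrightarrow> as ! i < bs ! i"
    "p \<in> {1..B}" "\<And>b. b \<in> set bs \<Longrightarrow> b < p" "r \<le> B"
  shows "Uop B r p (Uword B r as f) v = Uword B r as (Uop B r p f) v"
  using assms
proof (induction as bs arbitrary: v rule: list_induct2)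
  case Nil
  then show ?case by simp
next
  case (Cons a as b bs)
  have ab: "a < b" using Cons.prems(5)[of 0] by simp
  have "Uop B r p (Uword B r (a # as) f) v = Uop B r a (Uop B r p (Uword B r as f)) v"
    unfolding Uword.simps
    by (rule Uop_commute_hole[of B r b]) (use Cons.prems ab in \<open>auto intro: hole_state_mono\<close>)
  also have "\<dots> = Uop B r a (Uword B r as (Uop B r p f)) v"
  proof (rule Uop_cong_holes[OF Cons.prems(1)])
    fix c assume c: "c \<in> {r<..B}" "covers v (inv v a) c" "inv v a \<le> r"
      "hole_state B r (insert a (set (b # bs) - {v c})) (v \<circ> transpose (inv v a) c)"
    have vp: "v permutes {1..B}" "semi_shuffle r v" "r < inv v b"
      using Cons.prems(1) by (auto simp: hole_state_def)
    have va: "v (inv v a) = a" by (rule permutes_inverses(1)[OF vp(1)])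
    have "v c \<le> b"
      by (rule hole_landing[OF vp _ inv_in_range[OF vp(1)] c(3) _ c(1,2)]) (use Cons.prems va ab in auto)
    then have "set bs \<subseteq> insert a (set (b # bs) - {v c})" using Cons.prems(2) by auto
    then show "Uop B r p (Uword B r as f) (v \<circ> transpose (inv v a) c) =
        Uword B r as (Uop B r p f) (v \<circ> transpose (inv v a) c)"
    proof (intro Cons.IH hole_state_mono[OF c(4)])
      show "as ! i < bs ! i" if "i < length bs" for i using Cons.prems(5)[of "Suc i"] that by simp
    qed (use Cons.prems in auto)
  qed (use Cons.prems in simp)
  finally show ?case by simp
qed

lemma Uword_Uword_commute:
  fixes f :: "(nat \<Rightarrow> nat) \<Rightarrow> 'a::comm_ring_1"
  assumes "length as = length bs" "hole_state B r (set bs) v" "sorted_wrt (<) bs"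
    "set as \<subseteq> {1..B}" "set bs \<subseteq> {1..B}" "\<And>i. i < length bs \<Longrightarrow> as ! i < bs ! i"
    "set ps \<subseteq> {1..B}" "\<And>b p. b \<in> set bs \<Longrightarrow> p \<in> set ps \<Longrightarrow> b < p" "r \<le> B"
  shows "Uword B r ps (Uword B r as f) v = Uword B r as (Uword B r ps f) v"
  using assms(2,7,8)
proof (induction ps arbitrary: v)
  case Nil
  then show ?case by simp
next
  case (Cons p ps)
  have "Uword B r (p # ps) (Uword B r as f) v = Uop B r p (Uword B r as (Uword B r ps f)) v"
    unfolding Uword.simps
  proof (rule Uop_cong_holes[OF Cons.prems(1)])
    fix c assume c: "p < v c" "hole_state B r (insert p (set bs - {v c})) (v \<circ> transpose (inv v p) c)"
    have "set bs \<subseteq> insert p (set bs - {v c})"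
    proof
      fix x assume "x \<in> set bs"
      then have "x < p" using Cons.prems(3)[of x p] by simp
      then show "x \<in> insert p (set bs - {v c})" using c(1) \<open>x \<in> set bs\<close> by auto
    qed
    then show "Uword B r ps (Uword B r as f) (v \<circ> transpose (inv v p) c) =
        Uword B r as (Uword B r ps f) (v \<circ> transpose (inv v p) c)"
      by (intro Cons.IH hole_state_mono[OF c(2)]) (use Cons.prems in auto)
  qed (use Cons.prems in simp)
  also have "\<dots> = Uword B r as (Uop B r p (Uword B r ps f)) v"
    by (rule Uop_Uword_commute[OF assms(1) Cons.prems(1) assms(3-6)]) (use Cons.prems assms(9) in auto)
  finally show ?case by simp
qed

text \<open>The steps of \<open>as\<close> stop at barriers below k. So k is still a hole at its
  turn, and the value of a hole stands beyond r and cannot be a label.\<close>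

lemma Uword_blocked:
  fixes f :: "(nat \<Rightarrow> nat) \<Rightarrow> 'a::comm_ring_1"
  assumes "length as = length bs" "hole_state B r (insert k (set bs)) v" "sorted_wrt (<) bs"
    "set as \<subseteq> {1..B}" "set bs \<subseteq> {1..B}" "\<And>i. i < length bs \<Longrightarrow> as ! i < bs ! i"
    "\<And>b. b \<in> set bs \<Longrightarrow> b < k"
  shows "Uword B r as (Uop B r k f) v = 0"
  using assms
proof (induction as bs arbitrary: v rule: list_induct2)
  case Nil
  then show ?case by (simp add: hole_state_def Uop_def)
next
  case (Cons a as b bs)
  have ab: "a < b" using Cons.prems(5)[of 0] by simp
  have "Uword B r (a # as) (Uop B r k f) v = Uop B r a (\<lambda>v. 0) v"
    unfolding Uword.simps
  proof (rule Uop_cong_holes[OF Cons.prems(1)])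
    fix c assume c: "c \<in> {r<..B}" "covers v (inv v a) c" "inv v a \<le> r"
      "hole_state B r (insert a (insert k (set (b # bs)) - {v c})) (v \<circ> transpose (inv v a) c)"
    have vp: "v permutes {1..B}" "semi_shuffle r v" "r < inv v b"
      using Cons.prems(1) by (auto simp: hole_state_def)
    have va: "v (inv v a) = a" by (rule permutes_inverses(1)[OF vp(1)])
    have "v c \<le> b"
      by (rule hole_landing[OF vp _ inv_in_range[OF vp(1)] c(3) _ c(1,2)]) (use Cons.prems va ab in auto)
    moreover have "b < k" using Cons.prems(6) by simp
    ultimately have "insert k (set bs) \<subseteq> insert a (insert k (set (b # bs)) - {v c})"
      using Cons.prems(2) by auto
    then show "Uword B r as (Uop B r k f) (v \<circ> transpose (inv v a) c) = 0"
    proof (intro Cons.IH hole_state_mono[OF c(4)])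
      show "as ! i < bs ! i" if "i < length bs" for i using Cons.prems(5)[of "Suc i"] that by simp
    qed (use Cons.prems in auto)
  qed (use Cons.prems in simp)
  then show ?case by (simp add: Uop_zero)
qed

section \<open>Row configurations and violations of column strictness\<close>

definition rows_word :: "nat set list \<Rightarrow> nat list" where
  "rows_word Rs = concat (map sorted_list_of_set Rs)"

text \<open>\<open>Rs\<close> lists the entry sets of the rows from the bottom row up, so row \<open>Suc i\<close> lies above row \<open>i\<close>.
  Column strictness means that for all \<open>k\<close> row \<open>Suc i\<close> has at least as many entries \<open>< k\<close> as row \<open>i\<close> has
  entries \<open>\<le> k\<close>.\<close>

definition violates :: "nat set list \<Rightarrow> nat \<Rightarrow> nat \<Rightarrow> bool" where
  "violates Rs k i \<longleftrightarrow> Suc i < length Rs \<and> card (Rs ! Suc i \<inter> {..<k}) < card (Rs ! i \<inter> {..k})"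

text \<open>Minimizing k before i makes the choice depend on entries \<le> k only, so it survives
  any change of the larger entries.\<close>

definition first_violation :: "nat set list \<Rightarrow> nat \<Rightarrow> nat \<Rightarrow> bool" where
  "first_violation Rs k i \<longleftrightarrow> violates Rs k i \<and> (\<forall>k'<k. \<forall>j. \<not> violates Rs k' j) \<and> (\<forall>j<i. \<not> violates Rs k j)"

definition row_configs :: "nat \<Rightarrow> nat \<Rightarrow> nat set list set" where
  "row_configs B N = {Rs. length Rs = N \<and> (\<forall>R\<in>set Rs. R \<subseteq> {1..B})}"

lemma sorted_list_of_set_union:
  assumes "finite A" "finite A'" "\<And>a b. a \<in> A \<Longrightarrow> b \<in> A' \<Longrightarrow> a < (b :: nat)"
  shows "sorted_list_of_set (A \<union> A') = sorted_list_of_set A @ sorted_list_of_set A'"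
proof (rule strict_sorted_equal)
  show "sorted_wrt (<) (sorted_list_of_set A @ sorted_list_of_set A')"
    using assms by (simp add: sorted_wrt_append)
qed (use assms in auto)

text \<open>Conversely, the count at k = \<open>ys ! j\<close> provides j + 1 entries of xs below
  \<open>ys ! j\<close>.\<close>

lemma nth_less_iff_card:
  fixes xs ys :: "nat list"
  assumes xs: "sorted_wrt (<) xs" and ys: "sorted_wrt (<) ys"
  shows "(\<forall>j<length ys. j < length xs \<and> xs ! j < ys ! j) \<longleftrightarrow>
    (\<forall>k. card (set ys \<inter> {..k}) \<le> card (set xs \<inter> {..<k}))"
proof
  assume a: "\<forall>j<length ys. j < length xs \<and> xs ! j < ys ! j"
  show "\<forall>k. card (set ys \<inter> {..k}) \<le> card (set xs \<inter> {..<k})"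
  proof
    fix k
    let ?J = "{j. j < length ys \<and> ys ! j \<le> k}"
    have "set ys \<inter> {..k} = (\<lambda>j. ys ! j) ` ?J" by (auto simp: in_set_conv_nth)
    then have "card (set ys \<inter> {..k}) \<le> card ?J" by (simp add: card_image_le)
    also have "\<dots> \<le> card (set xs \<inter> {..<k})"
    proof (rule card_inj_on_le)
      have "distinct xs" using xs by (simp add: strict_sorted_iff)
      then show "inj_on (\<lambda>j. xs ! j) ?J" using a by (auto simp: inj_on_def nth_eq_iff_index_eq)
      show "(\<lambda>j. xs ! j) ` ?J \<subseteq> set xs \<inter> {..<k}" using a by force
    qed simp
    finally show "card (set ys \<inter> {..k}) \<le> card (set xs \<inter> {..<k})" .
  qed
next
  assume a: "\<forall>k. card (set ys \<inter> {..k}) \<le> card (set xs \<inter> {..<k})"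
  show "\<forall>j<length ys. j < length xs \<and> xs ! j < ys ! j"
  proof (intro allI impI)
    fix j assume j: "j < length ys"
    let ?k = "ys ! j"
    have dys: "distinct ys" using ys by (simp add: strict_sorted_iff)
    have "set (take (Suc j) ys) \<subseteq> set ys \<inter> {..?k}"
    proof
      fix y assume "y \<in> set (take (Suc j) ys)"
      then obtain i where i: "i \<le> j" "y = ys ! i" using j by (auto simp: in_set_conv_nth less_Suc_eq_le)
      then have "y \<le> ?k" using sorted_wrt_nth_less[OF ys, of i j] j by (cases "i = j") auto
      then show "y \<in> set ys \<inter> {..?k}" using i j by auto
    qed
    then have "card (set (take (Suc j) ys)) \<le> card (set ys \<inter> {..?k})" by (intro card_mono) auto
    moreover have "card (set (take (Suc j) ys)) = Suc j" using dys j by (simp add: distinct_card)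
    ultimately have c: "Suc j \<le> card (set xs \<inter> {..<?k})" using a[rule_format, of ?k] by linarith
    show "j < length xs \<and> xs ! j < ?k"
    proof (rule ccontr)
      assume n: "\<not> (j < length xs \<and> xs ! j < ?k)"
      have "set xs \<inter> {..<?k} \<subseteq> set (take j xs)"
      proof
        fix x assume x: "x \<in> set xs \<inter> {..<?k}"
        then obtain i where i: "i < length xs" "x = xs ! i" by (auto simp: in_set_conv_nth)
        have "i < j"
        proof (rule ccontr)
          assume "\<not> i < j"
          then have "j < length xs" "xs ! j \<le> xs ! i"
            using i sorted_wrt_nth_less[OF xs, of j i] by (cases "i = j"; auto)+
          then show False using n x i by auto
        qed
        then show "x \<in> set (take j xs)" using i by (auto simp: in_set_conv_nth intro!: exI[of _ i])
      qed
      then have "card (set xs \<inter> {..<?k}) \<le> card (set (take j xs))" by (intro card_mono) auto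
      also have "\<dots> \<le> j" by (rule order_trans[OF card_length]) simp
      finally show False using c by simp
    qed
  qed
qed

section \<open>Exchange of tails at a first violation\<close>

context
  fixes B r k :: nat and hb ha :: "nat set"
  assumes r: "r \<le> B" and k: "k \<in> {1..B}" and hb: "hb \<subseteq> {1..k}" and ha: "ha \<subseteq> {1..k}"
    and kb: "k \<in> hb" and cards: "card (ha \<inter> {..<k}) = card (hb \<inter> {..<k})"
    and dom: "\<And>k'. k' < k \<Longrightarrow> card (hb \<inter> {..k'}) \<le> card (ha \<inter> {..<k'})"
begin

text \<open>\<open>hb\<close> and \<open>ha\<close> are the entries \<le> k of the lower and of the
  upper row at a first violation k; \<open>bs\<close> and \<open>as\<close> leave out k itself. The
  two lists have equal length, and absence of earlier violations makes \<open>as\<close> smaller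
  than \<open>bs\<close> entry by entry.\<close>

private definition "as = sorted_list_of_set (ha \<inter> {..<k})"
private definition "bs = sorted_list_of_set (hb \<inter> {..<k})"

lemma fin_heads: "finite ha" "finite hb"
  using ha hb finite_subset by auto

lemma heads_facts:
  "length as = length bs" "sorted_wrt (<) bs" "set as \<subseteq> {1..B}" "set bs \<subseteq> {1..B}"
  "\<And>b. b \<in> set bs \<Longrightarrow> b < k" "\<And>i. i < length bs \<Longrightarrow> as ! i < bs ! i"
proof -
  note f = fin_heads
  show "length as = length bs" by (simp add: as_def bs_def cards)
  show "sorted_wrt (<) bs" by (simp add: bs_def)
  show "set as \<subseteq> {1..B}" "set bs \<subseteq> {1..B}" using ha hb k f by (auto simp: as_def bs_def)
  show "b < k" if "b \<in> set bs" for b using that f by (simp add: bs_def)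
  have "card (set bs \<inter> {..k'}) \<le> card (set as \<inter> {..<k'})" for k'
  proof (cases "k' < k")
    case True
    then have "set bs \<inter> {..k'} = hb \<inter> {..k'}" "set as \<inter> {..<k'} = ha \<inter> {..<k'}"
      using f by (auto simp: as_def bs_def)
    then show ?thesis using dom[OF True] by simp
  next
    case False
    then have "set bs \<inter> {..k'} = hb \<inter> {..<k}" "set as \<inter> {..<k'} = ha \<inter> {..<k}"
      using f by (auto simp: as_def bs_def)
    then show ?thesis using cards by simp
  qed
  then have "\<forall>i<length bs. i < length as \<and> as ! i < bs ! i"
    by (subst nth_less_iff_card) (simp_all add: as_def bs_def)
  then show "as ! i < bs ! i" if "i < length bs" for i using that by simp
qed

lemma lower_word:
  assumes "P \<subseteq> {Suc k..B}"
  shows "sorted_list_of_set (hb \<union> P) = bs @ k # sorted_list_of_set P"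
proof -
  have fP: "finite P" using assms finite_subset by auto
  have "hb = (hb \<inter> {..<k}) \<union> {k}" using hb kb by force
  then have "sorted_list_of_set hb = bs @ [k]"
    using sorted_list_of_set_union[of "hb \<inter> {..<k}" "{k}"] fin_heads by (simp add: bs_def)
  moreover have "sorted_list_of_set (hb \<union> P) = sorted_list_of_set hb @ sorted_list_of_set P"
    using fin_heads fP hb assms by (intro sorted_list_of_set_union) fastforce+
  ultimately show ?thesis by simp
qed

lemma upper_word:
  assumes "Q \<subseteq> {Suc k..B}"
  shows "sorted_list_of_set (ha \<union> Q) = as @ (if k \<in> ha then [k] else []) @ sorted_list_of_set Q"
proof -
  have fQ: "finite Q" using assms finite_subset by auto
  have "ha \<subseteq> insert k {..<k}" using ha by auto
  then have "ha = (ha \<inter> {..<k}) \<union> (if k \<in> ha then {k} else {})" by auto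
  then have "sorted_list_of_set ha = as @ (if k \<in> ha then [k] else [])"
    using sorted_list_of_set_union[of "ha \<inter> {..<k}" "if k \<in> ha then {k} else {}"] fin_heads
    by (auto simp: as_def split: if_splits)
  moreover have "sorted_list_of_set (ha \<union> Q) = sorted_list_of_set ha @ sorted_list_of_set Q"
    using fin_heads fQ ha assms by (intro sorted_list_of_set_union) fastforce+
  ultimately show ?thesis by simp
qed

text \<open>The head of the lower row creates the holes that serve as barriers for the head of the
  upper row.\<close>

lemma holes_after_lower:
  assumes v: "hole_state B r {} v"
    and eq: "\<And>v'. hole_state B r (insert k (set bs)) v' \<Longrightarrow> g v' = h v'"
  shows "Uword B r (bs @ [k]) g v = Uword B r (bs @ [k]) h v"
proof (rule Uword_cong_new_holes[OF v])
  show "set (bs @ [k]) \<subseteq> {1..B}" using heads_facts(4) k by simp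
  show "sorted_wrt (<) (bs @ [k])" using heads_facts(2,5) by (simp add: sorted_wrt_append)
qed (use eq in auto)

text \<open>The tail P keeps the hole k because its labels are larger, and \<open>as\<close> keeps
  it because its barriers are smaller. So the label k of the upper row cannot be used.\<close>

lemma tails_zero:
  fixes f :: "(nat \<Rightarrow> nat) \<Rightarrow> 'a::comm_ring_1"
  assumes v: "hole_state B r {} v" and P: "P \<subseteq> {Suc k..B}" and Q: "Q \<subseteq> {Suc k..B}" and ka: "k \<in> ha"
  shows "Uword B r (sorted_list_of_set (hb \<union> P) @ sorted_list_of_set (ha \<union> Q)) f v = 0"
proof -
  have fP: "finite P" using P finite_subset by auto
  have "Uword B r (sorted_list_of_set (hb \<union> P) @ sorted_list_of_set (ha \<union> Q)) f v =
    Uword B r (bs @ [k]) (Uword B r (sorted_list_of_set P) (Uword B r as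
      (Uop B r k (Uword B r (sorted_list_of_set Q) f)))) v"
    unfolding lower_word[OF P] upper_word[OF Q] using ka by (simp add: Uword_append)
  also have "\<dots> = Uword B r (bs @ [k]) (\<lambda>_. 0) v"
  proof (rule holes_after_lower[OF v])
    fix v' assume v': "hole_state B r (insert k (set bs)) v'"
    have "Uword B r (sorted_list_of_set P) (Uword B r as (Uop B r k (Uword B r (sorted_list_of_set Q) f))) v' =
      Uword B r (sorted_list_of_set P) (\<lambda>_. 0) v'"
    proof (rule Uword_cong_holes_above[OF v'])
      show "set (sorted_list_of_set P) \<subseteq> {1..B}" using P fP by auto
      show "x < p" if "x \<in> insert k (set bs)" "p \<in> set (sorted_list_of_set P)" for x p
        using that P fP heads_facts(5)[of x] by fastforce
      show "Uword B r as (Uop B r k (Uword B r (sorted_list_of_set Q) f)) u = 0"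
        if "hole_state B r (insert k (set bs)) u" for u
        by (rule Uword_blocked[OF heads_facts(1) that heads_facts(2,3,4,6,5)])
    qed
    then show "Uword B r (sorted_list_of_set P) (Uword B r as (Uop B r k (Uword B r (sorted_list_of_set Q) f))) v' = 0"
      by (simp add: Uword_zero)
  qed
  finally show ?thesis by (simp add: Uword_zero)
qed

text \<open>The tail of the lower row moves past \<open>as\<close>; then the two tails are adjacent
  and add up to two operators \<open>Hop\<close> with the same threshold.\<close>

lemma tails_hop:
  fixes f :: "(nat \<Rightarrow> nat) \<Rightarrow> 'a::comm_ring_1"
  assumes v: "hole_state B r {} v" and ka: "k \<notin> ha"
  shows "(\<Sum>P | P \<subseteq> {Suc k..B} \<and> card P = x. \<Sum>Q | Q \<subseteq> {Suc k..B} \<and> card Q = y.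
      Uword B r (sorted_list_of_set (hb \<union> P) @ sorted_list_of_set (ha \<union> Q)) f v) =
    Uword B r (bs @ [k]) (Uword B r as (Hop B r (Suc k) x (Hop B r (Suc k) y f))) v"
proof -
  let ?T = "\<lambda>x. {P. P \<subseteq> {Suc k..B} \<and> card P = x}"
  have "(\<Sum>P\<in>?T x. \<Sum>Q\<in>?T y. Uword B r (sorted_list_of_set (hb \<union> P) @ sorted_list_of_set (ha \<union> Q)) f v) =
    (\<Sum>P\<in>?T x. \<Sum>Q\<in>?T y. Uword B r (bs @ [k]) (Uword B r (sorted_list_of_set P) (Uword B r as
      (Uword B r (sorted_list_of_set Q) f))) v)"
    by (intro sum.cong refl) (simp add: lower_word upper_word ka Uword_append)
  also have "\<dots> = (\<Sum>P\<in>?T x. \<Sum>Q\<in>?T y. Uword B r (bs @ [k]) (Uword B r as (Uword B r (sorted_list_of_set P)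
      (Uword B r (sorted_list_of_set Q) f))) v)"
  proof (intro sum.cong refl holes_after_lower[OF v])
    fix P Q v' assume P: "P \<in> ?T x" and v': "hole_state B r (insert k (set bs)) v'"
    then have fP: "finite P" "P \<subseteq> {Suc k..B}" using finite_subset by auto
    show "Uword B r (sorted_list_of_set P) (Uword B r as (Uword B r (sorted_list_of_set Q) f)) v' =
        Uword B r as (Uword B r (sorted_list_of_set P) (Uword B r (sorted_list_of_set Q) f)) v'"
    proof (rule Uword_Uword_commute[OF heads_facts(1) hole_state_mono[OF v'] heads_facts(2,3,4,6)])
      show "set (sorted_list_of_set P) \<subseteq> {1..B}" using fP by auto
      show "b < p" if "b \<in> set bs" "p \<in> set (sorted_list_of_set P)" for b p
        using that fP heads_facts(5)[of b] by fastforce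
    qed (use r in auto)
  qed
  also have "\<dots> = Uword B r (bs @ [k]) (Uword B r as (\<lambda>u. \<Sum>P\<in>?T x. Uword B r (sorted_list_of_set P)
      (\<lambda>u'. \<Sum>Q\<in>?T y. Uword B r (sorted_list_of_set Q) f u') u)) v"
    by (simp add: Uword_sum)
  finally show ?thesis by (simp add: Hop_def[abs_def])
qed

text \<open>The offsets e and e' are head sizes plus row indices. They have to agree only when k is
  missing from the upper row, since otherwise both sums are zero.\<close>

lemma tails_symmetric:
  fixes f :: "(nat \<Rightarrow> nat) \<Rightarrow> 'a::comm_ring_1"
  assumes v: "hole_state B r {} v"
    and e: "k \<notin> ha \<Longrightarrow> e = e'"
  shows "(\<Sum>P | P \<subseteq> {Suc k..B} \<and> card P + e = x. \<Sum>Q | Q \<subseteq> {Suc k..B} \<and> card Q + e' = y.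
      Uword B r (sorted_list_of_set (hb \<union> P) @ sorted_list_of_set (ha \<union> Q)) f v) =
    (\<Sum>P | P \<subseteq> {Suc k..B} \<and> card P + e = y. \<Sum>Q | Q \<subseteq> {Suc k..B} \<and> card Q + e' = x.
      Uword B r (sorted_list_of_set (hb \<union> P) @ sorted_list_of_set (ha \<union> Q)) f v)"
proof (cases "k \<in> ha")
  case True
  have "(\<Sum>P | P \<subseteq> {Suc k..B} \<and> card P + e = x. \<Sum>Q | Q \<subseteq> {Suc k..B} \<and> card Q + e' = y.
      Uword B r (sorted_list_of_set (hb \<union> P) @ sorted_list_of_set (ha \<union> Q)) f v) = 0" for x y
    by (intro sum.neutral ballI) (auto intro!: tails_zero[OF v _ _ True])
  then show ?thesis by simp
next
  case False
  then have e': "e' = e" using e by simp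
  have shift: "{P. P \<subseteq> {Suc k..B} \<and> card P + e = x} =
      (if e \<le> x then {P. P \<subseteq> {Suc k..B} \<and> card P = x - e} else {})" for x by auto
  show ?thesis
    unfolding e' shift using False
    by (cases "e \<le> x"; cases "e \<le> y")
      (simp_all add: tails_hop[OF v] Hop_commute[OF r, of "Suc k" "x - e" "y - e"])
qed

end

text \<open>As k - 1 is no violation, the lower row has at most as many entries < k as the upper
  row. The violation at k then has to come from k itself lying in the lower row, with equal counts
  below k.\<close>

lemma first_violation_facts:
  assumes fv: "first_violation Rs k i" and sub: "\<forall>R\<in>set Rs. R \<subseteq> {1..B}" and B: "\<forall>R\<in>set Rs. \<forall>x\<in>R. x \<le> B"
  shows "Suc i < length Rs" "k \<in> Rs ! i" "1 \<le> k"
    "card (Rs ! Suc i \<inter> {..<k}) = card (Rs ! i \<inter> {..<k})"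
    "k' < k \<Longrightarrow> card (Rs ! i \<inter> {..k'}) \<le> card (Rs ! Suc i \<inter> {..<k'})"
proof -
  show len: "Suc i < length Rs" using fv by (simp add: first_violation_def violates_def)
  have R: "Rs ! i \<subseteq> {1..B}" "Rs ! Suc i \<subseteq> {1..B}" using sub len by auto
  have fin: "finite (Rs ! i)" "finite (Rs ! Suc i)" using R finite_subset by auto
  have viol: "card (Rs ! Suc i \<inter> {..<k}) < card (Rs ! i \<inter> {..k})"
    using fv by (simp add: first_violation_def violates_def)
  show ok: "card (Rs ! i \<inter> {..k'}) \<le> card (Rs ! Suc i \<inter> {..<k'})" if "k' < k" for k'
  proof -
    have "\<not> violates Rs k' i" using fv that by (simp add: first_violation_def)
    then show ?thesis using len by (simp add: violates_def not_less)
  qed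
  show k1: "1 \<le> k"
  proof (rule ccontr)
    assume "\<not> 1 \<le> k"
    then have "Rs ! i \<inter> {..k} = {}" using R by auto
    then show False using viol by simp
  qed
  have pred: "card (Rs ! i \<inter> {..<k}) \<le> card (Rs ! Suc i \<inter> {..<k})"
  proof -
    have "Rs ! i \<inter> {..<k} = Rs ! i \<inter> {..k - 1}" using k1 by auto
    also have "card \<dots> \<le> card (Rs ! Suc i \<inter> {..<k - 1})" using k1 by (intro ok) simp
    also have "\<dots> \<le> card (Rs ! Suc i \<inter> {..<k})" using fin by (intro card_mono) auto
    finally show ?thesis .
  qed
  have split: "Rs ! i \<inter> {..k} = (if k \<in> Rs ! i then insert k (Rs ! i \<inter> {..<k}) else Rs ! i \<inter> {..<k})"
  proof -
    have "{..k} = insert k {..<k}" by auto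
    then show ?thesis by auto
  qed
  show "k \<in> Rs ! i"
  proof (rule ccontr)
    assume "k \<notin> Rs ! i"
    then show False using split viol pred by simp
  qed
  then have "card (Rs ! i \<inter> {..k}) = Suc (card (Rs ! i \<inter> {..<k}))" using split fin by simp
  then show "card (Rs ! Suc i \<inter> {..<k}) = card (Rs ! i \<inter> {..<k})" using viol pred by simp
qed

lemma first_violation_cong:
  assumes "length Rs = length Rs'" "\<And>j. j < length Rs \<Longrightarrow> Rs ! j \<inter> {..k} = Rs' ! j \<inter> {..k}"
  shows "first_violation Rs k i \<longleftrightarrow> first_violation Rs' k i"
proof -
  have "violates Rs k' j \<longleftrightarrow> violates Rs' k' j" if "k' \<le> k" for k' j
  proof (cases "Suc j < length Rs")
    case True
    have "A \<inter> {..k'} = A \<inter> {..k} \<inter> {..k'}" "A \<inter> {..<k'} = A \<inter> {..k} \<inter> {..<k'}" for A :: "nat set"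
      using that by auto
    then have "Rs ! l \<inter> {..k'} = Rs' ! l \<inter> {..k'}" "Rs ! l \<inter> {..<k'} = Rs' ! l \<inter> {..<k'}"
      if "l < length Rs" for l using assms(2)[OF that] by metis+
    then show ?thesis using True assms(1) by (simp add: violates_def)
  qed (use assms(1) in \<open>simp add: violates_def\<close>)
  then show ?thesis by (simp add: first_violation_def)
qed

lemma finite_row_configs: "finite (row_configs B N)"
proof -
  have "row_configs B N = {Rs. set Rs \<subseteq> Pow {1..B} \<and> length Rs = N}" by (auto simp: row_configs_def)
  then show ?thesis by (simp add: finite_lists_length_eq)
qed

section \<open>Sign-reversing cancellation\<close>

lemma sum_sign_cancel:
  fixes F :: "(nat \<Rightarrow> nat) \<Rightarrow> 'a::comm_ring_1"
  assumes i: "Suc i < N" and F: "\<And>\<pi>. \<pi> permutes {..<N} \<Longrightarrow> F (\<pi> \<circ> transpose i (Suc i)) = F \<pi>"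
  shows "(\<Sum>\<pi> | \<pi> permutes {..<N}. of_int (sign \<pi>) * F \<pi>) = 0"
proof -
  let ?t = "transpose i (Suc i)"
  let ?A = "{\<pi>. \<pi> permutes {..<N} \<and> \<pi> i < \<pi> (Suc i)}"
  let ?D = "{\<pi>. \<pi> permutes {..<N} \<and> \<pi> (Suc i) < \<pi> i}"
  have t: "?t permutes {..<N}" using i by (intro permutes_swap_id) auto
  have fin: "finite {\<pi>. \<pi> permutes {..<N}}" by (intro finite_permutations) simp
  have "\<pi> i \<noteq> \<pi> (Suc i)" if "\<pi> permutes {..<N}" for \<pi>
    using injD[OF permutes_inj[OF that], of i "Suc i"] by auto
  then have split: "{\<pi>. \<pi> permutes {..<N}} = ?A \<union> ?D" by (auto simp: neq_iff)
  have "(\<Sum>\<pi>\<in>?D. of_int (sign \<pi>) * F \<pi>) = (\<Sum>\<pi>\<in>?A. - (of_int (sign \<pi>) * F \<pi>))"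
  proof (rule sum.reindex_bij_witness[of _ "\<lambda>\<pi>. \<pi> \<circ> ?t" "\<lambda>\<pi>. \<pi> \<circ> ?t"])
    fix \<pi> assume "\<pi> \<in> ?D"
    then have \<pi>: "\<pi> permutes {..<N}" "\<pi> (Suc i) < \<pi> i" by auto
    show "\<pi> \<circ> ?t \<circ> ?t = \<pi>" by (simp add: comp_assoc)
    show "\<pi> \<circ> ?t \<in> ?A" using \<pi> t by (simp add: permutes_compose)
    have "sign (\<pi> \<circ> ?t) = - sign \<pi>"
      using permutes_imp_permutation[OF _ \<pi>(1)] permutes_imp_permutation[OF _ t]
      by (simp add: sign_compose sign_swap_id)
    then show "- (of_int (sign (\<pi> \<circ> ?t)) * F (\<pi> \<circ> ?t)) = of_int (sign \<pi>) * F \<pi>"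
      using F[OF \<pi>(1)] by simp
  next
    fix \<pi> assume "\<pi> \<in> ?A"
    then have \<pi>: "\<pi> permutes {..<N}" "\<pi> i < \<pi> (Suc i)" by auto
    show "\<pi> \<circ> ?t \<circ> ?t = \<pi>" by (simp add: comp_assoc)
    show "\<pi> \<circ> ?t \<in> ?D" using \<pi> t by (simp add: permutes_compose)
  qed
  moreover have "(\<Sum>\<pi>\<in>?A \<union> ?D. of_int (sign \<pi>) * F \<pi>) =
      (\<Sum>\<pi>\<in>?A. of_int (sign \<pi>) * F \<pi>) + (\<Sum>\<pi>\<in>?D. of_int (sign \<pi>) * F \<pi>)"
  proof (rule sum.union_disjoint)
    show "finite ?A" "finite ?D" by (rule finite_subset[OF _ fin], auto)+
  qed auto
  ultimately show ?thesis unfolding split by (simp add: sum_negf)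
qed

text \<open>Row j has length \<beta> (\<pi> j) - j, the index of the j-th factor in the Jacobi-Trudi
  term of \<pi>. The additive form makes negative lengths impossible instead of truncating
  them.\<close>

definition violating_configs ::
    "nat \<Rightarrow> nat \<Rightarrow> (nat \<Rightarrow> nat) \<Rightarrow> nat \<Rightarrow> nat \<Rightarrow> (nat \<Rightarrow> nat) \<Rightarrow> nat set list set" where
  "violating_configs B N \<beta> k i \<pi> = {Rs \<in> row_configs B N. first_violation Rs k i \<and>
     (\<forall>j<N. card (Rs ! j) + j = \<beta> (\<pi> j))}"

text \<open>What remains of a violating configuration when the entries \<open>> k\<close> of the rows \<open>i\<close> and \<open>Suc i\<close> are
  forgotten; the exchange of tails takes place over a fixed truncation.\<close>

definition truncated_configs ::
    "nat \<Rightarrow> nat \<Rightarrow> (nat \<Rightarrow> nat) \<Rightarrow> nat \<Rightarrow> nat \<Rightarrow> (nat \<Rightarrow> nat) \<Rightarrow> nat set list set" where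
  "truncated_configs B N \<beta> k i \<pi> = {H \<in> row_configs B N. H ! i \<subseteq> {..k} \<and> H ! Suc i \<subseteq> {..k} \<and>
     first_violation H k i \<and> (\<forall>j<N. j \<noteq> i \<and> j \<noteq> Suc i \<longrightarrow> card (H ! j) + j = \<beta> (\<pi> j))}"

lemma row_configs_nth: "Rs \<in> row_configs B N \<Longrightarrow> j < N \<Longrightarrow> Rs ! j \<subseteq> {1..B}"
  by (simp add: row_configs_def)

lemma row_configs_update:
  "Rs \<in> row_configs B N \<Longrightarrow> R \<subseteq> {1..B} \<Longrightarrow> Rs[j := R] \<in> row_configs B N"
  unfolding row_configs_def using set_update_subset_insert[of Rs j R] by auto

lemma sum_violating_configs:
  fixes f :: "nat set list \<Rightarrow> 'a::comm_ring_1"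
  assumes i: "Suc i < N" and k: "k \<le> B"
  shows "(\<Sum>Rs\<in>violating_configs B N \<beta> k i \<pi>. f Rs) =
    (\<Sum>H\<in>truncated_configs B N \<beta> k i \<pi>.
      \<Sum>P | P \<subseteq> {Suc k..B} \<and> card P + (card (H ! i) + i) = \<beta> (\<pi> i).
      \<Sum>Q | Q \<subseteq> {Suc k..B} \<and> card Q + (card (H ! Suc i) + Suc i) = \<beta> (\<pi> (Suc i)).
        f (H[i := H ! i \<union> P, Suc i := H ! Suc i \<union> Q]))"
proof -
  let ?P = "\<lambda>H. {P. P \<subseteq> {Suc k..B} \<and> card P + (card (H ! i) + i) = \<beta> (\<pi> i)}"
  let ?Q = "\<lambda>H. {Q. Q \<subseteq> {Suc k..B} \<and> card Q + (card (H ! Suc i) + Suc i) = \<beta> (\<pi> (Suc i))}"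
  let ?X = "truncated_configs B N \<beta> k i \<pi>"
  let ?upd = "\<lambda>H A A'. H[i := A, Suc i := A']"
  define join where "join s = ?upd (fst s) (fst s ! i \<union> fst (snd s)) (fst s ! Suc i \<union> snd (snd s))"
    for s :: "nat set list \<times> nat set \<times> nat set"
  define cut_at where "cut_at Rs = (?upd Rs (Rs ! i \<inter> {..k}) (Rs ! Suc i \<inter> {..k}),
    (Rs ! i \<inter> {Suc k..}, Rs ! Suc i \<inter> {Suc k..}))" for Rs :: "nat set list"
  have finPQ: "finite (?P H)" "finite (?Q H)" for H
    by (rule finite_subset[of _ "Pow {Suc k..B}"]; auto)+
  have finX: "finite ?X"
    by (rule finite_subset[OF _ finite_row_configs[of B N]]) (auto simp: truncated_configs_def)
  have len: "length H = N" if "H \<in> row_configs B N" for H using that by (simp add: row_configs_def)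
  have nth_upd: "?upd H A A' ! i = A" "?upd H A A' ! Suc i = A'"
    "j \<noteq> i \<Longrightarrow> j \<noteq> Suc i \<Longrightarrow> ?upd H A A' ! j = H ! j" if "length H = N" for H A A' j
    using that i by auto
  have "(\<Sum>H\<in>?X. \<Sum>P\<in>?P H. \<Sum>Q\<in>?Q H. f (?upd H (H ! i \<union> P) (H ! Suc i \<union> Q))) =
      (\<Sum>H\<in>?X. \<Sum>p\<in>?P H \<times> ?Q H. f (?upd H (H ! i \<union> fst p) (H ! Suc i \<union> snd p)))"
    by (simp add: sum.cartesian_product split_def)
  also have "\<dots> = (\<Sum>s\<in>Sigma ?X (\<lambda>H. ?P H \<times> ?Q H). f (join s))"
    using finX finPQ by (subst sum.Sigma) (simp_all add: split_def join_def)
  also have "\<dots> = (\<Sum>Rs\<in>violating_configs B N \<beta> k i \<pi>. f Rs)"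
  proof (rule sum.reindex_bij_witness[of _ cut_at join])
    fix s assume "s \<in> Sigma ?X (\<lambda>H. ?P H \<times> ?Q H)"
    then obtain H P Q where s: "s = (H, (P, Q))" and H: "H \<in> ?X" and P: "P \<in> ?P H" and Q: "Q \<in> ?Q H"
      by (cases s) auto
    have Hr: "H \<in> row_configs B N" and Hs: "H ! i \<subseteq> {..k}" "H ! Suc i \<subseteq> {..k}" "first_violation H k i"
      and Hc: "\<And>j. j < N \<Longrightarrow> j \<noteq> i \<Longrightarrow> j \<noteq> Suc i \<Longrightarrow> card (H ! j) + j = \<beta> (\<pi> j)"
      using H by (auto simp: truncated_configs_def)
    note lH = len[OF Hr]
    define R0 where "R0 = ?upd H (H ! i \<union> P) (H ! Suc i \<union> Q)"
    have join_s: "join s = R0" by (simp add: join_def s R0_def)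
    have R: "R0 ! i = H ! i \<union> P" "R0 ! Suc i = H ! Suc i \<union> Q" "\<And>j. j \<noteq> i \<Longrightarrow> j \<noteq> Suc i \<Longrightarrow> R0 ! j = H ! j"
      using nth_upd[OF lH] by (auto simp: R0_def)
    have subs: "H ! i \<subseteq> {1..B}" "H ! Suc i \<subseteq> {1..B}" using row_configs_nth[OF Hr] i by auto
    have PQ: "P \<subseteq> {Suc k..B}" "Q \<subseteq> {Suc k..B}" using P Q by auto
    have fin: "finite P" "finite Q" "finite (H ! i)" "finite (H ! Suc i)"
      using PQ subs by (meson finite_subset finite_atLeastAtMost)+
    have cut: "(H ! i \<union> P) \<inter> {..k} = H ! i" "(H ! Suc i \<union> Q) \<inter> {..k} = H ! Suc i"
      "(H ! i \<union> P) \<inter> {Suc k..} = P" "(H ! Suc i \<union> Q) \<inter> {Suc k..} = Q"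
      using Hs(1,2) PQ by fastforce+
    have "?upd R0 (H ! i) (H ! Suc i) = H"
    proof (rule nth_equalityI)
      fix j assume "j < length (?upd R0 (H ! i) (H ! Suc i))"
      then show "?upd R0 (H ! i) (H ! Suc i) ! j = H ! j"
        using lH i by (cases "j = i"; cases "j = Suc i") (auto simp: R0_def)
    qed (simp add: R0_def)
    then have "cut_at R0 = s" by (simp add: cut_at_def R(1,2) cut s)
    then show "cut_at (join s) = s" by (simp only: join_s)
    have "R0 \<in> row_configs B N" unfolding R0_def using Hr subs PQ k by (intro row_configs_update) auto
    moreover have "first_violation R0 k i"
    proof (subst first_violation_cong[of R0 H])
      show "R0 ! j \<inter> {..k} = H ! j \<inter> {..k}" for j
      proof -
        have "H ! i \<inter> {..k} = H ! i" "H ! Suc i \<inter> {..k} = H ! Suc i" using Hs(1,2) by auto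
        then show ?thesis using R(3)[of j] cut(1,2) by (cases "j = i"; cases "j = Suc i") (simp_all add: R(1,2))
      qed
    qed (use Hs in \<open>simp_all add: R0_def\<close>)
    moreover have "card (R0 ! j) + j = \<beta> (\<pi> j)" if "j < N" for j
    proof -
      have "H ! i \<inter> P = {}" "H ! Suc i \<inter> Q = {}" using Hs(1,2) PQ by fastforce+
      then have "card (H ! i \<union> P) = card (H ! i) + card P" "card (H ! Suc i \<union> Q) = card (H ! Suc i) + card Q"
        using fin by (simp_all add: card_Un_disjoint)
      then show ?thesis using P Q Hc[OF that] R(3)[of j] by (cases "j = i"; cases "j = Suc i") (simp_all add: R(1,2))
    qed
    ultimately show "join s \<in> violating_configs B N \<beta> k i \<pi>"
      unfolding join_s by (simp add: violating_configs_def)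
  next
    fix Rs assume "Rs \<in> violating_configs B N \<beta> k i \<pi>"
    then have Rr: "Rs \<in> row_configs B N" and Rv: "first_violation Rs k i"
      and Rc: "\<And>j. j < N \<Longrightarrow> card (Rs ! j) + j = \<beta> (\<pi> j)"
      by (auto simp: violating_configs_def)
    note lR = len[OF Rr]
    define H where "H = ?upd Rs (Rs ! i \<inter> {..k}) (Rs ! Suc i \<inter> {..k})"
    have cut_Rs: "cut_at Rs = (H, (Rs ! i \<inter> {Suc k..}, Rs ! Suc i \<inter> {Suc k..}))"
      by (simp add: cut_at_def H_def)
    have Hn: "H ! i = Rs ! i \<inter> {..k}" "H ! Suc i = Rs ! Suc i \<inter> {..k}"
      "\<And>j. j \<noteq> i \<Longrightarrow> j \<noteq> Suc i \<Longrightarrow> H ! j = Rs ! j"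
      using nth_upd[OF lR] by (auto simp: H_def)
    have subs: "Rs ! i \<subseteq> {1..B}" "Rs ! Suc i \<subseteq> {1..B}" using row_configs_nth[OF Rr] i by auto
    have glue: "A \<inter> {..k} \<union> A \<inter> {Suc k..} = A" for A by auto
    have cards: "card (A \<inter> {Suc k..}) + card (A \<inter> {..k}) = card A" if "A \<subseteq> {1..B}" for A
    proof -
      have "finite A" using that finite_subset by auto
      moreover have "A \<inter> {Suc k..} \<inter> (A \<inter> {..k}) = {}" by auto
      ultimately have "card (A \<inter> {Suc k..} \<union> A \<inter> {..k}) = card (A \<inter> {Suc k..}) + card (A \<inter> {..k})"
        by (intro card_Un_disjoint) auto
      moreover have "A \<inter> {Suc k..} \<union> A \<inter> {..k} = A" by auto
      ultimately show ?thesis by simp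
    qed
    have "?upd H (Rs ! i) (Rs ! Suc i) = Rs"
    proof (rule nth_equalityI)
      fix j assume "j < length (?upd H (Rs ! i) (Rs ! Suc i))"
      then show "?upd H (Rs ! i) (Rs ! Suc i) ! j = Rs ! j"
        using lR i by (cases "j = i"; cases "j = Suc i") (auto simp: H_def)
    qed (simp add: H_def)
    then show "join (cut_at Rs) = Rs" by (simp add: cut_Rs join_def Hn(1,2) glue)
    have Hr: "H \<in> row_configs B N" unfolding H_def using Rr subs by (intro row_configs_update) auto
    have "first_violation H k i"
    proof (subst first_violation_cong[of H Rs])
      show "H ! j \<inter> {..k} = Rs ! j \<inter> {..k}" for j
        using Hn(3)[of j] by (cases "j = i"; cases "j = Suc i") (simp_all add: Hn(1,2) Int_assoc)
    qed (use Rv in \<open>simp_all add: H_def\<close>)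
    then have "H \<in> ?X" using Hr Rc Hn by (auto simp: truncated_configs_def)
    moreover have "Rs ! i \<inter> {Suc k..} \<in> ?P H" "Rs ! Suc i \<inter> {Suc k..} \<in> ?Q H"
      using cards[OF subs(1)] cards[OF subs(2)] Rc[of i] Rc[of "Suc i"] i subs unfolding Hn(1,2) by auto
    ultimately show "cut_at Rs \<in> Sigma ?X (\<lambda>H. ?P H \<times> ?Q H)"
      unfolding cut_Rs by blast
  qed simp
  finally show ?thesis ..
qed

lemma rows_word_update:
  assumes "Suc i < length H"
  shows "rows_word (H[i := A, Suc i := A']) = rows_word (take i H) @
    (sorted_list_of_set A @ sorted_list_of_set A') @ rows_word (drop (Suc (Suc i)) H)"
proof -
  define xs where "xs = take i H"
  define zs where "zs = drop (Suc (Suc i)) H"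
  have "H = xs @ H ! i # H ! Suc i # zs"
    using assms by (simp add: xs_def zs_def Cons_nth_drop_Suc)
  then obtain x y where H: "H = xs @ x # y # zs" by blast
  have i: "i = length xs" using assms by (simp add: xs_def)
  have "H[i := A, Suc i := A'] = xs @ [A, A'] @ zs"
    unfolding H i by (simp add: list_update_append)
  then show ?thesis by (simp add: rows_word_def xs_def zs_def)
qed

text \<open>Composing \<pi> with the transposition of i and i + 1 exchanges the targets of these two
  rows only. Over each truncation this exchanges the two tail lengths, up to the offsets in
  \<open>tails_symmetric\<close>.\<close>

lemma violating_sum_symmetric:
  fixes g :: "(nat \<Rightarrow> nat) \<Rightarrow> 'a::comm_ring_1"
  assumes w: "hole_state B r {} w" and r: "r \<le> B" and i: "Suc i < N" and k: "k \<le> B"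
  shows "(\<Sum>Rs\<in>violating_configs B N \<beta> k i (\<pi> \<circ> transpose i (Suc i)). Uword B r (rows_word Rs) g w) =
    (\<Sum>Rs\<in>violating_configs B N \<beta> k i \<pi>. Uword B r (rows_word Rs) g w)"
proof -
  let ?\<pi>' = "\<pi> \<circ> transpose i (Suc i)"
  have X: "truncated_configs B N \<beta> k i ?\<pi>' = truncated_configs B N \<beta> k i \<pi>"
    by (auto simp: truncated_configs_def transpose_def)
  have \<pi>': "?\<pi>' i = \<pi> (Suc i)" "?\<pi>' (Suc i) = \<pi> i" by simp_all
  let ?S = "\<lambda>H x y. \<Sum>P | P \<subseteq> {Suc k..B} \<and> card P + (card (H ! i) + i) = x.
      \<Sum>Q | Q \<subseteq> {Suc k..B} \<and> card Q + (card (H ! Suc i) + Suc i) = y.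
      Uword B r (rows_word (H[i := H ! i \<union> P, Suc i := H ! Suc i \<union> Q])) g w"
  have sym: "?S H x y = ?S H y x" if H: "H \<in> truncated_configs B N \<beta> k i \<pi>" for H x y
  proof -
    have Hr: "H \<in> row_configs B N" and Hs: "H ! i \<subseteq> {..k}" "H ! Suc i \<subseteq> {..k}" and fv: "first_violation H k i"
      using H by (auto simp: truncated_configs_def)
    have lH: "length H = N" "\<forall>R\<in>set H. R \<subseteq> {1..B}" using Hr by (auto simp: row_configs_def)
    have facts: "H ! i \<subseteq> {1..k}" "H ! Suc i \<subseteq> {1..k}"
      using Hs row_configs_nth[OF Hr, of i] row_configs_nth[OF Hr, of "Suc i"] i by fastforce+
    have ks: "\<forall>R\<in>set H. \<forall>x\<in>R. x \<le> B" using lH(2) by fastforce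
    note fvf = first_violation_facts[OF fv lH(2) ks]
    have kB: "k \<in> {1..B}" using fvf(3) k by simp
    let ?W = "\<lambda>P Q. sorted_list_of_set (H ! i \<union> P) @ sorted_list_of_set (H ! Suc i \<union> Q)"
    let ?f = "Uword B r (rows_word (drop (Suc (Suc i)) H)) g"
    let ?pre = "rows_word (take i H)"
    let ?G = "\<lambda>x y v. \<Sum>P | P \<subseteq> {Suc k..B} \<and> card P + (card (H ! i) + i) = x.
      \<Sum>Q | Q \<subseteq> {Suc k..B} \<and> card Q + (card (H ! Suc i) + Suc i) = y. Uword B r (?W P Q) ?f v"
    have S: "?S H x y = Uword B r ?pre (?G x y) w" for x y
      using i lH(1) by (simp add: rows_word_update Uword_append Uword_sum)
    have "Uword B r ?pre (?G x y) w = Uword B r ?pre (?G y x) w"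
    proof (rule Uword_cong_holes_above[OF w])
      show "set ?pre \<subseteq> {1..B}"
      proof
        fix x assume "x \<in> set ?pre"
        then obtain R where R: "R \<in> set (take i H)" "x \<in> set (sorted_list_of_set R)" by (auto simp: rows_word_def)
        have RB: "R \<subseteq> {1..B}" using lH(2) in_set_takeD[OF R(1)] by blast
        then have "finite R" by (rule finite_subset) simp
        then show "x \<in> {1..B}" using R(2) RB by auto
      qed
      fix v assume v: "hole_state B r {} v"
      show "?G x y v = ?G y x v"
      proof (rule tails_symmetric[OF r kB facts fvf(2,4,5) v])
        \<comment> \<open>The lower head has one entry more than the upper head, namely k; this
          compensates the shift of the row index by one.\<close>
        assume "k \<notin> H ! Suc i"
        have "{..k} = insert k {..<k}" by auto
        then have "H ! i \<subseteq> insert k {..<k}" "H ! Suc i \<subseteq> insert k {..<k}" using Hs(1,2) by auto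
        then have eqs: "insert k (H ! i \<inter> {..<k}) = H ! i" "H ! Suc i \<inter> {..<k} = H ! Suc i"
          using fvf(2) \<open>k \<notin> H ! Suc i\<close> by blast+
        have "finite (H ! i \<inter> {..<k})" by simp
        then have "card (insert k (H ! i \<inter> {..<k})) = Suc (card (H ! i \<inter> {..<k}))" by simp
        then have "card (H ! i) = Suc (card (H ! Suc i))" using fvf(4) unfolding eqs by simp
        then show "card (H ! i) + i = card (H ! Suc i) + Suc i" by simp
      qed
    qed auto
    then show ?thesis unfolding S .
  qed
  show ?thesis
    unfolding sum_violating_configs[OF i k] X \<pi>' by (intro sum.cong refl sym)
qed

lemma first_violation_exists:
  assumes Rs: "Rs \<in> row_configs B N" and v: "violates Rs k i"
  shows "\<exists>k0 i0. k0 \<le> B \<and> Suc i0 < N \<and> first_violation Rs k0 i0"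
proof -
  have len: "length Rs = N" using Rs by (simp add: row_configs_def)
  have "\<exists>k'\<le>B. violates Rs k' i"
  proof (cases "k \<le> B")
    \<comment> \<open>No entry exceeds B, so a violation beyond B is already one at B.\<close>
    case False
    have i: "Suc i < N" using v len by (simp add: violates_def)
    have R: "Rs ! i \<subseteq> {1..B}" "Rs ! Suc i \<subseteq> {1..B}" using row_configs_nth[OF Rs] i by auto
    have fin: "finite (Rs ! Suc i)" using R(2) by (rule finite_subset) simp
    have "card (Rs ! Suc i \<inter> {..<B}) \<le> card (Rs ! Suc i)" using fin by (intro card_mono) auto
    moreover have "Rs ! i \<inter> {..k} = Rs ! i \<inter> {..B}" "Rs ! Suc i \<inter> {..<k} = Rs ! Suc i"
      using R False by fastforce+
    ultimately have "violates Rs B i" using v by (simp add: violates_def)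
    then show ?thesis by blast
  qed (use v in blast)
  then obtain k' where k': "k' \<le> B" "violates Rs k' i" by blast
  define k0 where "k0 = (LEAST k. \<exists>i. violates Rs k i)"
  have ex: "\<exists>i. violates Rs k0 i" unfolding k0_def by (rule LeastI[of _ k']) (use k' in blast)
  have "k0 \<le> k'" unfolding k0_def by (rule Least_le) (use k' in blast)
  have min: "\<not> violates Rs k'' j" if "k'' < k0" for k'' j
    using not_less_Least[of k'' "\<lambda>k. \<exists>i. violates Rs k i"] that unfolding k0_def by blast
  define i0 where "i0 = (LEAST i. violates Rs k0 i)"
  have vi: "violates Rs k0 i0" unfolding i0_def using ex by (rule LeastI_ex)
  have "\<not> violates Rs k0 j" if "j < i0" for j using not_less_Least[of j "violates Rs k0"] that unfolding i0_def by blast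
  then have "first_violation Rs k0 i0" using vi min by (simp add: first_violation_def)
  moreover have "Suc i0 < N" using vi len by (simp add: violates_def)
  ultimately show ?thesis using \<open>k0 \<le> k'\<close> k' by (meson le_trans)
qed

lemma first_violation_unique:
  assumes "first_violation Rs k i" "first_violation Rs k' i'"
  shows "k = k' \<and> i = i'"
  using assms unfolding first_violation_def by (metis linorder_neqE_nat)

lemma permutes_lessThan_id:
  fixes \<pi> :: "nat \<Rightarrow> nat"
  assumes \<pi>: "\<pi> permutes {..<N}" and mono: "\<And>i. Suc i < N \<Longrightarrow> \<pi> i < \<pi> (Suc i)"
  shows "\<pi> = id"
proof (rule strict_mono_permutes_id[OF \<pi>])
  show "strict_mono \<pi>"
    unfolding strict_mono_Suc_iff
  proof
    fix i
    show "\<pi> i < \<pi> (Suc i)"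
    proof (cases "Suc i < N")
      case False
      then have "\<pi> (Suc i) = Suc i" using permutes_not_in[OF \<pi>] by simp
      moreover have "\<pi> i < Suc i"
        using permutes_in_image[OF \<pi>, of i] permutes_not_in[OF \<pi>, of i] False by (cases "i < N") auto
      ultimately show ?thesis by simp
    qed (rule mono)
  qed
qed

definition sized_configs :: "nat \<Rightarrow> nat \<Rightarrow> (nat \<Rightarrow> nat) \<Rightarrow> nat set list set" where
  "sized_configs B N s = {Rs \<in> row_configs B N. \<forall>j<N. card (Rs ! j) + j = s j}"

definition good_configs :: "nat \<Rightarrow> nat \<Rightarrow> (nat \<Rightarrow> nat) \<Rightarrow> nat set list set" where
  "good_configs B N s = {Rs \<in> sized_configs B N s. \<forall>k i. \<not> violates Rs k i}"

lemma sum_sized_configs: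
  "(\<Sum>Rs\<in>sized_configs B N (\<beta> \<circ> \<pi>). f Rs) = (\<Sum>Rs\<in>good_configs B N (\<beta> \<circ> \<pi>). f Rs) +
    (\<Sum>(k, i)\<in>{..B} \<times> {i. Suc i < N}. \<Sum>Rs\<in>violating_configs B N \<beta> k i \<pi>. f Rs)"
proof -
  let ?I = "{..B} \<times> {i. Suc i < N}"
  let ?V = "\<lambda>p. violating_configs B N \<beta> (fst p) (snd p) \<pi>"
  have finI: "finite ?I"
  proof -
    have "{i. Suc i < N} \<subseteq> {..N}" by auto
    then show ?thesis using finite_subset by blast
  qed
  have fin: "finite (sized_configs B N s)" for s
    by (rule finite_subset[OF _ finite_row_configs[of B N]]) (auto simp: sized_configs_def)
  have finV: "finite (?V p)" for p
    by (rule finite_subset[OF _ finite_row_configs[of B N]]) (auto simp: violating_configs_def)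
  have eq: "sized_configs B N (\<beta> \<circ> \<pi>) = good_configs B N (\<beta> \<circ> \<pi>) \<union> (\<Union>p\<in>?I. ?V p)"
  proof (intro equalityI subsetI)
    fix Rs assume Rs: "Rs \<in> sized_configs B N (\<beta> \<circ> \<pi>)"
    then have Rr: "Rs \<in> row_configs B N" by (simp add: sized_configs_def)
    show "Rs \<in> good_configs B N (\<beta> \<circ> \<pi>) \<union> (\<Union>p\<in>?I. ?V p)"
    proof (cases "\<exists>k i. violates Rs k i")
      case True
      then obtain k i where "k \<le> B" "Suc i < N" "first_violation Rs k i"
        using first_violation_exists[OF Rr] by blast
      then have "(k, i) \<in> ?I" "Rs \<in> ?V (k, i)"
        using Rs by (auto simp: violating_configs_def sized_configs_def)
      then show ?thesis by blast
    qed (use Rs in \<open>simp add: good_configs_def\<close>)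
  qed (auto simp: good_configs_def violating_configs_def sized_configs_def)
  have "(\<Sum>Rs\<in>sized_configs B N (\<beta> \<circ> \<pi>). f Rs) =
      (\<Sum>Rs\<in>good_configs B N (\<beta> \<circ> \<pi>). f Rs) + (\<Sum>Rs\<in>(\<Union>p\<in>?I. ?V p). f Rs)"
    unfolding eq
  proof (rule sum.union_disjoint)
    show "finite (good_configs B N (\<beta> \<circ> \<pi>))"
      by (rule finite_subset[OF _ fin]) (auto simp: good_configs_def)
    show "finite (\<Union>p\<in>?I. ?V p)" using finI finV by blast
    show "good_configs B N (\<beta> \<circ> \<pi>) \<inter> (\<Union>p\<in>?I. ?V p) = {}"
      by (auto simp: good_configs_def violating_configs_def first_violation_def)
  qed
  also have "(\<Sum>Rs\<in>(\<Union>p\<in>?I. ?V p). f Rs) = (\<Sum>p\<in>?I. \<Sum>Rs\<in>?V p. f Rs)"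
  proof (rule sum.UNION_disjoint[OF finI])
    show "\<forall>p\<in>?I. finite (?V p)" using finV by blast
    show "\<forall>p\<in>?I. \<forall>q\<in>?I. p \<noteq> q \<longrightarrow> ?V p \<inter> ?V q = {}"
    proof (intro ballI impI)
      fix p q assume "p \<in> ?I" "q \<in> ?I" "p \<noteq> (q :: nat \<times> nat)"
      then show "?V p \<inter> ?V q = {}"
        using first_violation_unique by (fastforce simp: violating_configs_def prod_eq_iff)
    qed
  qed
  finally show ?thesis by (simp only: split_def)
qed

text \<open>The threshold k = B + 1 counts whole rows, so without a violation there the upper row is
  at least as long; the added row index makes the inequality strict.\<close>

lemma good_configs_sorted:
  assumes "Rs \<in> good_configs B N s" "Suc i < N"
  shows "s i < s (Suc i)"
proof -
  have Rs: "Rs \<in> row_configs B N" "\<And>j. j < N \<Longrightarrow> card (Rs ! j) + j = s j" "\<not> violates Rs (Suc B) i"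
    using assms(1) by (auto simp: good_configs_def sized_configs_def)
  have R: "Rs ! i \<subseteq> {1..B}" "Rs ! Suc i \<subseteq> {1..B}" using row_configs_nth[OF Rs(1)] assms(2) by auto
  then have "Rs ! i \<inter> {..Suc B} = Rs ! i" "Rs ! Suc i \<inter> {..<Suc B} = Rs ! Suc i" by fastforce+
  moreover have "length Rs = N" using Rs(1) by (simp add: row_configs_def)
  ultimately have "card (Rs ! i) \<le> card (Rs ! Suc i)" using Rs(3) assms(2) by (simp add: violates_def not_less)
  then show ?thesis using Rs(2)[of i] Rs(2)[of "Suc i"] assms(2) by simp
qed

text \<open>For each possible first violation (k, i) the terms of \<pi> and of its composition with
  the transposition of i and i + 1 cancel. Configurations without violation need increasing values
  of \<beta> along \<pi>, which leaves the identity.\<close>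

lemma sign_reversal:
  fixes g :: "(nat \<Rightarrow> nat) \<Rightarrow> 'a::comm_ring_1"
  assumes w: "hole_state B r {} w" and r: "r \<le> B"
    and \<beta>: "\<And>i j. i < j \<Longrightarrow> j < N \<Longrightarrow> \<beta> i < \<beta> j"
  shows "(\<Sum>\<pi> | \<pi> permutes {..<N}. of_int (sign \<pi>) *
      (\<Sum>Rs\<in>sized_configs B N (\<beta> \<circ> \<pi>). Uword B r (rows_word Rs) g w)) =
    (\<Sum>Rs\<in>good_configs B N \<beta>. Uword B r (rows_word Rs) g w)"
proof -
  let ?U = "\<lambda>Rs. Uword B r (rows_word Rs) g w"
  let ?S = "{\<pi>. \<pi> permutes {..<N}}"
  have finS: "finite ?S" by (intro finite_permutations) simp
  have only_id: "good_configs B N (\<beta> \<circ> \<pi>) = {}" if \<pi>: "\<pi> permutes {..<N}" "\<pi> \<noteq> id" for \<pi>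
  proof (rule ccontr)
    assume "good_configs B N (\<beta> \<circ> \<pi>) \<noteq> {}"
    then obtain Rs where Rs: "Rs \<in> good_configs B N (\<beta> \<circ> \<pi>)" by blast
    have "\<pi> i < \<pi> (Suc i)" if i: "Suc i < N" for i
    proof (rule ccontr)
      assume "\<not> \<pi> i < \<pi> (Suc i)"
      moreover have "\<pi> i \<noteq> \<pi> (Suc i)" using injD[OF permutes_inj[OF \<pi>(1)], of i "Suc i"] by auto
      ultimately have "\<pi> (Suc i) < \<pi> i" by simp
      moreover have "\<pi> i < N" using permutes_in_image[OF \<pi>(1), of i] i by simp
      ultimately have "\<beta> (\<pi> (Suc i)) < \<beta> (\<pi> i)" by (rule \<beta>)
      then show False using good_configs_sorted[OF Rs i] by simp
    qed
    then show False using permutes_lessThan_id[OF \<pi>(1)] \<pi>(2) by blast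
  qed
  have "(\<Sum>\<pi>\<in>?S. of_int (sign \<pi>) * (\<Sum>Rs\<in>sized_configs B N (\<beta> \<circ> \<pi>). ?U Rs)) =
    (\<Sum>\<pi>\<in>?S. of_int (sign \<pi>) * (\<Sum>Rs\<in>good_configs B N (\<beta> \<circ> \<pi>). ?U Rs)) +
    (\<Sum>\<pi>\<in>?S. \<Sum>p\<in>{..B} \<times> {i. Suc i < N}. of_int (sign \<pi>) *
      (\<Sum>Rs\<in>violating_configs B N \<beta> (fst p) (snd p) \<pi>. ?U Rs))"
    by (simp add: sum_sized_configs distrib_left sum.distrib sum_distrib_left split_def)
  also have "(\<Sum>\<pi>\<in>?S. \<Sum>p\<in>{..B} \<times> {i. Suc i < N}. of_int (sign \<pi>) *
      (\<Sum>Rs\<in>violating_configs B N \<beta> (fst p) (snd p) \<pi>. ?U Rs)) =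
    (\<Sum>p\<in>{..B} \<times> {i. Suc i < N}. \<Sum>\<pi>\<in>?S. of_int (sign \<pi>) *
      (\<Sum>Rs\<in>violating_configs B N \<beta> (fst p) (snd p) \<pi>. ?U Rs))"
    by (rule sum.swap)
  also have "\<dots> = 0"
  proof (rule sum.neutral, rule ballI)
    fix p assume p: "p \<in> {..B} \<times> {i. Suc i < N}"
    show "(\<Sum>\<pi>\<in>?S. of_int (sign \<pi>) * (\<Sum>Rs\<in>violating_configs B N \<beta> (fst p) (snd p) \<pi>. ?U Rs)) = 0"
      by (rule sum_sign_cancel[of "snd p"]) (use p violating_sum_symmetric[OF w r] in auto)
  qed
  also have "(\<Sum>\<pi>\<in>?S. of_int (sign \<pi>) * (\<Sum>Rs\<in>good_configs B N (\<beta> \<circ> \<pi>). ?U Rs)) =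
    (\<Sum>\<pi>\<in>{id}. of_int (sign \<pi>) * (\<Sum>Rs\<in>good_configs B N (\<beta> \<circ> \<pi>). ?U Rs))"
    using finS only_id by (intro sum.mono_neutral_right) (auto simp: permutes_id)
  also have "(\<Sum>\<pi>\<in>{id}. of_int (sign \<pi>) * (\<Sum>Rs\<in>good_configs B N (\<beta> \<circ> \<pi>). ?U Rs)) =
      (\<Sum>Rs\<in>good_configs B N \<beta>. ?U Rs)"
    by (simp add: sign_id)
  finally show ?thesis by (simp only: add_0_right)
qed

section \<open>The Jacobi-Trudi determinant as a multiplication operator\<close>

definition list_configs :: "nat \<Rightarrow> nat list \<Rightarrow> nat set list set" where
  "list_configs B ms = {Rs. list_all2 (\<lambda>R m. R \<subseteq> {1..B} \<and> card R = m) Rs ms}"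

lemma list_configs_Cons:
  "list_configs B (m # ms) = (\<lambda>(R, Rs). R # Rs) ` ({R. R \<subseteq> {1..B} \<and> card R = m} \<times> list_configs B ms)"
  by (auto simp: list_configs_def list_all2_Cons2 image_iff)

lemma pieri_product:
  assumes "w permutes {1..n}" "r \<le> n" "n + sum_list ms \<le> B"
  shows "(\<Sum>Rs\<in>list_configs B ms. Uword B r (rows_word Rs) schubert w) =
    prod_list (map (hpoly r) ms) * schubert w"
  using assms
proof (induction ms arbitrary: w n)
  case Nil
  have "list_configs B [] = {[]}" by (auto simp: list_configs_def)
  then show ?case by (simp add: rows_word_def)
next
  case (Cons m ms)
  let ?T = "{R. R \<subseteq> {1..B} \<and> card R = m}"
  let ?h = "prod_list (map (hpoly r) ms)"
  have inj: "inj_on (\<lambda>(R, Rs). R # Rs) X" for X :: "(nat set \<times> nat set list) set" by (auto simp: inj_on_def)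
  have "(\<Sum>Rs\<in>list_configs B (m # ms). Uword B r (rows_word Rs) schubert w) =
      (\<Sum>p\<in>?T \<times> list_configs B ms. Uword B r (sorted_list_of_set (fst p)) (Uword B r (rows_word (snd p)) schubert) w)"
    unfolding list_configs_Cons by (subst sum.reindex[OF inj]) (simp add: split_def rows_word_def Uword_append)
  also have "\<dots> = (\<Sum>R\<in>?T. Uword B r (sorted_list_of_set R)
      (\<lambda>v. \<Sum>Rs\<in>list_configs B ms. Uword B r (rows_word Rs) schubert v) w)"
    by (simp add: Uword_sum sum.cartesian_product split_def)
  also have "\<dots> = (\<Sum>R\<in>?T. Uword B r (sorted_list_of_set R) (\<lambda>v. ?h * schubert v) w)"
  proof (rule sum.cong[OF refl])
    fix R assume R: "R \<in> ?T"
    then have fR: "finite R" using finite_subset[of R "{1..B}"] by auto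
    show "Uword B r (sorted_list_of_set R) (\<lambda>v. \<Sum>Rs\<in>list_configs B ms. Uword B r (rows_word Rs) schubert v) w =
        Uword B r (sorted_list_of_set R) (\<lambda>v. ?h * schubert v) w"
    proof (rule Uword_cong[OF Cons.prems(1,2)])
      fix v assume v: "v permutes {1..n + length (sorted_list_of_set R)}"
      show "(\<Sum>Rs\<in>list_configs B ms. Uword B r (rows_word Rs) schubert v) = ?h * schubert v"
        by (rule Cons.IH[OF v]) (use R Cons.prems in auto)
    qed (use R fR Cons.prems in auto)
  qed
  also have "\<dots> = ?h * Hop B r 1 m schubert w"
    by (simp add: Uword_mult Hop_def sum_distrib_left)
  also have "Hop B r 1 m schubert w = hpoly r m * schubert w"
    by (rule schubert_pieri[OF Cons.prems(1,2)]) (use Cons.prems in simp)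
  finally show ?case by (simp add: ac_simps)
qed

text \<open>The guard \<open>j \<le> \<beta> (\<pi> j)\<close> encodes \<open>h\<^sub>m = 0\<close> for \<open>m < 0\<close>, which truncated subtraction would turn into
  \<open>h\<^sub>0 = 1\<close>.\<close>

definition jacobi_trudi :: "nat \<Rightarrow> nat \<Rightarrow> (nat \<Rightarrow> nat) \<Rightarrow> mpoly" where
  "jacobi_trudi r N \<beta> = (\<Sum>\<pi> | \<pi> permutes {..<N}. of_int (sign \<pi>) *
     (if \<forall>j<N. j \<le> \<beta> (\<pi> j) then prod_list (map (\<lambda>j. hpoly r (\<beta> (\<pi> j) - j)) [0..<N]) else 0))"

lemma sized_configs_eq:
  "sized_configs B N s = (if \<forall>j<N. j \<le> s j then list_configs B (map (\<lambda>j. s j - j) [0..<N]) else {})"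
proof (cases "\<forall>j<N. j \<le> s j")
  case True
  have "card (Rs ! j) + j = s j \<longleftrightarrow> card (Rs ! j) = s j - j" if "j < N" for Rs :: "nat set list" and j
    using True that by auto
  then show ?thesis
    using True by (auto simp: sized_configs_def row_configs_def list_configs_def list_all2_conv_all_nth
        all_set_conv_all_nth)
next
  case False
  then obtain j where "j < N" "\<not> j \<le> s j" by blast
  then have "card (Rs ! j) + j \<noteq> s j" for Rs :: "nat set list" by auto
  then show ?thesis using False \<open>j < N\<close> by (auto simp: sized_configs_def)
qed

lemma jacobi_trudi_pieri:
  assumes w: "w permutes {1..n}" "r \<le> n" "semi_shuffle r w"
    and \<beta>: "\<And>i j. i < j \<Longrightarrow> j < N \<Longrightarrow> \<beta> i < \<beta> j"
    and B: "n + (\<Sum>j<N. \<beta> j - j) \<le> B"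
  shows "(\<Sum>Rs\<in>good_configs B N \<beta>. Uword B r (rows_word Rs) schubert w) = jacobi_trudi r N \<beta> * schubert w"
proof -
  have wB: "w permutes {1..B}" using w(1) by (rule permutes_subset) (use B in auto)
  have st: "hole_state B r {} w" using wB w(3) by (simp add: hole_state_def)
  have rB: "r \<le> B" using w(2) B by simp
  have j_le: "j \<le> \<beta> j" if "j < N" for j
    using that
  proof (induction j)
    case (Suc j)
    then show ?case using \<beta>[of j "Suc j"] by simp
  qed simp
  have one: "(\<Sum>Rs\<in>sized_configs B N (\<beta> \<circ> \<pi>). Uword B r (rows_word Rs) schubert w) =
    (if \<forall>j<N. j \<le> \<beta> (\<pi> j) then prod_list (map (\<lambda>j. hpoly r (\<beta> (\<pi> j) - j)) [0..<N]) else 0) * schubert w"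
    if \<pi>: "\<pi> permutes {..<N}" for \<pi>
  proof (cases "\<forall>j<N. j \<le> \<beta> (\<pi> j)")
    case True
    let ?ms = "map (\<lambda>j. \<beta> (\<pi> j) - j) [0..<N]"
    have "sum_list ?ms = (\<Sum>j<N. \<beta> (\<pi> j) - j)"
      by (simp add: interv_sum_list_conv_sum_set_nat atLeast0LessThan)
    \<comment> \<open>All terms of the determinant have the same total degree, so a single bound on
      B serves every \<pi>.\<close>
    also have "\<dots> = (\<Sum>j<N. \<beta> j - j)"
    proof -
      have "(\<Sum>j<N. \<beta> (\<pi> j) - j) + (\<Sum>j<N. j) = (\<Sum>j<N. \<beta> (\<pi> j))"
        unfolding sum.distrib[symmetric] using True by (intro sum.cong refl) auto
      also have "\<dots> = (\<Sum>j<N. \<beta> j)" using sum.permute[OF \<pi>, of \<beta>] by (simp add: o_def)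
      also have "\<dots> = (\<Sum>j<N. \<beta> j - j) + (\<Sum>j<N. j)"
        unfolding sum.distrib[symmetric] using j_le by (intro sum.cong refl) auto
      finally show ?thesis by simp
    qed
    finally have "n + sum_list ?ms \<le> B" using B by simp
    then have "(\<Sum>Rs\<in>list_configs B ?ms. Uword B r (rows_word Rs) schubert w) =
        prod_list (map (hpoly r) ?ms) * schubert w"
      by (rule pieri_product[OF w(1,2)])
    moreover have "sized_configs B N (\<beta> \<circ> \<pi>) = list_configs B ?ms"
      unfolding sized_configs_eq o_apply using True by simp
    moreover have "map (hpoly r) ?ms = map (\<lambda>j. hpoly r (\<beta> (\<pi> j) - j)) [0..<N]" by simp
    ultimately show ?thesis unfolding if_P[OF True] by (simp only:)
  next
    case False
    then have "sized_configs B N (\<beta> \<circ> \<pi>) = {}" unfolding sized_configs_eq o_apply by (rule if_not_P)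
    then show ?thesis unfolding if_not_P[OF False] by simp
  qed
  have "(\<Sum>Rs\<in>good_configs B N \<beta>. Uword B r (rows_word Rs) schubert w) =
    (\<Sum>\<pi> | \<pi> permutes {..<N}. of_int (sign \<pi>) *
      (\<Sum>Rs\<in>sized_configs B N (\<beta> \<circ> \<pi>). Uword B r (rows_word Rs) schubert w))"
    by (rule sign_reversal[OF st rB \<beta>, symmetric])
  also have "\<dots> = jacobi_trudi r N \<beta> * schubert w"
    unfolding jacobi_trudi_def sum_distrib_right by (rule sum.cong[OF refl]) (simp add: one mult.assoc)
  finally show ?thesis .
qed

section \<open>Strict fillings as row configurations\<close>

lemma boxes_rows: "boxes lam = concat (map (\<lambda>i. map (Pair (num_parts lam - i))
    [1..<Suc (lam (num_parts lam - i))]) [0..<num_parts lam])"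
proof -
  have "rev [1..<Suc (num_parts lam)] = map (\<lambda>i. num_parts lam - i) [0..<num_parts lam]"
    by (rule nth_equalityI) (auto simp: rev_nth simp del: upt_Suc)
  then show ?thesis unfolding boxes_def by (simp add: o_def del: upt_Suc)
qed

lemma sorted_list_of_row:
  assumes "\<And>j j'. 1 \<le> j \<Longrightarrow> j < j' \<Longrightarrow> j' \<le> m \<Longrightarrow> f j < (f j' :: nat)"
  shows "sorted_list_of_set (f ` {1..m}) = map f [1..<Suc m]"
proof (rule strict_sorted_equal)
  show "sorted_wrt (<) (map f [1..<Suc m])"
    unfolding sorted_wrt_map using assms
    by (intro sorted_wrt_mono_rel[OF _ sorted_wrt_upt]) auto
qed (auto simp del: upt_Suc)

lemma no_violation_iff:
  assumes Rs: "Rs \<in> row_configs B N"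
  shows "(\<forall>k i. \<not> violates Rs k i) \<longleftrightarrow> (\<forall>i. Suc i < N \<longrightarrow> (\<forall>j<card (Rs ! i). j < card (Rs ! Suc i) \<and>
    sorted_list_of_set (Rs ! Suc i) ! j < sorted_list_of_set (Rs ! i) ! j))"
proof -
  have len: "length Rs = N" using Rs by (simp add: row_configs_def)
  have fin: "finite (Rs ! i)" if "i < N" for i
    using row_configs_nth[OF Rs that] by (rule finite_subset) simp
  have "(\<forall>k. \<not> violates Rs k i) \<longleftrightarrow> (\<forall>j<card (Rs ! i). j < card (Rs ! Suc i) \<and>
    sorted_list_of_set (Rs ! Suc i) ! j < sorted_list_of_set (Rs ! i) ! j)" if i: "Suc i < N" for i
    using nth_less_iff_card[of "sorted_list_of_set (Rs ! Suc i)" "sorted_list_of_set (Rs ! i)"] i fin[of i] fin[of "Suc i"]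
    by (simp add: violates_def len not_less)
  moreover have "\<not> violates Rs k i" if "\<not> Suc i < N" for k i using that by (simp add: violates_def len)
  ultimately show ?thesis by metis
qed

lemma partition_part_pos:
  assumes "is_partition lam" "1 \<le> i"
  shows "lam i \<noteq> 0 \<longleftrightarrow> i \<le> num_parts lam"
  using partition_support[OF assms(1)] assms(2) by (metis (mono_tags, lifting) atLeastAtMost_iff mem_Collect_eq)

text \<open>Row configurations start with the bottom row, so list index i stands for row N - i of
  the diagram. The entry sets of the rows determine a row strict filling, and column strictness of
  neighbouring rows is the absence of violations.\<close>

lemma sum_good_configs:
  fixes f :: "nat list \<Rightarrow> 'a::comm_monoid_add"
  assumes lam: "is_partition lam" and N: "N = num_parts lam"
  shows "(\<Sum>F\<in>strict_fillings B lam. f (map F (boxes lam))) =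
    (\<Sum>Rs\<in>good_configs B N (\<lambda>i. lam (N - i) + i). f (rows_word Rs))"
proof -
  define rows where "rows F = map (\<lambda>i. (\<lambda>j. F (N - i, j)) ` {1..lam (N - i)}) [0..<N]" for F :: "nat \<times> nat \<Rightarrow> nat"
  define fill where "fill Rs = restrict (\<lambda>x. sorted_list_of_set (Rs ! (N - fst x)) ! (snd x - 1)) (diagram lam)"
    for Rs :: "nat set list"
  have diag: "(i, j) \<in> diagram lam \<longleftrightarrow> 1 \<le> i \<and> 1 \<le> j \<and> j \<le> lam i" for i j by (simp add: diagram_def)
  have iN: "i \<le> N" if "(i, j) \<in> diagram lam" for i j
    using that partition_part_pos[OF lam, of i] unfolding diag N by auto
  have length_rows: "length (rows F) = N" for F by (simp add: rows_def)
  have nth_rows: "rows F ! i = (\<lambda>j. F (N - i, j)) ` {1..lam (N - i)}" if "i < N" for F i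
    using that by (simp add: rows_def)
  have anti: "lam (N - i) \<le> lam (N - Suc i)" if "Suc i < N" for i
    using partition_antimono[OF lam, of "N - Suc i" "N - i"] that by simp
  show ?thesis
  proof (rule sum.reindex_bij_witness[of _ fill rows])
    fix F assume F: "F \<in> strict_fillings B lam"
    then have FE: "F \<in> diagram lam \<rightarrow>\<^sub>E {1..B}" and rs: "row_strict lam F" and cs: "column_strict lam F"
      by (auto simp: strict_fillings_def)
    have sl: "sorted_list_of_set (rows F ! i) = map (\<lambda>j. F (N - i, j)) [1..<Suc (lam (N - i))]"
      if "i < N" for i
      unfolding nth_rows[OF that]
    proof (rule sorted_list_of_row)
      fix j j' assume "1 \<le> j" "j < j'" "j' \<le> lam (N - i)"
      then have "(N - i, j) \<in> diagram lam" "(N - i, j') \<in> diagram lam" using that by (auto simp: diag)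
      then show "F (N - i, j) < F (N - i, j')" using rs \<open>j < j'\<close> unfolding row_strict_def by blast
    qed
    have card: "card (rows F ! i) = lam (N - i)" if "i < N" for i
      using arg_cong[OF sl[OF that], of length] by simp
    show "fill (rows F) = F"
    proof (rule PiE_ext[OF _ FE])
      show "fill (rows F) x = F x" if x: "x \<in> diagram lam" for x
      proof -
        obtain i j where ij: "x = (i, j)" by fastforce
        have "1 \<le> i" "i \<le> N" "1 \<le> j" "j \<le> lam i" using x iN[of i j] by (auto simp: ij diag)
        moreover from this have "[1..<Suc (lam i)] ! (j - 1) = j" by (subst nth_upt) auto
        ultimately show ?thesis using x by (simp add: fill_def ij sl del: upt_Suc)
      qed
      then show "fill (rows F) \<in> diagram lam \<rightarrow>\<^sub>E {1..B}"
        using FE by (auto simp: fill_def PiE_def Pi_def)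
    qed
    have conf: "rows F \<in> row_configs B N"
      unfolding row_configs_def using FE by (auto simp: rows_def diag dest!: PiE_mem)
    have "\<not> violates (rows F) k i" for k i
    proof -
      have "\<forall>i. Suc i < N \<longrightarrow> (\<forall>j<card (rows F ! i). j < card (rows F ! Suc i) \<and>
        sorted_list_of_set (rows F ! Suc i) ! j < sorted_list_of_set (rows F ! i) ! j)"
      proof (intro allI impI)
        fix i j assume i: "Suc i < N" and j: "j < card (rows F ! i)"
        have jl: "j < lam (N - i)" "j < lam (N - Suc i)" using j card[of i] anti[OF i] i by auto
        have "(N - Suc i, Suc j) \<in> diagram lam" "(N - i, Suc j) \<in> diagram lam" "N - Suc i < N - i"
          using i jl by (auto simp: diag)
        then have "F (N - Suc i, Suc j) < F (N - i, Suc j)" using cs unfolding column_strict_def by blast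
        then show "j < card (rows F ! Suc i) \<and>
            sorted_list_of_set (rows F ! Suc i) ! j < sorted_list_of_set (rows F ! i) ! j"
          using i jl card[of "Suc i"] sl[of i] sl[of "Suc i"] by (simp del: upt_Suc)
      qed
      then show ?thesis using no_violation_iff[OF conf] by blast
    qed
    then show "rows F \<in> good_configs B N (\<lambda>i. lam (N - i) + i)"
      using conf card by (simp add: good_configs_def sized_configs_def)
    have "rows_word (rows F) = concat (map (\<lambda>i. sorted_list_of_set (rows F ! i)) [0..<N])"
      unfolding rows_word_def
      by (intro arg_cong[of _ _ concat] nth_equalityI) (simp_all add: length_rows)
    also have "\<dots> = concat (map (\<lambda>i. map (\<lambda>j. F (N - i, j)) [1..<Suc (lam (N - i))]) [0..<N])"
      by (intro arg_cong[of _ _ concat] map_cong refl sl) auto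
    also have "\<dots> = map F (boxes lam)"
      unfolding boxes_rows N[symmetric] by (simp add: map_concat o_def del: upt_Suc)
    finally show "f (rows_word (rows F)) = f (map F (boxes lam))" by simp
  next
    fix Rs assume "Rs \<in> good_configs B N (\<lambda>i. lam (N - i) + i)"
    then have conf: "Rs \<in> row_configs B N" and card: "\<And>i. i < N \<Longrightarrow> card (Rs ! i) = lam (N - i)"
      and nv: "\<forall>k i. \<not> violates Rs k i" by (auto simp: good_configs_def sized_configs_def)
    have len: "length Rs = N" using conf by (simp add: row_configs_def)
    have sub: "Rs ! i \<subseteq> {1..B}" "finite (Rs ! i)" if "i < N" for i
      using row_configs_nth[OF conf that] finite_subset[of "Rs ! i" "{1..B}"] by auto
    let ?F = "fill Rs"
    have F: "?F (i, j) = sorted_list_of_set (Rs ! (N - i)) ! (j - 1)" if "(i, j) \<in> diagram lam" for i j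
      using that by (simp add: fill_def)
    have idx: "N - i < N" "card (Rs ! (N - i)) = lam i" "j - 1 < lam i" if "(i, j) \<in> diagram lam" for i j
    proof -
      have "1 \<le> i" "i \<le> N" "1 \<le> j" "j \<le> lam i" using that iN[OF that] by (auto simp: diag)
      then show "N - i < N" "card (Rs ! (N - i)) = lam i" "j - 1 < lam i" using card[of "N - i"] by auto
    qed
    have "?F \<in> diagram lam \<rightarrow>\<^sub>E {1..B}"
    proof (rule PiE_I)
      fix x assume x: "x \<in> diagram lam"
      obtain i j where ij: "x = (i, j)" by fastforce
      note id = idx[OF x[unfolded ij]]
      have "sorted_list_of_set (Rs ! (N - i)) ! (j - 1) \<in> set (sorted_list_of_set (Rs ! (N - i)))"
        using id by (intro nth_mem) simp
      then show "?F x \<in> {1..B}" using F[OF x[unfolded ij]] sub[OF id(1)] by (auto simp: ij)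
    qed (simp add: fill_def)
    moreover have row: "?F (i, j) < ?F (i, j')"
      if d: "(i, j) \<in> diagram lam" "(i, j') \<in> diagram lam" "j < j'" for i j j'
    proof -
      have "j - 1 < j' - 1" using d by (auto simp: diag)
      moreover have "j' - 1 < length (sorted_list_of_set (Rs ! (N - i)))" using idx[OF d(2)] by simp
      ultimately show ?thesis unfolding F[OF d(1)] F[OF d(2)]
        using sorted_wrt_nth_less[OF strict_sorted_list_of_set] by blast
    qed
    moreover have col: "?F (i, j) < ?F (i', j)"
      if d: "(i, j) \<in> diagram lam" "(i', j) \<in> diagram lam" "i < i'" for i i' j
      using d(3,2)
    proof (induction i')
      case (Suc m)
      have im: "1 \<le> i" "i \<le> m" "1 \<le> j" "j \<le> lam (Suc m)" using Suc.prems d(1) by (auto simp: diag)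
      then have m: "(m, j) \<in> diagram lam"
        using partition_antimono[OF lam, of m "Suc m"] by (auto simp: diag)
      have mN: "Suc m \<le> N" using iN[OF Suc.prems(2)] .
      have "?F (m, j) < ?F (Suc m, j)"
      proof -
        have e: "N - m = Suc (N - Suc m)" "Suc (N - Suc m) < N" using mN im by auto
        have "j - 1 < card (Rs ! (N - Suc m))" using idx[OF Suc.prems(2)] by simp
        then have "sorted_list_of_set (Rs ! Suc (N - Suc m)) ! (j - 1) < sorted_list_of_set (Rs ! (N - Suc m)) ! (j - 1)"
          using no_violation_iff[OF conf] nv e(2) by blast
        then show ?thesis unfolding F[OF m] F[OF Suc.prems(2)] e(1) .
      qed
      moreover have "?F (i, j) \<le> ?F (m, j)"
        using Suc.IH[OF _ m] im by (cases "i = m") auto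
      ultimately show ?case by simp
    qed simp
    ultimately show "?F \<in> strict_fillings B lam"
      by (auto simp: strict_fillings_def row_strict_def column_strict_def less_imp_le)
    show "rows ?F = Rs"
    proof (rule nth_equalityI)
      show "length (rows ?F) = length Rs" by (simp add: length_rows len)
      fix i assume "i < length (rows ?F)"
      then have i: "i < N" by (simp add: length_rows)
      have "(\<lambda>j. ?F (N - i, j)) ` {1..lam (N - i)} = (\<lambda>q. sorted_list_of_set (Rs ! i) ! q) ` {..<lam (N - i)}"
      proof -
        have "(\<lambda>j. ?F (N - i, j)) ` {1..lam (N - i)} = (\<lambda>j. sorted_list_of_set (Rs ! i) ! (j - 1)) ` {1..lam (N - i)}"
          using i by (intro image_cong refl) (simp add: F diag)
        also have "\<dots> = (\<lambda>q. sorted_list_of_set (Rs ! i) ! q) ` (\<lambda>j. j - 1) ` {1..lam (N - i)}"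
          by (simp add: image_image)
        also have "(\<lambda>j. j - 1) ` {1..lam (N - i)} = {..<lam (N - i)}"
          by (auto simp: image_iff intro!: bexI[of _ "Suc _"])
        finally show ?thesis .
      qed
      also have "\<dots> = set (sorted_list_of_set (Rs ! i))"
        using card[OF i] by (auto simp: set_conv_nth)
      also have "\<dots> = Rs ! i" using sub[OF i] by simp
      finally show "rows ?F ! i = Rs ! i" by (simp add: nth_rows i)
    qed
  qed
qed

subsection \<open>Chains from the identity\<close>

lemma shuffle_semi_shuffle: "shuffle r v \<Longrightarrow> semi_shuffle r v"
  by (simp add: shuffle_def semi_shuffle_def)

lemma shuffle_less:
  assumes "shuffle r v" "1 \<le> i" "i < j" "j \<le> r"
  shows "v i < v j"
  using assms(3,4)
proof (induction j)
  case (Suc j)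
  have "v j < v (Suc j)" if "1 \<le> j" using assms(1) that Suc.prems by (simp add: shuffle_def)
  then show ?case using Suc assms(2) by (cases "i = j") (auto intro: less_trans)
qed simp

text \<open>The step has to land at k + 1. Otherwise k + 1 lies between k and v b in value, and
  since a shuffle increases on each side of r, also in position.\<close>

lemma Uop_shuffle:
  fixes g :: "(nat \<Rightarrow> nat) \<Rightarrow> 'a::comm_ring_1"
  assumes v: "v permutes {1..B}" and sh: "shuffle r v" and k: "k \<in> {1..B}" and r: "r \<le> B"
  shows "Uop B r k g v = (if inv v k \<le> r \<and> r < inv v (Suc k) \<and> Suc k \<le> B then g (simple_refl k \<circ> v) else 0)"
proof (cases "inv v k \<le> r")
  case False
  then show ?thesis by (simp add: Uop_def)
next
  case True
  define a where "a = inv v k"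
  define q where "q = inv v (Suc k)"
  have va: "v a = k" and vq: "v q = Suc k"
    unfolding a_def q_def by (rule permutes_inverses(1)[OF v])+
  have aB: "a \<in> {1..B}" unfolding a_def by (rule inv_in_range[OF v k])
  have ar: "a \<le> r" using True by (simp add: a_def)
  have inj: "v x = v y \<Longrightarrow> x = y" for x y using permutes_inj[OF v] by (auto dest: injD)
  have only: "b = q \<and> r < q" if b: "b \<in> {r<..B}" "covers v a b" for b
  proof -
    have bB: "b \<in> {1..B}" "a < b" using b ar by auto
    have cov: "v a < v b" "\<And>c. a < c \<Longrightarrow> c < b \<Longrightarrow> \<not> (v a < v c \<and> v c < v b)"
      using covers_iff[OF v bB(2) aB bB(1)] b(2) by auto
    show ?thesis
    proof (cases "b = q")
      case False
      then have "v b \<noteq> Suc k" using vq inj by metis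
      then have less: "Suc k < v b" using cov(1) va by simp
      have "\<not> (a < q \<and> q < b)" using cov(2)[of q] less va vq by auto
      moreover have "q < b"
      proof (cases "q \<le> r")
        case False
        show ?thesis
        proof (rule ccontr)
          assume "\<not> q < b"
          then have "b < q" using \<open>b \<noteq> q\<close> by simp
          then show False using semi_shuffle_less[OF shuffle_semi_shuffle[OF sh], of b q] b(1) less vq by simp
        qed
      qed (use b in auto)
      moreover have "a < q"
      proof (rule ccontr)
        assume n: "\<not> a < q"
        moreover have "q \<noteq> a" using va vq by auto
        ultimately have "q < a" by simp
        moreover have "1 \<le> q"
        proof (rule ccontr)
          assume "\<not> 1 \<le> q"
          then have "v q = q" using permutes_not_in[OF v] by simp
          then show False using vq \<open>\<not> 1 \<le> q\<close> by simp
        qed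
        ultimately have "v q < v a" using shuffle_less[OF sh _ _ ar] by blast
        then show False using va vq by simp
      qed
      ultimately show ?thesis by blast
    qed (use b in auto)
  qed
  have swap: "v \<circ> transpose a q = simple_refl k \<circ> v"
    unfolding simple_refl_def a_def q_def by (rule comp_transpose_inv[OF v, symmetric])
  have U: "Uop B r k g v = (\<Sum>b\<in>{r<..B}. if covers v a b then g (v \<circ> transpose a b) else 0)"
    unfolding Uop_def a_def[symmetric] using v ar by simp
  show ?thesis
  proof (cases "r < q \<and> Suc k \<le> B")
    case True
    have qB: "q \<in> {1..B}" unfolding q_def by (rule inv_in_range[OF v]) (use True in auto)
    have "a < q" using True ar by simp
    then have "covers v a q" using covers_iff[OF v _ aB qB] va vq by force
    then have "Uop B r k g v = (\<Sum>b\<in>{r<..B}. if b = q then g (v \<circ> transpose a q) else 0)"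
      unfolding U
    proof (intro sum.cong refl)
      fix b assume b: "b \<in> {r<..B}"
      show "(if covers v a b then g (v \<circ> transpose a b) else 0) = (if b = q then g (v \<circ> transpose a q) else 0)"
      proof (cases "b = q")
        case False
        then have "\<not> covers v a b" using only[OF b] by blast
        then show ?thesis using False by simp
      qed (use \<open>covers v a q\<close> in simp)
    qed
    also have "\<dots> = g (simple_refl k \<circ> v)" using True qB by (simp add: swap)
    finally show ?thesis using True ar unfolding a_def[symmetric] q_def[symmetric] by simp
  next
    case False
    have "\<not> covers v a b" if b: "b \<in> {r<..B}" for b
    proof
      assume c: "covers v a b"
      then have bq: "b = q" "r < q" using only[OF b] by auto
      have "v q \<in> {1..B}" using permutes_in_image[OF v, of q] b bq by auto
      then show False using False bq vq by simp
    qed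
    then have "Uop B r k g v = 0" unfolding U by (intro sum.neutral) auto
    then show ?thesis using False unfolding a_def[symmetric] q_def[symmetric] by auto
  qed
qed

lemma shuffle_simple_refl:
  assumes v: "v permutes {1..B}" and sh: "shuffle r v" and k: "inv v k \<le> r" "r < inv v (Suc k)"
  shows "shuffle r (simple_refl k \<circ> v)"
  unfolding shuffle_def
proof (intro allI impI)
  fix i :: nat assume i: "1 \<le> i" "i \<noteq> r"
  have less: "v i < v (Suc i)" using sh i by (simp add: shuffle_def)
  have "\<not> (v i = k \<and> v (Suc i) = Suc k)"
  proof
    assume "v i = k \<and> v (Suc i) = Suc k"
    then have "inv v k = i" "inv v (Suc k) = Suc i" by (auto intro: inv_eqI[OF v])
    then show False using k i by simp
  qed
  then show "(simple_refl k \<circ> v) i < (simple_refl k \<circ> v) (Suc i)"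
    unfolding o_apply using less by (subst simple_refl_less_iff) auto
qed

text \<open>A row with labels below the values of the holes cannot skip a hole: its only nonzero
  contribution moves the holes \<open>c + 1, c + 2, \<dots>\<close> down by one.\<close>

lemma Uword_shuffle_row:
  fixes g :: "(nat \<Rightarrow> nat) \<Rightarrow> 'a::comm_ring_1"
  assumes "v permutes {1..B}" "shuffle r v" "r \<le> B" "r + c + length ks \<le> B"
    "sorted_wrt (<) ks" "set ks \<subseteq> {1..B}"
    "\<And>i. i < length ks \<Longrightarrow> Suc (c + i) \<le> m \<Longrightarrow> ks ! i < v (r + Suc (c + i))"
    "\<And>j. m < j \<Longrightarrow> c < j \<Longrightarrow> v (r + j) = r + j"
    "1 \<le> c \<Longrightarrow> ks \<noteq> [] \<Longrightarrow> v (r + c) < hd ks"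
  shows "Uword B r ks g v = (if ks = map (\<lambda>j. v (r + j) - 1) [Suc c..<Suc (c + length ks)]
      then g (word_perm (rev ks) \<circ> v) else 0) \<and>
    (ks = map (\<lambda>j. v (r + j) - 1) [Suc c..<Suc (c + length ks)] \<longrightarrow>
      (word_perm (rev ks) \<circ> v) permutes {1..B} \<and> shuffle r (word_perm (rev ks) \<circ> v) \<and>
      (\<forall>j\<ge>1. (word_perm (rev ks) \<circ> v) (r + j) =
        (if c < j \<and> j \<le> c + length ks then v (r + j) - 1 else v (r + j))))"
  using assms
proof (induction ks arbitrary: v c)
  case Nil
  then show ?case by auto
next
  case (Cons k ks)
  note v = Cons.prems(1) and sh = Cons.prems(2)
  have k: "k \<in> {1..B}" using Cons.prems(6) by simp
  let ?t = "\<lambda>v c ks. map (\<lambda>j. v (r + j) - 1) [Suc c..<Suc (c + length ks)]"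
  have inj: "v x = v y \<Longrightarrow> x = y" for x y using permutes_inj[OF v] by (auto dest: injD)
  have hole_less: "v (r + x) < v (r + y)" if "1 \<le> x" "x < y" for x y
    using semi_shuffle_less[OF shuffle_semi_shuffle[OF sh], of "r + x" "r + y"] that by simp
  have next_pos: "1 \<le> v (r + Suc c)" using permutes_in_image[OF v, of "r + Suc c"] Cons.prems(4) by auto
  have t_Cons: "?t v c (k # ks) = (v (r + Suc c) - 1) # map (\<lambda>j. v (r + j) - 1) [Suc (Suc c)..<Suc (Suc c + length ks)]"
    by (simp add: upt_conv_Cons del: upt_Suc)
  \<comment> \<open>The hole k + 1 is number c + 1. Earlier holes lie below the label. If a later
    one were meant, hole c + 1 would lie above k and below k + 1, or, beyond m, the preceding hole
    would have the value k.\<close>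
  have which: "v (r + Suc c) = Suc k" if a: "inv v k \<le> r" "r < inv v (Suc k)"
  proof -
    define x where "x = inv v (Suc k) - r"
    have x: "1 \<le> x" "r + x = inv v (Suc k)" using a(2) by (auto simp: x_def)
    have vx: "v (r + x) = Suc k" unfolding x(2) by (rule permutes_inverses(1)[OF v])
    have "c < x"
    proof (rule ccontr)
      assume "\<not> c < x"
      then have "1 \<le> c" "x \<le> c" using x(1) by auto
      then have "v (r + x) \<le> v (r + c)" using hole_less[of x c] x(1) by (cases "x = c") auto
      then show False using Cons.prems(9) \<open>1 \<le> c\<close> vx by simp
    qed
    moreover have "\<not> Suc c < x"
    proof
      assume cx: "Suc c < x"
      show False
      proof (cases "Suc c \<le> m")
        case True
        then have "k < v (r + Suc c)" using Cons.prems(7)[of 0] by simp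
        then show False using hole_less[of "Suc c" x] cx vx by simp
      next
        case False
        obtain y where y: "x = Suc y" using x(1) by (cases x) auto
        have "v (r + x) = r + x" "v (r + y) = r + y"
          using Cons.prems(8)[of x] Cons.prems(8)[of y] False cx y by simp_all
        then have "v (r + y) = k" using vx y by simp
        then have "inv v k = r + y" by (rule inv_eqI[OF v])
        then show False using a(1) cx y by simp
      qed
    qed
    ultimately have "x = Suc c" by simp
    then show ?thesis using vx by simp
  qed
  show ?case
  proof (cases "v (r + Suc c) = Suc k")
    case False
    then have "\<not> (inv v k \<le> r \<and> r < inv v (Suc k))" using which by blast
    then have "Uword B r (k # ks) g v = 0" unfolding Uword.simps using Uop_shuffle[OF v sh k Cons.prems(3)] by auto
    moreover have "k # ks \<noteq> ?t v c (k # ks)" unfolding t_Cons using False next_pos by auto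
    ultimately show ?thesis by simp
  next
    case True
    have iq: "inv v (Suc k) = r + Suc c" using True by (rule inv_eqI[OF v])
    have ik: "inv v k \<le> r"
    proof (rule ccontr)
      assume n: "\<not> inv v k \<le> r"
      define x where "x = inv v k - r"
      have x: "1 \<le> x" "r + x = inv v k" using n by (auto simp: x_def)
      have vx: "v (r + x) = k" unfolding x(2) by (rule permutes_inverses(1)[OF v])
      have "\<not> Suc c \<le> x"
      proof
        assume "Suc c \<le> x"
        then have "v (r + Suc c) \<le> v (r + x)" using hole_less[of "Suc c" x] by (cases "x = Suc c") auto
        then show False using True vx by simp
      qed
      then have "x \<le> c" "1 \<le> c" using x(1) by auto
      then have "v (r + x) \<le> v (r + c)" using hole_less[of x c] x(1) by (cases "x = c") auto
      then show False using Cons.prems(9) \<open>1 \<le> c\<close> vx by simp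
    qed
    have SkB: "Suc k \<le> B"
      using permutes_in_image[OF v, of "r + Suc c"] True Cons.prems(4) by auto
    define u where "u = simple_refl k \<circ> v"
    have u: "u permutes {1..B}" unfolding u_def
      by (rule simple_refl_comp_permutes[OF v]) (use k SkB in auto)
    have shu: "shuffle r u" unfolding u_def by (rule shuffle_simple_refl[OF v sh ik]) (simp add: iq)
    have U: "Uword B r (k # ks) g v = Uword B r ks g u"
      unfolding Uword.simps Uop_shuffle[OF v sh k Cons.prems(3)] u_def using ik iq SkB by simp
    have uc: "u (r + Suc c) = k" unfolding u_def using True by simp
    have uj: "u (r + j) = v (r + j)" if "j \<noteq> Suc c" "1 \<le> j" for j
    proof -
      have "v (r + j) \<noteq> Suc k" using inj[of "r + j" "r + Suc c"] True that by auto
      moreover have "v (r + j) \<noteq> k"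
      proof
        assume "v (r + j) = k"
        then have "inv v k = r + j" by (rule inv_eqI[OF v])
        then show False using ik that by simp
      qed
      ultimately show ?thesis unfolding u_def by (simp add: simple_refl_def transpose_def)
    qed
    have IH: "Uword B r ks g u = (if ks = ?t u (Suc c) ks then g (word_perm (rev ks) \<circ> u) else 0) \<and>
      (ks = ?t u (Suc c) ks \<longrightarrow> (word_perm (rev ks) \<circ> u) permutes {1..B} \<and> shuffle r (word_perm (rev ks) \<circ> u) \<and>
      (\<forall>j\<ge>1. (word_perm (rev ks) \<circ> u) (r + j) =
        (if Suc c < j \<and> j \<le> Suc c + length ks then u (r + j) - 1 else u (r + j))))"
    proof (rule Cons.IH[OF u shu])
      show "ks ! i < u (r + Suc (Suc c + i))" if "i < length ks" "Suc (Suc c + i) \<le> m" for i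
        using Cons.prems(7)[of "Suc i"] that uj[of "Suc (Suc c + i)"] by simp
      show "u (r + j) = r + j" if "m < j" "Suc c < j" for j
        using Cons.prems(8)[of j] uj[of j] that by simp
      show "u (r + Suc c) < hd ks" if "ks \<noteq> []"
        unfolding uc using Cons.prems(5) that by (cases ks) auto
    qed (use Cons.prems in auto)
    have tt: "?t u (Suc c) ks = map (\<lambda>j. v (r + j) - 1) [Suc (Suc c)..<Suc (Suc c + length ks)]"
    proof (rule map_cong[OF refl])
      fix j assume "j \<in> set [Suc (Suc c)..<Suc (Suc c + length ks)]"
      then have "j \<noteq> Suc c" "1 \<le> j" by (auto simp del: upt_Suc)
      then show "u (r + j) - 1 = v (r + j) - 1" using uj by simp
    qed
    have iff: "k # ks = ?t v c (k # ks) \<longleftrightarrow> ks = ?t u (Suc c) ks"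
      unfolding t_Cons tt using True by simp
    have wp: "word_perm (rev (k # ks)) \<circ> v = word_perm (rev ks) \<circ> u"
      unfolding u_def by (simp add: word_perm_append comp_assoc)
    have holes: "(if Suc c < j \<and> j \<le> Suc c + length ks then u (r + j) - 1 else u (r + j)) =
        (if c < j \<and> j \<le> c + length (k # ks) then v (r + j) - 1 else v (r + j))" if "1 \<le> j" for j
      using uj[of j] uc True that by (cases "j = Suc c") auto
    show ?thesis unfolding U iff wp
    proof (intro conjI impI allI)
      show "Uword B r ks g u = (if ks = ?t u (Suc c) ks then g (word_perm (rev ks) \<circ> u) else 0)"
        using IH by (rule conjunct1)
      assume e: "ks = ?t u (Suc c) ks"
      show "(word_perm (rev ks) \<circ> u) permutes {1..B}" "shuffle r (word_perm (rev ks) \<circ> u)"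
        using IH e by blast+
      fix j :: nat assume j: "1 \<le> j"
      have "(word_perm (rev ks) \<circ> u) (r + j) =
          (if Suc c < j \<and> j \<le> Suc c + length ks then u (r + j) - 1 else u (r + j))"
        using IH e j by blast
      then show "(word_perm (rev ks) \<circ> u) (r + j) =
          (if c < j \<and> j \<le> c + length (k # ks) then v (r + j) - 1 else v (r + j))"
        using holes[OF j] by (rule trans)
    qed
  qed
qed

definition row_less :: "nat set \<Rightarrow> nat set \<Rightarrow> bool" where
  "row_less R R' \<longleftrightarrow> (\<forall>j<card R. j < card R' \<and> sorted_list_of_set R' ! j < sorted_list_of_set R ! j)"

definition row_chains :: "nat \<Rightarrow> nat set \<Rightarrow> nat list \<Rightarrow> nat set list set" where
  "row_chains B R0 ms = {Rs. list_all2 (\<lambda>R m. R \<subseteq> {1..B} \<and> card R = m) Rs ms \<and> successively row_less (R0 # Rs)}"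

lemma row_chains_Cons:
  "row_chains B R0 (m # ms) =
    (\<lambda>(R, Rs). R # Rs) ` (SIGMA R : {R. R \<subseteq> {1..B} \<and> card R = m \<and> row_less R0 R}. row_chains B R ms)"
  by (auto simp: row_chains_def list_all2_Cons2 image_iff)

lemma finite_row_chains: "finite (row_chains B R0 ms)"
proof (rule finite_subset[OF _ finite_row_configs])
  show "row_chains B R0 ms \<subseteq> row_configs B (length ms)"
    by (auto simp: row_chains_def row_configs_def list_all2_conv_all_nth all_set_conv_all_nth)
qed

text \<open>Every row is forced: a row of length m lowers the first m holes by one, and its labels
  are the new values of these holes. So the row below, with which the next row is compared, is the
  set of current holes. The bound on v (r + 1) lets the lowest hole be lowered by every remaining
  row.\<close>

lemma sum_row_chains_shuffle:
  fixes g :: "(nat \<Rightarrow> nat) \<Rightarrow> 'a::comm_ring_1"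
  assumes "v permutes {1..B}" "shuffle r v" "r \<le> B" "\<And>j. m < j \<Longrightarrow> v (r + j) = r + j"
    "sorted (m # ms)" "\<And>m'. m' \<in> set ms \<Longrightarrow> r + m' \<le> B" "length ms < v (r + 1)"
  shows "\<exists>u. u permutes {1..B} \<and> shuffle r u \<and>
    (\<forall>j\<ge>1. u (r + j) + length (filter (\<lambda>m. j \<le> m) ms) = v (r + j)) \<and>
    (\<Sum>Rs\<in>row_chains B ((\<lambda>j. v (r + j)) ` {1..m}) ms. Uword B r (rows_word Rs) g v) = g u"
  using assms
proof (induction ms arbitrary: v m)
  case Nil
  have "row_chains B R0 [] = {[]}" for R0 by (auto simp: row_chains_def)
  then show ?case using Nil.prems by (intro exI[of _ v]) (simp add: rows_word_def)
next
  case (Cons m' ms)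
  note v = Cons.prems(1) and sh = Cons.prems(2)
  have mm: "m \<le> m'" using Cons.prems(5) by simp
  have m'B: "r + m' \<le> B" using Cons.prems(6) by simp
  have hole_less: "v (r + x) < v (r + y)" if "1 \<le> x" "x < y" for x y
    using semi_shuffle_less[OF shuffle_semi_shuffle[OF sh], of "r + x" "r + y"] that by simp
  have hole_ge: "v (r + 1) \<le> v (r + x)" if "1 \<le> x" for x
    using hole_less[of 1 x] that by (cases "x = 1") auto
  let ?P = "(\<lambda>j. v (r + j)) ` {1..m}"
  let ?h = "\<lambda>j. v (r + j) - 1"
  let ?Q = "?h ` {1..m'}"
  have dec_less: "?h x < ?h y" if "1 \<le> x" "x < y" for x y
    using hole_less[OF that] hole_ge[OF that(1)] Cons.prems(7) by simp
  have sR0: "sorted_list_of_set ?P = map (\<lambda>j. v (r + j)) [1..<Suc m]"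
    by (rule sorted_list_of_row) (use hole_less in auto)
  have sR: "sorted_list_of_set ?Q = map ?h [1..<Suc m']"
    by (rule sorted_list_of_row) (use dec_less in auto)
  have cR0: "card ?P = m" using arg_cong[OF sR0, of length] by simp
  have cR: "card ?Q = m'" using arg_cong[OF sR, of length] by simp
  let ?A = "{R. R \<subseteq> {1..B} \<and> card R = m' \<and> row_less ?P R}"
  have RA: "?Q \<in> ?A"
  proof -
    have "?h j \<in> {1..B}" if "j \<in> {1..m'}" for j
    proof -
      have "v (r + j) \<in> {1..B}" using permutes_in_image[OF v, of "r + j"] that m'B by auto
      moreover have "2 \<le> v (r + j)" using hole_ge[of j] Cons.prems(7) that by simp
      ultimately show ?thesis by auto
    qed
    then have "?Q \<subseteq> {1..B}" by blast
    moreover have "row_less ?P ?Q"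
      unfolding row_less_def cR0 cR sR0 sR
    proof (intro allI impI conjI)
      fix j assume "j < m"
      then show "j < m'" using mm by simp
      have "[1..<Suc m'] ! j = Suc j" "[1..<Suc m] ! j = Suc j"
        using \<open>j < m\<close> mm by (simp_all add: nth_upt del: upt_Suc)
      moreover have "?h (Suc j) < v (r + Suc j)" using hole_ge[of "Suc j"] Cons.prems(7) by simp
      ultimately show "map ?h [1..<Suc m'] ! j < map (\<lambda>j. v (r + j)) [1..<Suc m] ! j"
        using \<open>j < m\<close> mm by (simp del: upt_Suc)
    qed
    ultimately show ?thesis using cR by simp
  qed
  have finA: "finite ?A" by (rule finite_subset[of _ "Pow {1..B}"]) auto
  have row: "Uword B r (sorted_list_of_set R) G v =
        (if R = ?Q then G (word_perm (rev (sorted_list_of_set R)) \<circ> v) else 0) \<and>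
      (R = ?Q \<longrightarrow> (word_perm (rev (sorted_list_of_set R)) \<circ> v) permutes {1..B} \<and>
        shuffle r (word_perm (rev (sorted_list_of_set R)) \<circ> v) \<and>
        (\<forall>j\<ge>1. (word_perm (rev (sorted_list_of_set R)) \<circ> v) (r + j) =
          (if j \<le> m' then v (r + j) - 1 else v (r + j))))"
    if R: "R \<in> ?A" for R and G :: "(nat \<Rightarrow> nat) \<Rightarrow> 'a"
  proof -
    have fR: "finite R" using R finite_subset[of R "{1..B}"] by auto
    let ?ks = "sorted_list_of_set R"
    have len: "length ?ks = m'" using R by simp
    have iff: "?ks = map ?h [Suc 0..<Suc (0 + length ?ks)] \<longleftrightarrow> R = ?Q"
    proof
      assume e: "?ks = map ?h [Suc 0..<Suc (0 + length ?ks)]"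
      have "set ?ks = set (map ?h [Suc 0..<Suc (0 + m')])" using arg_cong[OF e, of set] unfolding len .
      then show "R = ?Q" using fR by (auto simp del: upt_Suc simp: atLeastLessThanSuc_atLeastAtMost)
    next
      assume "R = ?Q"
      then show "?ks = map ?h [Suc 0..<Suc (0 + length ?ks)]" using sR len by (simp del: upt_Suc)
    qed
    have "Uword B r ?ks G v = (if ?ks = map ?h [Suc 0..<Suc (0 + length ?ks)]
        then G (word_perm (rev ?ks) \<circ> v) else 0) \<and>
      (?ks = map ?h [Suc 0..<Suc (0 + length ?ks)] \<longrightarrow>
        (word_perm (rev ?ks) \<circ> v) permutes {1..B} \<and> shuffle r (word_perm (rev ?ks) \<circ> v) \<and>
        (\<forall>j\<ge>1. (word_perm (rev ?ks) \<circ> v) (r + j) =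
          (if 0 < j \<and> j \<le> 0 + length ?ks then v (r + j) - 1 else v (r + j))))"
    proof (rule Uword_shuffle_row[OF v sh Cons.prems(3), of 0 ?ks m])
      show "?ks ! i < v (r + Suc (0 + i))" if "i < length ?ks" "Suc (0 + i) \<le> m" for i
      proof -
        have "?ks ! i < sorted_list_of_set ?P ! i"
          using R that cR0 unfolding row_less_def by auto
        moreover have "[1..<Suc m] ! i = Suc i" using that by (simp add: nth_upt del: upt_Suc)
        ultimately show ?thesis unfolding sR0 using that by (simp del: upt_Suc)
      qed
    qed (use R fR m'B Cons.prems(4) in auto)
    note X = this[unfolded iff]
    show ?thesis
    proof (intro conjI impI allI)
      show "Uword B r ?ks G v = (if R = ?Q then G (word_perm (rev ?ks) \<circ> v) else 0)"
        using X by (rule conjunct1)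
      assume e: "R = ?Q"
      note Y = mp[OF conjunct2[OF X] e]
      show "(word_perm (rev ?ks) \<circ> v) permutes {1..B}" using Y by (rule conjunct1)
      show "shuffle r (word_perm (rev ?ks) \<circ> v)" using conjunct2[OF Y] by (rule conjunct1)
      fix j :: nat assume "1 \<le> j"
      then have "(word_perm (rev ?ks) \<circ> v) (r + j) =
          (if 0 < j \<and> j \<le> 0 + length ?ks then v (r + j) - 1 else v (r + j))"
        using conjunct2[OF conjunct2[OF Y]] by blast
      also have "\<dots> = (if j \<le> m' then v (r + j) - 1 else v (r + j))"
        unfolding len using \<open>1 \<le> j\<close> by simp
      finally show "(word_perm (rev ?ks) \<circ> v) (r + j) = (if j \<le> m' then v (r + j) - 1 else v (r + j))" .
    qed
  qed
  define v' where "v' = word_perm (rev (sorted_list_of_set ?Q)) \<circ> v"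
  have v': "v' permutes {1..B}" "shuffle r v'" "\<And>j. 1 \<le> j \<Longrightarrow> v' (r + j) = (if j \<le> m' then v (r + j) - 1 else v (r + j))"
  proof -
    note Y = mp[OF conjunct2[OF row[OF RA, of g]] refl, folded v'_def]
    show "v' permutes {1..B}" "shuffle r v'" by (rule conjunct1[OF Y], rule conjunct1[OF conjunct2[OF Y]])
    show "v' (r + j) = (if j \<le> m' then v (r + j) - 1 else v (r + j))" if "1 \<le> j" for j
      using conjunct2[OF conjunct2[OF Y]] that by blast
  qed
  have R_eq: "?Q = (\<lambda>j. v' (r + j)) ` {1..m'}" using v'(3) by (intro image_cong) auto
  have IH: "\<exists>u. u permutes {1..B} \<and> shuffle r u \<and>
    (\<forall>j\<ge>1. u (r + j) + length (filter (\<lambda>m. j \<le> m) ms) = v' (r + j)) \<and>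
    (\<Sum>Rs\<in>row_chains B ((\<lambda>j. v' (r + j)) ` {1..m'}) ms. Uword B r (rows_word Rs) g v') = g u"
  proof (rule Cons.IH[OF v'(1,2) Cons.prems(3)])
    show "v' (r + j) = r + j" if "m' < j" for j using v'(3)[of j] Cons.prems(4)[of j] that mm by simp
    show "sorted (m' # ms)" using Cons.prems(5) by simp
    show "r + m'' \<le> B" if "m'' \<in> set ms" for m'' using Cons.prems(6) that by simp
    show "length ms < v' (r + 1)" using Cons.prems(7) v'(3)[of 1] by auto
  qed
  then obtain u where u: "u permutes {1..B}" "shuffle r u"
    "\<And>j. 1 \<le> j \<Longrightarrow> u (r + j) + length (filter (\<lambda>m. j \<le> m) ms) = v' (r + j)"
    "(\<Sum>Rs\<in>row_chains B ?Q ms. Uword B r (rows_word Rs) g v') = g u"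
    unfolding R_eq by blast
  have inj: "inj_on (\<lambda>(R, Rs). R # Rs) X" for X :: "(nat set \<times> nat set list) set" by (auto simp: inj_on_def)
  have "(\<Sum>Rs\<in>row_chains B ?P (m' # ms). Uword B r (rows_word Rs) g v) =
      (\<Sum>p\<in>(SIGMA R : ?A. row_chains B R ms). Uword B r (sorted_list_of_set (fst p)) (Uword B r (rows_word (snd p)) g) v)"
    unfolding row_chains_Cons by (subst sum.reindex[OF inj]) (simp add: split_def rows_word_def Uword_append)
  also have "\<dots> = (\<Sum>R\<in>?A. \<Sum>Rs\<in>row_chains B R ms. Uword B r (sorted_list_of_set R) (Uword B r (rows_word Rs) g) v)"
    using finA finite_row_chains by (subst sum.Sigma) (auto simp: split_def)
  also have "\<dots> = (\<Sum>R\<in>?A. if R = ?Q then g u else 0)"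
  proof (rule sum.cong[OF refl])
    fix R assume R: "R \<in> ?A"
    have "(\<Sum>Rs\<in>row_chains B R ms. Uword B r (sorted_list_of_set R) (Uword B r (rows_word Rs) g) v) =
        Uword B r (sorted_list_of_set R) (\<lambda>v. \<Sum>Rs\<in>row_chains B R ms. Uword B r (rows_word Rs) g v) v"
      by (simp add: Uword_sum)
    also have "\<dots> = (if R = ?Q then g u else 0)"
      using row[OF R, of "\<lambda>v. \<Sum>Rs\<in>row_chains B R ms. Uword B r (rows_word Rs) g v"] u(4)
      unfolding v'_def by auto
    finally show "(\<Sum>Rs\<in>row_chains B R ms. Uword B r (sorted_list_of_set R) (Uword B r (rows_word Rs) g) v) =
        (if R = ?Q then g u else 0)" .
  qed
  also have "\<dots> = g u" using finA RA by (subst sum.delta) auto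
  finally have total: "(\<Sum>Rs\<in>row_chains B ?P (m' # ms). Uword B r (rows_word Rs) g v) = g u" .
  have "u (r + j) + length (filter (\<lambda>m. j \<le> m) (m' # ms)) = v (r + j)" if "1 \<le> j" for j
    using u(3)[OF that] v'(3)[OF that] hole_ge[OF that] Cons.prems(7) by auto
  then show ?case using u(1,2) total by blast
qed

section \<open>Recognizing v(\<lambda>, r) by its values beyond r\<close>

lemma card_less_values:
  assumes u: "u permutes {1..B}" and k: "k \<in> {1..B}"
  shows "card {p \<in> {1..B}. u p < k} = k - 1"
proof -
  have "u ` {p \<in> {1..B}. u p < k} = {1..<k}"
  proof (intro set_eqI iffI)
    fix x assume "x \<in> {1..<k}"
    moreover have "x \<in> u ` {1..B}" unfolding permutes_image[OF u] using \<open>x \<in> {1..<k}\<close> k by auto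
    ultimately show "x \<in> u ` {p \<in> {1..B}. u p < k}" by auto
  next
    fix x assume x: "x \<in> u ` {p \<in> {1..B}. u p < k}"
    then have "x \<in> u ` {1..B}" by blast
    then have "x \<in> {1..B}" unfolding permutes_image[OF u] .
    then show "x \<in> {1..<k}" using x by auto
  qed
  moreover have "card (u ` {p \<in> {1..B}. u p < k}) = card {p \<in> {1..B}. u p < k}"
    by (rule card_image[OF inj_on_subset[OF permutes_inj[OF u] subset_UNIV]])
  ultimately show ?thesis by simp
qed

lemma initial_segment:
  assumes "finite S" "0 \<notin> S" "\<And>i j. j \<in> S \<Longrightarrow> 1 \<le> i \<Longrightarrow> i \<le> j \<Longrightarrow> i \<in> (S :: nat set)"
  shows "S = {1..card S}"
proof (cases "S = {}")
  case False
  have "S = {1..Max S}"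
  proof (intro set_eqI iffI)
    fix x assume "x \<in> S"
    then show "x \<in> {1..Max S}" using Max_ge[OF assms(1), of x] assms(2) by (cases x) auto
  next
    fix x assume "x \<in> {1..Max S}"
    then show "x \<in> S" using assms(3)[OF Max_in[OF assms(1) False], of x] by simp
  qed
  then have "card S = Max S" using card_atLeastAtMost[of 1 "Max S"] by simp
  then show ?thesis using \<open>S = {1..Max S}\<close> by simp
qed simp

text \<open>The quotient of the two permutations fixes {1..r} pointwise and is increasing beyond r,
  hence is the identity.\<close>

lemma shuffle_unique:
  assumes v1: "v1 \<in> S_inf" "shuffle r v1" and v2: "v2 \<in> S_inf" "shuffle r v2"
    and eq: "\<And>p. p \<in> {1..r} \<Longrightarrow> v1 p = v2 p"
  shows "v1 = v2"
proof -
  have p1: "v1 permutes {1..}" and p2: "v2 permutes {1..}" using v1(1) v2(1) by (auto simp: S_inf_def)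
  define f where "f = inv v1 \<circ> v2"
  have f: "f permutes {1..}" unfolding f_def by (rule permutes_compose[OF p2 permutes_inv[OF p1]])
  have v1f: "v1 (f x) = v2 x" for x unfolding f_def o_apply by (rule permutes_inverses(1)[OF p1])
  have fix_p: "f p = p" if "p \<le> r" for p
  proof (cases "p = 0")
    case True
    then show ?thesis using permutes_not_in[OF f, of 0] by simp
  next
    case False
    then have "v1 (f p) = v1 p" using v1f eq[of p] that by simp
    then show ?thesis using permutes_inj[OF p1] by (simp add: inj_eq)
  qed
  have above: "r < f x" if "r < x" for x
  proof (rule ccontr)
    assume n: "\<not> r < f x"
    then have "f (f x) = f x" by (intro fix_p) simp
    then have "f x = x" using permutes_inj[OF f] by (simp add: inj_eq)
    then show False using n that by simp
  qed
  have "f x < f y" if "x < y" for x y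
  proof (cases "r < x")
    case True
    have "v1 (f x) < v1 (f y)"
      unfolding v1f by (rule semi_shuffle_less[OF shuffle_semi_shuffle[OF v2(2)] True that])
    then have "\<not> f y < f x" "f x \<noteq> f y"
      using semi_shuffle_less[OF shuffle_semi_shuffle[OF v1(2)], of "f y" "f x"] above[of y] True that by auto
    then show ?thesis by simp
  next
    case False
    then have "f x = x" by (intro fix_p) simp
    moreover have "x < f y"
    proof (cases "r < y")
      case True
      then show ?thesis using above[of y] False by simp
    next
      case False
      then show ?thesis using fix_p[of y] that by simp
    qed
    ultimately show ?thesis by simp
  qed
  then have "f = id" by (intro strict_mono_permutes_id[OF f]) (simp add: strict_mono_def)
  then show ?thesis using v1f by auto
qed

text \<open>The values of a shuffle at positions \<open>> r\<close> determine the conjugate partition.\<close>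

lemma shuffle_of_eqI:
  assumes lam: "is_partition lam" "num_parts lam \<le> r" and u: "u permutes {1..B}" "shuffle r u" and r: "r \<le> B"
    and holes: "\<And>x. 1 \<le> x \<Longrightarrow> u (r + x) + card {i. 1 \<le> i \<and> x \<le> lam i} = r + x"
  shows "shuffle_of lam r = u"
proof -
  define c where "c x = card {i. 1 \<le> i \<and> x \<le> lam i}" for x
  have sub: "{i. 1 \<le> i \<and> x \<le> lam i} \<subseteq> {1..num_parts lam}" if "1 \<le> x" for x
    unfolding partition_support[OF lam(1), symmetric] using that by auto
  have seg: "x \<le> lam i \<longleftrightarrow> i \<le> c x" if "1 \<le> x" "1 \<le> i" for x i
  proof -
    have "{i. 1 \<le> i \<and> x \<le> lam i} = {1..c x}" unfolding c_def
    proof (rule initial_segment)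
      show "finite {i. 1 \<le> i \<and> x \<le> lam i}" by (rule finite_subset[OF sub[OF that(1)]]) simp
      show "i \<in> {i. 1 \<le> i \<and> x \<le> lam i}" if "j \<in> {i. 1 \<le> i \<and> x \<le> lam i}" "1 \<le> i" "i \<le> j" for i j
        using partition_antimono[OF lam(1) that(2,3)] that by auto
    qed simp
    then have "i \<in> {i. 1 \<le> i \<and> x \<le> lam i} \<longleftrightarrow> i \<in> {1..c x}" by simp
    then show ?thesis using that(2) by simp
  qed
  have cr: "c x \<le> r" if "1 \<le> x" for x
    using card_mono[OF _ sub[OF that]] lam(2) unfolding c_def by simp
  have hole_less: "u (r + x) < u (r + y) \<longleftrightarrow> x < y" if "1 \<le> x" "1 \<le> y" for x y
    using semi_shuffle_less[OF shuffle_semi_shuffle[OF u(2)], of "r + x" "r + y"]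
      semi_shuffle_less[OF shuffle_semi_shuffle[OF u(2)], of "r + y" "r + x"] that
    by (cases x y rule: linorder_cases) auto
  have left_less: "u p < u q \<longleftrightarrow> p < q" if "p \<in> {1..r}" "q \<in> {1..r}" for p q
    using shuffle_less[OF u(2), of p q] shuffle_less[OF u(2), of q p] that
    by (cases p q rule: linorder_cases) auto
  have split: "card {p \<in> {1..B}. u p < k} = card {p \<in> {1..r}. u p < k} + card {x \<in> {1..B - r}. u (r + x) < k}" for k
  proof -
    have "{p \<in> {1..B}. u p < k} = {p \<in> {1..r}. u p < k} \<union> (+) r ` {x \<in> {1..B - r}. u (r + x) < k}"
    proof (intro set_eqI iffI)
      fix p assume p: "p \<in> {p \<in> {1..B}. u p < k}"
      show "p \<in> {p \<in> {1..r}. u p < k} \<union> (+) r ` {x \<in> {1..B - r}. u (r + x) < k}"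
      proof (cases "p \<le> r")
        case False
        then have "p = r + (p - r)" "p - r \<in> {x \<in> {1..B - r}. u (r + x) < k}" using p by auto
        then show ?thesis by blast
      qed (use p in auto)
    qed (use r in auto)
    moreover have "card ((+) r ` {x \<in> {1..B - r}. u (r + x) < k}) = card {x \<in> {1..B - r}. u (r + x) < k}"
      by (rule card_image) simp
    moreover have "card ({p \<in> {1..r}. u p < k} \<union> (+) r ` {x \<in> {1..B - r}. u (r + x) < k}) =
        card {p \<in> {1..r}. u p < k} + card ((+) r ` {x \<in> {1..B - r}. u (r + x) < k})"
      by (rule card_Un_disjoint) auto
    ultimately show ?thesis by simp
  qed
  \<comment> \<open>Of the values below u (r + x), exactly x - 1 stand beyond r, so r - c x of them
    stand in the first r positions. As u increases there, they occupy the first r - c x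
    positions.\<close>
  have cross: "u (r + x) < u p \<longleftrightarrow> x \<le> lam (r + 1 - p)" if x: "x \<in> {1..B - r}" and p: "p \<in> {1..r}" for x p
  proof -
    have inB: "u (r + x) \<in> {1..B}" unfolding permutes_in_image[OF u(1)] using x by auto
    have "{y \<in> {1..B - r}. u (r + y) < u (r + x)} = {1..<x}" using hole_less x by auto
    then have "card {p \<in> {1..r}. u p < u (r + x)} + (x - 1) = u (r + x) - 1"
      using split[of "u (r + x)"] card_less_values[OF u(1) inB] by simp
    then have card: "card {p \<in> {1..r}. u p < u (r + x)} = r - c x"
      using holes[of x] x inB unfolding c_def by auto
    have "{p \<in> {1..r}. u p < u (r + x)} = {1..card {p \<in> {1..r}. u p < u (r + x)}}"
    proof (rule initial_segment)
      fix i j assume "j \<in> {p \<in> {1..r}. u p < u (r + x)}" "1 \<le> i" "i \<le> j"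
      then show "i \<in> {p \<in> {1..r}. u p < u (r + x)}"
        using left_less[of i j] by (cases "i = j") auto
    qed auto
    then have "p \<in> {p \<in> {1..r}. u p < u (r + x)} \<longleftrightarrow> p \<in> {1..r - c x}" unfolding card by simp
    then have "u p < u (r + x) \<longleftrightarrow> p \<le> r - c x" using p by simp
    moreover have "u p \<noteq> u (r + x)" using permutes_inj[OF u(1)] p x by (auto simp: inj_eq)
    ultimately have "u (r + x) < u p \<longleftrightarrow> \<not> p \<le> r - c x" by auto
    also have "\<dots> \<longleftrightarrow> r + 1 - p \<le> c x" using cr[of x] p x by auto
    also have "\<dots> \<longleftrightarrow> x \<le> lam (r + 1 - p)" by (rule seg[symmetric]) (use p x in auto)
    finally show ?thesis .
  qed
  \<comment> \<open>The values below u p are the p - 1 values to its left and the holes below it,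
    which number lam (r + 1 - p).\<close>
  have val: "u p = p + lam (r + 1 - p)" if p: "p \<in> {1..r}" for p
  proof -
    have inB: "u p \<in> {1..B}" unfolding permutes_in_image[OF u(1)] using p r by auto
    have "lam (r + 1 - p) \<le> B - r"
    proof (cases "lam (r + 1 - p) = 0")
      case False
      then have "r + 1 - p \<le> c (lam (r + 1 - p))" by (intro seg[THEN iffD1]) (use p in auto)
      then have "c (lam (r + 1 - p)) \<noteq> 0" using p by auto
      then have "u (r + lam (r + 1 - p)) \<noteq> r + lam (r + 1 - p)"
        using holes[of "lam (r + 1 - p)"] False unfolding c_def by auto
      then have "r + lam (r + 1 - p) \<in> {1..B}" using permutes_not_in[OF u(1)] by blast
      then show ?thesis by auto
    qed simp
    then have "{x \<in> {1..B - r}. u (r + x) < u p} = {1..lam (r + 1 - p)}" using cross p by auto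
    moreover have "{q \<in> {1..r}. u q < u p} = {1..<p}" using left_less p by auto
    ultimately have "u p - 1 = p - 1 + lam (r + 1 - p)"
      using split[of "u p"] card_less_values[OF u(1) inB] by simp
    then show ?thesis using inB p by auto
  qed
  show ?thesis unfolding shuffle_of_def
  proof (rule the_equality, intro conjI ballI)
    show uS: "u \<in> S_inf" by (rule permutes_S_inf[OF u(1)])
    show "shuffle r u" by (rule u(2))
    show "int (lam j) = int (u (r + 1 - j)) - int r - 1 + int j" if "j \<in> {1..r}" for j
    proof -
      have j: "r + 1 - (r + 1 - j) = j" "r + 1 - j \<in> {1..r}" using that by auto
      have "u (r + 1 - j) = r + 1 - j + lam j" using val[OF j(2)] unfolding j(1) .
      then show ?thesis using that by auto
    qed
    fix v assume v: "v \<in> S_inf \<and> shuffle r v \<and> (\<forall>j\<in>{1..r}. int (lam j) = int (v (r + 1 - j)) - int r - 1 + int j)"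
    show "v = u"
    proof (rule shuffle_unique)
      fix p assume p: "p \<in> {1..r}"
      then have "r + 1 - p \<in> {1..r}" "r + 1 - (r + 1 - p) = p" by auto
      then have "int (lam (r + 1 - p)) = int (v p) - int r - 1 + int (r + 1 - p)" using v by metis
      then show "v p = u p" using val[OF p] p by auto
    qed (use v uS u(2) in auto)
  qed
qed

lemma good_configs_row_chains:
  "good_configs B N (\<lambda>i. lam (N - i) + i) = row_chains B {} (map (\<lambda>i. lam (N - i)) [0..<N])"
proof (intro set_eqI)
  fix Rs
  have empty: "row_less {} R" for R by (simp add: row_less_def)
  have succ: "successively row_less ({} # Rs) \<longleftrightarrow> successively row_less Rs"
    by (auto simp: successively_Cons empty)
  have "Rs \<in> good_configs B N (\<lambda>i. lam (N - i) + i) \<longleftrightarrow> Rs \<in> row_configs B N \<and>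
      (\<forall>j<N. card (Rs ! j) = lam (N - j)) \<and> (\<forall>i. Suc i < N \<longrightarrow> row_less (Rs ! i) (Rs ! Suc i))"
    unfolding good_configs_def sized_configs_def row_less_def using no_violation_iff[of Rs B N] by auto
  also have "\<dots> \<longleftrightarrow> Rs \<in> row_chains B {} (map (\<lambda>i. lam (N - i)) [0..<N])"
    unfolding row_chains_def mem_Collect_eq succ
    by (auto simp: row_configs_def successively_conv_nth list_all2_conv_all_nth all_set_conv_all_nth)
  finally show "Rs \<in> good_configs B N (\<lambda>i. lam (N - i) + i) \<longleftrightarrow> Rs \<in> row_chains B {} (map (\<lambda>i. lam (N - i)) [0..<N])" .
qed

section \<open>The multiplier D and the expansion of the product\<close>

lemma length_boxes: "length (boxes lam) = (\<Sum>j<num_parts lam. lam (num_parts lam - j))"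
proof -
  have "length (boxes lam) = sum_list (map lam (rev [1..<Suc (num_parts lam)]))"
    unfolding boxes_def by (simp add: length_concat comp_def del: upt_Suc)
  also have "\<dots> = (\<Sum>i\<in>{1..num_parts lam}. lam i)"
    by (subst sum_list_distinct_conv_sum_set) (auto simp del: upt_Suc simp: atLeastLessThanSuc_atLeastAtMost)
  also have "\<dots> = (\<Sum>j<num_parts lam. lam (num_parts lam - j))"
    by (rule sum.reindex_bij_witness[of _ "\<lambda>i. num_parts lam - i" "\<lambda>i. num_parts lam - i"]) auto
  finally show ?thesis .
qed

text \<open>The chain of rows starts with the empty set, which constrains nothing. Hole x is lowered
  once for each part \<ge> x, that is, by a part of the conjugate partition, and
  \<open>shuffle_of_eqI\<close> identifies the result.\<close>

lemma strict_fillings_id: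
  fixes g :: "(nat \<Rightarrow> nat) \<Rightarrow> 'a::comm_ring_1"
  assumes lam: "is_partition lam" and N: "num_parts lam \<le> r" and B: "r + length (boxes lam) \<le> B"
  shows "(\<Sum>F\<in>strict_fillings B lam. Uword B r (map F (boxes lam)) g id) = g (shuffle_of lam r)"
proof -
  define N where "N = num_parts lam"
  define ms where "ms = map (\<lambda>i. lam (N - i)) [0..<N]"
  have mem: "\<exists>i<N. m = lam (N - i)" if "m \<in> set ms" for m using that by (auto simp: ms_def)
  have "\<exists>u. u permutes {1..B} \<and> shuffle r u \<and> (\<forall>j\<ge>1. u (r + j) + length (filter (\<lambda>m. j \<le> m) ms) = id (r + j)) \<and>
    (\<Sum>Rs\<in>row_chains B ((\<lambda>j. id (r + j)) ` {1..0}) ms. Uword B r (rows_word Rs) g id) = g u"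
  proof (rule sum_row_chains_shuffle)
    show "sorted (0 # ms)"
      unfolding ms_def using partition_antimono[OF lam] by (auto simp: sorted_iff_nth_mono)
    show "r + m' \<le> B" if m': "m' \<in> set ms" for m'
    proof -
      obtain i where i: "i < N" "m' = lam (N - i)" using mem[OF m'] by blast
      have "lam (N - i) \<le> (\<Sum>j<N. lam (N - j))"
        by (rule member_le_sum[of i "{..<N}" "\<lambda>j. lam (N - j)"]) (use i in auto)
      then show ?thesis using B i unfolding length_boxes N_def by simp
    qed
    show "length ms < id (r + 1)" using N by (simp add: ms_def N_def)
    show "id permutes {1..B}" by (rule permutes_id)
  qed (use B in \<open>auto simp: shuffle_def\<close>)
  then obtain u where u: "u permutes {1..B}" "shuffle r u"
    "\<And>j. 1 \<le> j \<Longrightarrow> u (r + j) + length (filter (\<lambda>m. j \<le> m) ms) = r + j"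
    "(\<Sum>Rs\<in>row_chains B {} ms. Uword B r (rows_word Rs) g id) = g u" by auto
  have "shuffle_of lam r = u"
  proof (rule shuffle_of_eqI[OF lam N u(1,2)])
    fix x :: nat assume x: "1 \<le> x"
    have "length (filter (\<lambda>m. x \<le> m) ms) = card {j \<in> {..<N}. x \<le> lam (N - j)}"
      unfolding ms_def by (simp add: length_filter_conv_card) (rule arg_cong[of _ _ card], auto)
    also have "\<dots> = card {i. 1 \<le> i \<and> x \<le> lam i}"
    proof (rule bij_betw_same_card[OF bij_betw_byWitness[of _ "\<lambda>i. N - i" "\<lambda>i. N - i"]])
      have "i \<le> N" if "1 \<le> i" "x \<le> lam i" for i
        using partition_part_pos[OF lam that(1)] that x by (simp add: N_def)
      then show "(\<lambda>i. N - i) ` {i. 1 \<le> i \<and> x \<le> lam i} \<subseteq> {j \<in> {..<N}. x \<le> lam (N - j)}"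
        "\<forall>i\<in>{i. 1 \<le> i \<and> x \<le> lam i}. N - (N - i) = i" by force+
    qed auto
    finally show "u (r + x) + card {i. 1 \<le> i \<and> x \<le> lam i} = r + x" using u(3)[OF x] by simp
  qed (use B in simp)
  moreover have "(\<Sum>F\<in>strict_fillings B lam. Uword B r (map F (boxes lam)) g id) =
      (\<Sum>Rs\<in>good_configs B N (\<lambda>i. lam (N - i) + i). Uword B r (rows_word Rs) g id)"
    by (rule sum_good_configs[OF lam N_def])
  ultimately show ?thesis using u(4) unfolding good_configs_row_chains ms_def by simp
qed

text \<open>D has to be chosen before w, n and B, because it is evaluated at the identity
  afterwards. For a nonempty hook the hook polynomial serves every w. The empty partition gets D =
  1. In the remaining case w is a semi-shuffle and the determinant applies.\<close>

lemma strict_fillings_pieri: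
  assumes lam: "is_partition lam"
  obtains D where "\<And>w n B. w permutes {1..n} \<Longrightarrow> r \<le> n \<Longrightarrow> n + length (boxes lam) \<le> B \<Longrightarrow>
    semi_shuffle r w \<or> hook lam \<Longrightarrow>
    (\<Sum>F\<in>strict_fillings B lam. Uword B r (map F (boxes lam)) schubert w) = D * schubert w"
proof (cases "hook lam \<and> num_parts lam \<noteq> 0")
  case True
  then obtain b where b: "hook lam" "num_parts lam = Suc b" by (cases "num_parts lam") auto
  show ?thesis by (rule that[of "hook_poly r b (lam 1)"]) (rule hook_case[OF lam b])
next
  case False
  define N where "N = num_parts lam"
  define \<beta> where "\<beta> i = lam (N - i) + i" for i
  have \<beta>_less: "\<beta> i < \<beta> j" if "i < j" "j < N" for i j
  proof -
    have "lam (N - i) \<le> lam (N - j)" by (rule partition_antimono[OF lam]) (use that in auto)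
    then show ?thesis using that unfolding \<beta>_def by simp
  qed
  have size: "(\<Sum>j<N. \<beta> j - j) = length (boxes lam)" by (simp add: \<beta>_def N_def length_boxes)
  have fillings: "(\<Sum>F\<in>strict_fillings B lam. Uword B r (map F (boxes lam)) schubert w) =
      (\<Sum>Rs\<in>good_configs B N \<beta>. Uword B r (rows_word Rs) schubert w)" for B w
    unfolding \<beta>_def by (rule sum_good_configs[OF lam N_def])
  show ?thesis
  proof (cases "N = 0")
    case True
    have "good_configs B 0 \<beta> = {[]}" for B
      by (auto simp: good_configs_def sized_configs_def row_configs_def violates_def)
    then show ?thesis using True fillings by (intro that[of 1]) (simp add: rows_word_def)
  next
    case N: False
    show ?thesis
    proof (rule that[of "jacobi_trudi r N \<beta>"])
      fix w n B assume "w permutes {1..n}" "r \<le> n" "n + length (boxes lam) \<le> B" "semi_shuffle r w \<or> hook lam"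
      then show "(\<Sum>F\<in>strict_fillings B lam. Uword B r (map F (boxes lam)) schubert w) =
          jacobi_trudi r N \<beta> * schubert w"
        unfolding fillings using False N \<beta>_less size N_def by (intro jacobi_trudi_pieri) auto
    qed
  qed
qed

lemma schubert_id: "schubert id = 1"
proof -
  have "id permutes {1..0}" by (rule permutes_id)
  from schubert_eq_rcop[OF this] show ?thesis by (simp add: stair_def id_indicator_def)
qed

text \<open>\<open>lr_coeff\<close> is a definite description, so an expansion determines it only
  together with uniqueness, which \<open>schubert_independent\<close> gives on the union of both
  supports.\<close>

lemma lr_coeff_eqI:
  assumes F: "finite F" "F \<subseteq> S_inf" and c: "\<And>u. u \<notin> F \<Longrightarrow> c u = 0"
    and eq: "schubert w * schubert v = (\<Sum>u\<in>F. of_int (c u) * schubert u)"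
  shows "lr_coeff w v u = c u"
proof -
  define C where "C = Abs_poly_mapping c"
  have fin: "finite {u. c u \<noteq> 0}" by (rule finite_subset[OF _ F(1)]) (use c in auto)
  have lookup: "Poly_Mapping.lookup C = c" unfolding C_def by (rule lookup_Abs_poly_mapping[OF fin])
  have keys: "Poly_Mapping.keys C \<subseteq> F" using c unfolding lookup[symmetric] by (auto simp: in_keys_iff)
  have extend: "(\<Sum>u\<in>Poly_Mapping.keys d. of_int (Poly_Mapping.lookup d u) * schubert u) =
      (\<Sum>u\<in>G. of_int (Poly_Mapping.lookup d u) * schubert u)"
    if "finite G" "Poly_Mapping.keys d \<subseteq> G" for d G
    by (rule sum.mono_neutral_left[OF that]) (auto simp: in_keys_iff)
  have "(THE c :: (nat \<Rightarrow> nat) \<Rightarrow>\<^sub>0 int. Poly_Mapping.keys c \<subseteq> S_inf \<and>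
     schubert w * schubert v = (\<Sum>u\<in>Poly_Mapping.keys c. of_int (Poly_Mapping.lookup c u) * schubert u)) = C"
  proof (rule the_equality, intro conjI)
    show "Poly_Mapping.keys C \<subseteq> S_inf" using keys F(2) by blast
    show C: "schubert w * schubert v = (\<Sum>u\<in>Poly_Mapping.keys C. of_int (Poly_Mapping.lookup C u) * schubert u)"
      using extend[OF F(1) keys] eq unfolding lookup by simp
    fix d :: "(nat \<Rightarrow> nat) \<Rightarrow>\<^sub>0 int"
    assume d: "Poly_Mapping.keys d \<subseteq> S_inf \<and> schubert w * schubert v =
      (\<Sum>u\<in>Poly_Mapping.keys d. of_int (Poly_Mapping.lookup d u) * schubert u)"
    let ?G = "Poly_Mapping.keys d \<union> Poly_Mapping.keys C"
    have "(\<Sum>u\<in>?G. of_int (Poly_Mapping.lookup d u) * schubert u) = (\<Sum>u\<in>?G. of_int (Poly_Mapping.lookup C u) * schubert u)"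
      using extend[of ?G d] extend[of ?G C] d C by simp
    then have "(\<Sum>u\<in>?G. of_int (Poly_Mapping.lookup d u - Poly_Mapping.lookup C u) * schubert u) = 0"
      by (simp add: left_diff_distrib sum_subtractf)
    moreover have "?G \<subseteq> S_inf" using d keys F(2) by blast
    ultimately have "\<forall>u\<in>?G. Poly_Mapping.lookup d u - Poly_Mapping.lookup C u = 0"
      by (intro schubert_independent) auto
    then show "d = C"
      by (intro poly_mapping_eqI) (metis UnCI diff_eq_diff_eq diff_self in_keys_iff)
  qed
  then show ?thesis unfolding lr_coeff_def lookup[symmetric] by (rule arg_cong)
qed

theorem theorem2p4:
  fixes w u lam :: "nat \<Rightarrow> nat" and r :: nat
  assumes "w \<in> S_inf" and "u \<in> S_inf" and "r \<ge> 1"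
    and "is_partition lam" and "num_parts lam \<le> r"
    and "semi_shuffle r w \<or> hook lam"
  shows "finite (strict_chain_tableaux w lam r u) \<and>
    lr_coeff w (shuffle_of lam r) u = int (card (strict_chain_tableaux w lam r u))"
proof -
  note lam = assms(4)
  obtain m where "w permutes {1..m}" using S_inf_permutes[OF assms(1)] .
  \<comment> \<open>The index r may exceed the support of w.\<close>
  then have w: "w permutes {1..max m r}" by (rule permutes_subset) auto
  define B where "B = max m r + length (boxes lam)"
  define A where "A = strict_chains w lam r"
  define h where "h T = w \<circ> tableau_perm lam T" for T
  have finA: "finite A" unfolding A_def by (rule finite_strict_chains[OF lam w]) simp
  have chains: "strict_chain_tableaux w lam r x = {T \<in> A. h T = x}" for x
    by (auto simp: strict_chain_tableaux_def A_def strict_chains_def h_def)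
  have hS: "h T \<in> S_inf" if "T \<in> A" for T
  proof -
    have "T x \<in> {1..r} \<times> {r<..}" if "x \<in> diagram lam" for x
      using \<open>T \<in> A\<close> that unfolding A_def strict_chains_def transposition_tableaux_def by auto
    then have "set (map T (boxes lam)) \<subseteq> {1..} \<times> {1..}" unfolding set_map set_boxes[OF lam] by fastforce
    then show ?thesis unfolding h_def tableau_perm_eq by (rule S_inf_comp_pairs_perm[OF assms(1)])
  qed
  obtain D where D: "\<And>w n B. w permutes {1..n} \<Longrightarrow> r \<le> n \<Longrightarrow> n + length (boxes lam) \<le> B \<Longrightarrow>
    semi_shuffle r w \<or> hook lam \<Longrightarrow>
    (\<Sum>F\<in>strict_fillings B lam. Uword B r (map F (boxes lam)) schubert w) = D * schubert w"
    using strict_fillings_pieri[OF lam] by blast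
  \<comment> \<open>The identity is a semi-shuffle for every r, so D may be evaluated there in the
    hook case as well.\<close>
  have "D * schubert id = schubert (shuffle_of lam r)"
    using D[of id r B] strict_fillings_id[OF lam assms(5), of B schubert]
    by (simp add: permutes_id B_def semi_shuffle_def)
  then have D_eq: "D = schubert (shuffle_of lam r)" by (simp add: schubert_id)
  have "(\<Sum>T\<in>A. schubert (h T)) = (\<Sum>F\<in>strict_fillings B lam. Uword B r (map F (boxes lam)) schubert w)"
    unfolding A_def h_def by (rule sum_strict_chains[OF lam w]) (auto simp: B_def)
  also have "\<dots> = D * schubert w" by (rule D[OF w]) (use assms(6) in \<open>auto simp: B_def\<close>)
  finally have "schubert w * schubert (shuffle_of lam r) = (\<Sum>T\<in>A. schubert (h T))"
    by (simp add: D_eq mult.commute)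
  also have "\<dots> = (\<Sum>x\<in>h ` A. \<Sum>T\<in>{T \<in> A. h T = x}. schubert (h T))"
    by (rule sum.image_gen[OF finA])
  also have "\<dots> = (\<Sum>x\<in>h ` A. of_int (int (card {T \<in> A. h T = x})) * schubert x)"
    by (rule sum.cong[OF refl]) simp
  finally have "lr_coeff w (shuffle_of lam r) u = int (card {T \<in> A. h T = u})"
    by (intro lr_coeff_eqI[of "h ` A"]) (use finA hS in \<open>auto intro!: Collect_empty_eq[THEN iffD2]\<close>)
  then show ?thesis unfolding chains using finA by simp
qed

end
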